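(* Assume the setting described in the context: noisy and noiseless tail data $\psi_0,\psi_1,\psi_{0*},\psi_{1*}$, functions $Q,Q_*\in H^{2,h}(\Omega_h)$ and the exact tail $V_*$ as described, with $\|Q-Q_*\|_{H^{2,h}(\Omega_h)}<\delta$, $\delta\in(0,\delta_0)$, $\delta_0\in(0,e^{-2(d+\xi)\lambda_0})$, and let $V=V_{\mu(\delta)}$ be the tail function defined there. Let $R>0$. Assume there exist $F,F_*\in H_3^h$ with $F=\phi_0$, $F_z=\phi_1$ on $\Gamma$, $F=0$ on $\partial\Omega\setminus\Gamma$, $F_*=\phi_{0*}$, $\partial_zF_*=\phi_{1*}$ on $\Gamma$, $F_*=0$ on $\partial\Omega\setminus\Gamma$ (for all $k\in[\underline{k},\overline{k}]$), and $\|F-F_*\|_{H_3^h}<\delta$, where $\delta\in(0,\delta_1)$ with $\delta_1\in(0,e^{-2(d+\xi)\lambda_1})$ and $\lambda_1$ is the number below. Then: (i) the functional $J_\lambda$ has a Fréchet derivative $J'_\lambda(p)\in H^h_{0,2}$ at every point $p\in H^h_{0,2}$; (ii) there exist numbers $\lambda_1=\lambda_1(\Omega_h,R,\|F_*\|_{H_3^h},\|V_*\|_{H^{2,h}(\Omega_h)},\underline{k},\overline{k})\ge\lambda_0$ and $C_1=C_1(\Omega_h,R,\|F_*\|_{H_3^h},\|V_*\|_{H^{2,h}(\Omega_h)},\underline{k},\overline{k})>0$, depending only on the listed parameters, such that for every $\lambda\ge\lambda_1$ the functional $J_\lambda$ is strictly convex on $\overline{B(R)}$; more precisely $$J_\lambda(p+r)-J_\lambda(p)-J'_\lambda(p)(r)\ge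 C_1\|r\|^2_{H_2^h}\quad\text{for all }p,\ p+r\in\overline{B(R)}.$$
   Context: Geometry and grid: $b,\xi,d>0$, $\Omega=\{|x|<b,|y|<b,-\xi<z<d\}$, $\Gamma=\{|x|<b,|y|<b,z=-\xi\}$; fixed grid step $h$, uniform grid $\{(x_j,y_s)\}_{j,s=1}^{N_h}\subset[-b,b]^2$; $\Omega_h=\{(x_j,y_s,z):z\in(-\xi,d)\}$. Semidiscrete functions are families $\{f(x_j,y_s,z)\}$ (possibly also depending on $k\in[\underline{k},\overline{k}]\subset(0,\infty)$); complex valued functions are identified with pairs of real valued functions, and all Hilbert spaces are real. At interior grid points ($|x_j|,|y_s|<b$): $u^h_{xx}=(u(x_j-h,y_s,z)-2u(x_j,y_s,z)+u(x_j+h,y_s,z))/h^2$, $\partial^h_xu=(u(x_j+h,y_s,z)-u(x_j-h,y_s,z))/(2h)$, similarly in $y$; $\Delta^hu=u_{zz}+u^h_{xx}+u^h_{yy}$, $\nabla^hu=(\partial^h_xu,\partial^h_yu,u_z)$; difference operators are evaluated only at interior grid points, and sums $\sum_{j,s}$ run over points where the summand is defined. For complex 3-vectors, $a\cdot b=\sum_i a_ib_i$. Boundary conditions on $\partial\Omega,\Gamma$ are imposed at the grid points on these sets. Spaces: $\|f\|^2_{H^{n,h}(\Omega_h)}=\sum_{j,s}\sum_{r=0}^nh^2\int_{-\xi}^d|\partial_z^rf(x_j,y_s,z)|^2dz$; $\|f\|^2_{H^h_n}=\int_{\underline{k}}^{\overline{k}}\|f(\cdot,k)\|^2_{H^{n,h}(\Omega_h)}dk$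 ($n=2,3$). $H_0^{2,h}(\Omega_h)$: $f\in H^{2,h}(\Omega_h)$ with $f=0$ on $\partial\Omega$ (zero at grid points on the boundary of $[-b,b]^2$ and at $z=-\xi,d$) and $f_z=0$ at $z=-\xi$. $H^h_{0,2}$: $f\in H_2^h$ with these conditions for every $k$. $B(R)=\{r\in H^h_{0,2}:\|r\|_{H_2^h}<R\}$. $J'_\lambda(p)(r)$ denotes the action of the Fréchet derivative (identified with an element of $H^h_{0,2}$ via the scalar product) on $r$. Weight $\varphi_\lambda(z)=e^{-2\lambda z}$. Carleman estimate: there exist $\lambda_0>1$, $C>0$ depending only on $\xi,d,h$ with $\sum_{j,s}h^2\int|\Delta^hu|^2\varphi_\lambda dz\ge C\sum_{j,s}h^2\int(|u_{zz}|^2+\lambda|u_z|^2+\lambda^3|u|^2)\varphi_\lambda dz$ for all $\lambda\ge\lambda_0$, $u\in H_0^{2,h}(\Omega_h)$. Tail: $Q\in H^{2,h}(\Omega_h)$ with $Q=\psi_0$, $Q_z=\psi_1$ on $\Gamma$, $Q=0$ on $\partial\Omega\setminus\Gamma$; $Q_*$ the same with noiseless data $\psi_{0*},\psi_{1*}$; $V_*\in H^{2,h}(\Omega_h)$ solves $\Delta^hV_*=0$ with $V_*=\psi_{0*}$, $\partial_zV_*=\psi_{1*}$ on $\Gamma$, $V_*=0$ on $\partial\Omega\setminus\Gamma$. For $\mu>0$ let $W_\mu$ be the unique minimizer over $H_0^{2,h}(\Omega_h)$ of $I_\mu(W)=e^{2\mu d}\sum_{j,s}h^2\int_{-\xi}^d|\Delta^hW+\Delta^hQ|^2\varphi_\mu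 dz$; set $\mu(\delta)=\ln(\delta^{-1/(2(d+\xi))})$ and $V_{\mu(\delta)}=W_{\mu(\delta)}+Q$. Operator: with tail $V$, for semidiscrete $q(\mathbf{x},k)$, $L^h(q)=\Delta^hq+2k\Big(\nabla^hV-\int_k^{\overline{k}}\nabla^hq(\kappa)d\kappa\Big)\cdot\Big(k\nabla^h(q+V)-\int_k^{\overline{k}}\nabla^hq(\kappa)d\kappa\Big)+2i\Big(kq_z+V_z-\int_k^{\overline{k}}q_z(\kappa)d\kappa\Big)$. Data $\phi_0,\phi_1$ (noisy) and $\phi_{0*},\phi_{1*}$ (noiseless) are given functions on $\Gamma\times[\underline{k},\overline{k}]$. Functional: $J_\lambda(p)=e^{2\lambda d}\sum_{j,s}h^2\int_{\underline{k}}^{\overline{k}}\int_{-\xi}^d|L^h(p+F)(x_j,y_s,z,\kappa)|^2\varphi_\lambda(z)dzd\kappa$, with $V=V_{\mu(\delta)}$ in $L^h$. *)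

theory Defs
  imports "HOL-Analysis.Analysis"
begin

(* ------------------------------------------------------------------
   Conventions.
   Grid: indices j,s in {0..N}, x_j = -b + j*h, y_s = -b + s*h, N*h = 2b.
   Interior grid points (|x_j|,|y_s| < b): 1 <= j,s <= N-1, i.e. {1..<N}.
   Semidiscrete function:   sfun = j => s => z => value
   k-dependent semidiscrete: kfun = j => s => z => k => value
   Complex values; real Hilbert structure via Re(a * cnj b).
   ------------------------------------------------------------------ *)

type_synonym sfun = "nat \<Rightarrow> nat \<Rightarrow> real \<Rightarrow> complex"
type_synonym kfun = "nat \<Rightarrow> nat \<Rightarrow> real \<Rightarrow> real \<Rightarrow> complex"

(* Sobolev chain on an interval [a,c]: D 0, ..., D n are the function and its
   z-derivatives up to order n: D i is absolutely continuous with
   D i z = D i a + int_a^z D (i+1) (i < n), and D n is square integrable.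
   This is the standard characterisation of H^n(a,c). *)
definition zchain :: "real \<Rightarrow> real \<Rightarrow> nat \<Rightarrow> (nat \<Rightarrow> real \<Rightarrow> complex) \<Rightarrow> bool" where
  "zchain a c n D \<longleftrightarrow>
     (\<forall>i<n. set_integrable lborel {a..c} (D (Suc i)) \<and>
            (\<forall>z\<in>{a..c}. D i z = D i a + (LINT t:{a..z}|lborel. D (Suc i) t))) \<and>
     set_borel_measurable lborel {a..c} (D n) \<and>
     set_integrable lborel {a..c} (\<lambda>z. (cmod (D n z))\<^sup>2)"

definition Hs_derivs :: "nat \<Rightarrow> real \<Rightarrow> real \<Rightarrow> nat \<Rightarrow> sfun \<Rightarrow> (nat \<Rightarrow> sfun) \<Rightarrow> bool" where
  "Hs_derivs N \<xi> d n f D \<longleftrightarrow>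
     (\<forall>j\<le>N. \<forall>s\<le>N. (\<forall>z\<in>{-\<xi>..d}. D 0 j s z = f j s z) \<and>
                    zchain (-\<xi>) d n (\<lambda>i. D i j s))"

definition Hs :: "nat \<Rightarrow> real \<Rightarrow> real \<Rightarrow> nat \<Rightarrow> sfun set" where
  "Hs N \<xi> d n = {f. \<exists>D. Hs_derivs N \<xi> d n f D}"

definition dzs :: "nat \<Rightarrow> real \<Rightarrow> real \<Rightarrow> nat \<Rightarrow> sfun \<Rightarrow> nat \<Rightarrow> sfun" where
  "dzs N \<xi> d n f = (SOME D. Hs_derivs N \<xi> d n f D)"

definition normHs :: "nat \<Rightarrow> real \<Rightarrow> real \<Rightarrow> real \<Rightarrow> nat \<Rightarrow> sfun \<Rightarrow> real" where
  "normHs N h \<xi> d n f = sqrt (\<Sum>j\<le>N. \<Sum>s\<le>N. \<Sum>r\<le>n.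
       h\<^sup>2 * (LINT z:{-\<xi>..d}|lborel. (cmod (dzs N \<xi> d n f r j s z))\<^sup>2))"

definition Hs0 :: "nat \<Rightarrow> real \<Rightarrow> real \<Rightarrow> sfun set" where
  "Hs0 N \<xi> d = {f \<in> Hs N \<xi> d 2.
      (\<forall>j\<le>N. \<forall>s\<le>N. (j = 0 \<or> j = N \<or> s = 0 \<or> s = N) \<longrightarrow> (\<forall>z\<in>{-\<xi>..d}. f j s z = 0)) \<and>
      (\<forall>j\<le>N. \<forall>s\<le>N. f j s (-\<xi>) = 0 \<and> f j s d = 0 \<and> dzs N \<xi> d 2 f 1 j s (-\<xi>) = 0)}"

definition sdiff :: "sfun \<Rightarrow> sfun \<Rightarrow> sfun" where
  "sdiff f g = (\<lambda>j s z. f j s z - g j s z)"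

definition sadd :: "sfun \<Rightarrow> sfun \<Rightarrow> sfun" where
  "sadd f g = (\<lambda>j s z. f j s z + g j s z)"

definition Hk_derivs :: "nat \<Rightarrow> real \<Rightarrow> real \<Rightarrow> real \<Rightarrow> real \<Rightarrow> nat \<Rightarrow> kfun \<Rightarrow> (nat \<Rightarrow> kfun) \<Rightarrow> bool" where
  "Hk_derivs N \<xi> d kl ku n f D \<longleftrightarrow>
     (\<forall>j\<le>N. \<forall>s\<le>N.
        (\<forall>k\<in>{kl..ku}. \<forall>z\<in>{-\<xi>..d}. D 0 j s z k = f j s z k) \<and>
        (\<forall>k\<in>{kl..ku}. zchain (-\<xi>) d n (\<lambda>i z. D i j s z k)) \<and>
        (\<forall>i\<le>n. set_borel_measurable lborel ({-\<xi>..d} \<times> {kl..ku}) (\<lambda>(z,k). D i j s z k) \<and>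
                set_integrable lborel ({-\<xi>..d} \<times> {kl..ku}) (\<lambda>(z,k). (cmod (D i j s z k))\<^sup>2)))"

definition Hk :: "nat \<Rightarrow> real \<Rightarrow> real \<Rightarrow> real \<Rightarrow> real \<Rightarrow> nat \<Rightarrow> kfun set" where
  "Hk N \<xi> d kl ku n = {f. \<exists>D. Hk_derivs N \<xi> d kl ku n f D}"

definition dzk :: "nat \<Rightarrow> real \<Rightarrow> real \<Rightarrow> real \<Rightarrow> real \<Rightarrow> nat \<Rightarrow> kfun \<Rightarrow> nat \<Rightarrow> kfun" where
  "dzk N \<xi> d kl ku n f = (SOME D. Hk_derivs N \<xi> d kl ku n f D)"

definition ipHk :: "nat \<Rightarrow> real \<Rightarrow> real \<Rightarrow> real \<Rightarrow> real \<Rightarrow> real \<Rightarrow> nat \<Rightarrow> kfun \<Rightarrow> kfun \<Rightarrow> real" where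
  "ipHk N h \<xi> d kl ku n f g = (\<Sum>j\<le>N. \<Sum>s\<le>N. \<Sum>r\<le>n.
       h\<^sup>2 * (LINT k:{kl..ku}|lborel. LINT z:{-\<xi>..d}|lborel.
          Re (dzk N \<xi> d kl ku n f r j s z k * cnj (dzk N \<xi> d kl ku n g r j s z k))))"

definition normHk :: "nat \<Rightarrow> real \<Rightarrow> real \<Rightarrow> real \<Rightarrow> real \<Rightarrow> real \<Rightarrow> nat \<Rightarrow> kfun \<Rightarrow> real" where
  "normHk N h \<xi> d kl ku n f = sqrt (\<Sum>j\<le>N. \<Sum>s\<le>N. \<Sum>r\<le>n.
       h\<^sup>2 * (LINT k:{kl..ku}|lborel. LINT z:{-\<xi>..d}|lborel. (cmod (dzk N \<xi> d kl ku n f r j s z k))\<^sup>2))"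

definition Hk02 :: "nat \<Rightarrow> real \<Rightarrow> real \<Rightarrow> real \<Rightarrow> real \<Rightarrow> kfun set" where
  "Hk02 N \<xi> d kl ku = {f \<in> Hk N \<xi> d kl ku 2. \<forall>k\<in>{kl..ku}.
      (\<forall>j\<le>N. \<forall>s\<le>N. (j = 0 \<or> j = N \<or> s = 0 \<or> s = N) \<longrightarrow> (\<forall>z\<in>{-\<xi>..d}. f j s z k = 0)) \<and>
      (\<forall>j\<le>N. \<forall>s\<le>N. f j s (-\<xi>) k = 0 \<and> f j s d k = 0 \<and> dzk N \<xi> d kl ku 2 f 1 j s (-\<xi>) k = 0)}"

definition kadd :: "kfun \<Rightarrow> kfun \<Rightarrow> kfun" where
  "kadd f g = (\<lambda>j s z k. f j s z k + g j s z k)"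

definition kdiff :: "kfun \<Rightarrow> kfun \<Rightarrow> kfun" where
  "kdiff f g = (\<lambda>j s z k. f j s z k - g j s z k)"

definition gradh :: "real \<Rightarrow> (nat \<Rightarrow> nat \<Rightarrow> complex) \<Rightarrow> (nat \<Rightarrow> nat \<Rightarrow> complex) \<Rightarrow> nat \<Rightarrow> nat
                     \<Rightarrow> complex \<times> complex \<times> complex" where
  "gradh h u uz j s = ((u (j+1) s - u (j-1) s) / complex_of_real (2*h),
                       (u j (s+1) - u j (s-1)) / complex_of_real (2*h),
                       uz j s)"

definition laph :: "real \<Rightarrow> (nat \<Rightarrow> nat \<Rightarrow> complex) \<Rightarrow> (nat \<Rightarrow> nat \<Rightarrow> complex) \<Rightarrow> nat \<Rightarrow> nat \<Rightarrow> complex" where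
  "laph h u uzz j s = uzz j s
      + (u (j-1) s - 2 * u j s + u (j+1) s) / complex_of_real (h\<^sup>2)
      + (u j (s-1) - 2 * u j s + u j (s+1)) / complex_of_real (h\<^sup>2)"

definition dot3 :: "complex \<times> complex \<times> complex \<Rightarrow> complex \<times> complex \<times> complex \<Rightarrow> complex" where
  "dot3 a b = fst a * fst b + fst (snd a) * fst (snd b) + snd (snd a) * snd (snd b)"

definition lapS :: "nat \<Rightarrow> real \<Rightarrow> real \<Rightarrow> real \<Rightarrow> sfun \<Rightarrow> nat \<Rightarrow> nat \<Rightarrow> real \<Rightarrow> complex" where
  "lapS N h \<xi> d u j s z = laph h (\<lambda>j s. u j s z) (\<lambda>j s. dzs N \<xi> d 2 u 2 j s z) j s"

definition wgt :: "real \<Rightarrow> real \<Rightarrow> real" where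
  "wgt lam z = exp (-2 * lam * z)"

definition Lh :: "nat \<Rightarrow> real \<Rightarrow> real \<Rightarrow> real \<Rightarrow> real \<Rightarrow> real \<Rightarrow> sfun \<Rightarrow> kfun \<Rightarrow> kfun" where
  "Lh N h \<xi> d kl ku V q = (\<lambda>j s z k.
     let D = dzk N \<xi> d kl ku 2 q;
         DV = dzs N \<xi> d 2 V;
         g = (\<lambda>\<kappa>. gradh h (\<lambda>j s. D 0 j s z \<kappa>) (\<lambda>j s. D 1 j s z \<kappa>) j s);
         gV = gradh h (\<lambda>j s. V j s z) (\<lambda>j s. DV 1 j s z) j s;
         I = (LINT \<kappa>:{k..ku}|lborel. g \<kappa>);
         Iz = (LINT \<kappa>:{k..ku}|lborel. D 1 j s z \<kappa>)
     in laph h (\<lambda>j s. D 0 j s z k) (\<lambda>j s. D 2 j s z k) j s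
        + 2 * complex_of_real k * dot3 (gV - I) (k *\<^sub>R (g k + gV) - I)
        + 2 * \<i> * (complex_of_real k * D 1 j s z k + DV 1 j s z - Iz))"

definition Jfun :: "nat \<Rightarrow> real \<Rightarrow> real \<Rightarrow> real \<Rightarrow> real \<Rightarrow> real \<Rightarrow> sfun \<Rightarrow> kfun \<Rightarrow> real \<Rightarrow> kfun \<Rightarrow> real" where
  "Jfun N h \<xi> d kl ku V F lam p = exp (2 * lam * d) *
     (\<Sum>j\<in>{1..<N}. \<Sum>s\<in>{1..<N}. h\<^sup>2 *
        (LINT \<kappa>:{kl..ku}|lborel. LINT z:{-\<xi>..d}|lborel.
            (cmod (Lh N h \<xi> d kl ku V (kadd p F) j s z \<kappa>))\<^sup>2 * wgt lam z))"

definition Ifun :: "nat \<Rightarrow> real \<Rightarrow> real \<Rightarrow> real \<Rightarrow> sfun \<Rightarrow> real \<Rightarrow> sfun \<Rightarrow> real" where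
  "Ifun N h \<xi> d Q mu W = exp (2 * mu * d) *
     (\<Sum>j\<in>{1..<N}. \<Sum>s\<in>{1..<N}. h\<^sup>2 *
        (LINT z:{-\<xi>..d}|lborel. (cmod (lapS N h \<xi> d W j s z + lapS N h \<xi> d Q j s z))\<^sup>2 * wgt mu z))"

(* J has Frechet derivative at p, identified with g in H^h_{0,2} via the scalar product *)
definition frechet_H02 :: "nat \<Rightarrow> real \<Rightarrow> real \<Rightarrow> real \<Rightarrow> real \<Rightarrow> real \<Rightarrow> (kfun \<Rightarrow> real) \<Rightarrow> kfun \<Rightarrow> kfun \<Rightarrow> bool" where
  "frechet_H02 N h \<xi> d kl ku J p g \<longleftrightarrow>
     g \<in> Hk02 N \<xi> d kl ku \<and>
     (\<forall>\<epsilon>>0. \<exists>\<eta>>0. \<forall>r\<in>Hk02 N \<xi> d kl ku. normHk N h \<xi> d kl ku 2 r < \<eta> \<longrightarrow>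
        \<bar>J (kadd p r) - J p - ipHk N h \<xi> d kl ku 2 g r\<bar> \<le> \<epsilon> * normHk N h \<xi> d kl ku 2 r)"

(* boundary conditions of tail-type functions: f = psi0, f_z = psi1 on Gamma,
   f = 0 on the rest of the boundary *)
definition tail_bc :: "nat \<Rightarrow> real \<Rightarrow> real \<Rightarrow> sfun \<Rightarrow> sfun \<Rightarrow> (nat \<Rightarrow> nat \<Rightarrow> complex) \<Rightarrow> (nat \<Rightarrow> nat \<Rightarrow> complex) \<Rightarrow> bool" where
  "tail_bc N \<xi> d f fz psi0 psi1 \<longleftrightarrow>
     (\<forall>j\<in>{1..<N}. \<forall>s\<in>{1..<N}. f j s (-\<xi>) = psi0 j s \<and> fz j s (-\<xi>) = psi1 j s) \<and>
     (\<forall>j\<le>N. \<forall>s\<le>N. (j = 0 \<or> j = N \<or> s = 0 \<or> s = N) \<longrightarrow> (\<forall>z\<in>{-\<xi>..d}. f j s z = 0)) \<and>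
     (\<forall>j\<le>N. \<forall>s\<le>N. f j s d = 0)"

end

(* The remainder of J at p in the direction r splits into the squared norm of L(p+r+F) - L(p+F)
   and a cross term of L(p+F) with the part of L that is quadratic in r. Since r and r_z vanish at
   z = -xi and the weight decreases in z, the Cauchy-Schwarz inequality for r = int r_z and
   r_z = int r_zz bounds the weighted sup norms (in z) of r and r_z by
   lambda^(-1/2) times the weighted L2 norm X of r_zz. With h fixed the finite differences cost only
   constants, so every term other than r_zz itself, including the cross term, is O(X^2 / lambda);
   for large lambda the remainder is at least X^2 / 4, which controls the H^2 norm of r.
   The gradient is the Riesz representer of the linear part on H_{0,2}, whose completeness follows
   from that of L2 because r is recovered from r_zz. The Carleman estimate enters only in bounding
   the tail V = W + Q: comparing the minimiser W with V_* - Q_* gives e^(2 mu d) times the weighted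
   norm of the Laplacian of the difference at most C e^(2 mu (d + xi)) delta^2 = C delta. *)
theory Submission
  imports Defs
begin

section \<open>Square integrable functions\<close>

text \<open>The term \<open>L(p+F)\<close> contains the second derivative of \<open>p\<close>, which
  is merely square integrable, so no pointwise bound on it is available. The cross term is still of
  order X^2 / lambda because each quadratic term of the operator is a product with an integral over
  \<open>{k..ku}\<close>: Cauchy-Schwarz in k bounds that integral uniformly in k, the weight is
  shared between the two factors, and \<open>L(p+F)\<close> enters through its unweighted norm,
  which is bounded on the ball. Hence two mixed bounds: the supremum in z together with either the
  mean square or the supremum in k. Two features of the definitions shape the rest. Derivatives are
  picked by \<open>SOME\<close>, so every quantity must be shown to depend on the function only: the
  first derivative is unique everywhere, the second almost everywhere. Boundary conditions are
  imposed for every k, whereas an L2 limit is known for almost every k, so limits must be repaired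
  on a null set. Noisy data enter \<open>lam1\<close> only through norms of exact data, since the
  noise is below 1.\<close>

lemma amgm_sq_bound:
  fixes x a b :: real
  assumes "0 \<le> x" "0 \<le> a" "0 \<le> b" and le: "\<And>t. 0 < t \<Longrightarrow> x \<le> (t * a + b / t) / 2"
  shows "x\<^sup>2 \<le> a * b"
proof (cases "x = 0")
  case True then show ?thesis using assms by simp
next
  case False
  then have x: "0 < x" using assms by simp
  show ?thesis
  proof (cases "a = 0")
    case True
    have "b > 0" using le[of 1] x True by simp
    then show ?thesis using le[of "b / x"] x True by (simp add: field_simps)
  next
    case a: False
    then have "0 < a" using assms by simp
    \<comment> \<open>The optimal t would involve a square root; \<open>x / a\<close> is enough, as
      it turns the bound into \<open>x \<le> (x + a * b / x) / 2\<close>.\<close>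
    then show ?thesis using le[of "x / a"] x by (simp add: field_simps power2_eq_square)
  qed
qed

text \<open>The majorant \<open>F * G\<close> covers both the plain and the weighted Cauchy--Schwarz inequality.\<close>

lemma integral_cauchy_schwarz:
  fixes f :: "'a \<Rightarrow> complex" and F G :: "'a \<Rightarrow> real"
  assumes f: "f \<in> borel_measurable M" and F: "integrable M F" and G: "integrable M G"
    and nn: "\<And>x. x \<in> space M \<Longrightarrow> 0 \<le> F x \<and> 0 \<le> G x"
    and le: "\<And>x. x \<in> space M \<Longrightarrow> (cmod (f x))\<^sup>2 \<le> F x * G x"
  shows "integrable M f" "(cmod (integral\<^sup>L M f))\<^sup>2 \<le> integral\<^sup>L M F * integral\<^sup>L M G"
proof -
  \<comment> \<open>Pointwise arithmetic-geometric mean with a free parameter: t = 1 gives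
    integrability, all t together give the product of the integrals.\<close>
  have pt: "cmod (f x) \<le> (t * F x + G x / t) / 2" if x: "x \<in> space M" and t: "0 < t" for x t
  proof (rule power2_le_imp_le)
    have "4 * (F x * G x) \<le> (t * F x + G x / t)\<^sup>2"
    proof -
      have "(t * F x + G x / t)\<^sup>2 - 4 * (F x * G x) = (t * F x - G x / t)\<^sup>2"
        using t by (simp add: power2_eq_square field_simps)
      then show ?thesis by (smt (verit) zero_le_power2)
    qed
    then show "(cmod (f x))\<^sup>2 \<le> ((t * F x + G x / t) / 2)\<^sup>2"
      using le[OF x] by (simp add: power_divide)
    show "0 \<le> (t * F x + G x / t) / 2" using nn[OF x] t by simp
  qed
  show int: "integrable M f"
  proof (rule Bochner_Integration.integrable_bound[of M "\<lambda>x. (1 * F x + G x / 1) / 2"])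
    show "integrable M (\<lambda>x. (1 * F x + G x / 1) / 2)" using F G by simp
    show "AE x in M. norm (f x) \<le> norm ((1 * F x + G x / 1) / 2)"
    proof (rule AE_I2)
      fix x assume "x \<in> space M"
      from pt[OF this, of 1] show "norm (f x) \<le> norm ((1 * F x + G x / 1) / 2)"
        by (metis abs_ge_self order_trans real_norm_def zero_less_one)
    qed
  qed (use f in simp)
  show "(cmod (integral\<^sup>L M f))\<^sup>2 \<le> integral\<^sup>L M F * integral\<^sup>L M G"
  proof (rule amgm_sq_bound)
    show "0 \<le> integral\<^sup>L M F" "0 \<le> integral\<^sup>L M G"
      using nn by (auto intro!: integral_nonneg_AE AE_I2)
    fix t :: real assume t: "0 < t"
    have "cmod (integral\<^sup>L M f) \<le> (\<integral>x. cmod (f x) \<partial>M)" by simp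
    also have "\<dots> \<le> (\<integral>x. (t * F x + G x / t) / 2 \<partial>M)"
      using int F G pt t by (intro integral_mono) auto
    also have "\<dots> = (t * integral\<^sup>L M F + integral\<^sup>L M G / t) / 2"
      using F G by (simp add: field_simps)
    finally show "cmod (integral\<^sup>L M f) \<le> (t * integral\<^sup>L M F + integral\<^sup>L M G / t) / 2" .
  qed simp
qed

text \<open>A predicate on functions rather than on classes modulo null sets, because slices and
  point values of these functions matter later.\<close>

definition sqi :: "'a measure \<Rightarrow> ('a \<Rightarrow> complex) \<Rightarrow> bool" where
  "sqi M f \<longleftrightarrow> f \<in> borel_measurable M \<and> integrable M (\<lambda>x. (cmod (f x))\<^sup>2)"

lemma sqi_measurable: "sqi M f \<Longrightarrow> f \<in> borel_measurable M"
  and sqi_integrable_sq: "sqi M f \<Longrightarrow> integrable M (\<lambda>x. (cmod (f x))\<^sup>2)"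
  by (auto simp: sqi_def)

lemma norm_add_sq_le: "(norm (a + b))\<^sup>2 \<le> 2 * (norm a)\<^sup>2 + 2 * (norm b :: real)\<^sup>2"
proof -
  have "(norm (a + b))\<^sup>2 \<le> (norm a + norm b)\<^sup>2"
    by (intro power_mono norm_triangle_ineq) simp
  also have "\<dots> \<le> 2 * (norm a)\<^sup>2 + 2 * (norm b)\<^sup>2"
    using sum_squares_bound[of "norm a" "norm b"] by (simp add: power2_sum)
  finally show ?thesis .
qed

lemma norm_diff_sq_le: "(norm (a - b))\<^sup>2 \<le> 2 * (norm a)\<^sup>2 + 2 * (norm b :: real)\<^sup>2"
  using norm_add_sq_le[of a "- b"] by simp

lemma sqi_bound:
  assumes "f \<in> borel_measurable M" "integrable M G" "\<And>x. x \<in> space M \<Longrightarrow> (cmod (f x))\<^sup>2 \<le> G x"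
  shows "sqi M f"
  unfolding sqi_def
proof
  show "integrable M (\<lambda>x. (cmod (f x))\<^sup>2)"
    by (rule Bochner_Integration.integrable_bound[OF assms(2)])
       (use assms in \<open>auto intro!: AE_I2 order_trans[OF assms(3)]\<close>)
qed (rule assms)

lemma sqi_add: "sqi M f \<Longrightarrow> sqi M g \<Longrightarrow> sqi M (\<lambda>x. f x + g x)"
  by (rule sqi_bound[where G = "\<lambda>x. 2 * (cmod (f x))\<^sup>2 + 2 * (cmod (g x))\<^sup>2"])
     (auto simp: sqi_def norm_add_sq_le)

lemma sqi_cmult: "sqi M f \<Longrightarrow> sqi M (\<lambda>x. c * f x)"
  by (auto simp: sqi_def norm_mult power_mult_distrib)

lemma sqi_diff: "sqi M f \<Longrightarrow> sqi M g \<Longrightarrow> sqi M (\<lambda>x. f x - g x)"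
  using sqi_add[OF _ sqi_cmult[of M g "-1"], of f] by simp

lemma sqi_zero: "sqi M (\<lambda>x. 0)"
  by (simp add: sqi_def)

lemma sqi_cong_AE:
  "sqi M f \<Longrightarrow> g \<in> borel_measurable M \<Longrightarrow> AE x in M. g x = f x \<Longrightarrow> sqi M g"
  unfolding sqi_def by (auto intro: Bochner_Integration.integrable_bound)

lemma sqi_cong: "(\<And>x. x \<in> space M \<Longrightarrow> f x = g x) \<Longrightarrow> sqi M f \<longleftrightarrow> sqi M g"
  unfolding sqi_def
  by (intro conj_cong measurable_cong Bochner_Integration.integrable_cong) auto

lemma sqi_mult_integrable:
  assumes "sqi M f" "sqi M g"
  shows "integrable M (\<lambda>x. f x * g x)"
  by (rule integral_cauchy_schwarz(1)[where F = "\<lambda>x. (cmod (f x))\<^sup>2" and G = "\<lambda>x. (cmod (g x))\<^sup>2"])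
     (use assms in \<open>auto simp: sqi_def norm_mult power_mult_distrib\<close>)

lemma sqi_cnj: "sqi M f \<Longrightarrow> sqi M (\<lambda>x. cnj (f x))"
  by (auto simp: sqi_def intro: borel_measurable_continuous_onI[of cnj, THEN measurable_compose[rotated]] continuous_intros)

lemma sqi_Re_cnj_integrable:
  assumes "sqi M f" "sqi M g"
  shows "integrable M (\<lambda>x. Re (f x * cnj (g x)))"
  using integrable_bounded_linear[OF bounded_linear_Re sqi_mult_integrable[OF assms(1) sqi_cnj[OF assms(2)]]] .

lemma (in finite_measure) sqi_integrable:
  assumes "sqi M f"
  shows "integrable M f" "(cmod (integral\<^sup>L M f))\<^sup>2 \<le> measure M (space M) * (\<integral>x. (cmod (f x))\<^sup>2 \<partial>M)"
  using integral_cauchy_schwarz[of f M "\<lambda>_. 1" "\<lambda>x. (cmod (f x))\<^sup>2"] assms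
  unfolding sqi_def by simp_all

section \<open>Absolutely continuous functions on an interval\<close>

abbreviation intv :: "real \<Rightarrow> real \<Rightarrow> real measure" where
  "intv a c \<equiv> restrict_space lborel {a..c}"

lemma space_intv [simp]: "space (intv a c) = {a..c}"
  by (simp add: space_restrict_space)

lemma finite_measure_intv: "finite_measure (intv a c)"
  by (rule finite_measureI) (simp add: emeasure_restrict_space emeasure_lborel_Icc_eq)

lemma measure_intv: "a \<le> c \<Longrightarrow> measure (intv a c) {a..c} = c - a"
  by (simp add: measure_restrict_space)

lemma set_integrable_intv: "set_integrable lborel {a..c} f \<longleftrightarrow> integrable (intv a c) f"
  for f :: "real \<Rightarrow> 'b::{banach, second_countable_topology}"
  by (rule set_integrable_eq) simp

lemma set_integral_intv: "(LINT x:{a..c}|lborel. f x) = integral\<^sup>L (intv a c) f"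
  for f :: "real \<Rightarrow> 'b::{banach, second_countable_topology}"
  by (simp add: set_lebesgue_integral_def integral_restrict_space)

lemma set_measurable_intv: "set_borel_measurable lborel {a..c} f \<longleftrightarrow> f \<in> borel_measurable (intv a c)"
  for f :: "real \<Rightarrow> 'b::{banach, second_countable_topology}"
  by (simp add: set_borel_measurable_def borel_measurable_restrict_space_iff)

lemma id_measurable_intv [measurable]: "(\<lambda>x. x) \<in> borel_measurable (intv a c)"
  by (simp add: measurable_restrict_space1)

lemma integral_intv_sub:
  fixes f :: "real \<Rightarrow> 'b::{banach, second_countable_topology}"
  assumes "z \<in> {a..c}"
  shows "integral\<^sup>L (intv a z) f = (\<integral>t. indicator {..z} t *\<^sub>R f t \<partial>intv a c)"
  using assms
  by (auto simp: integral_restrict_space indicator_def intro!: Bochner_Integration.integral_cong)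

lemma integral_intv_up:
  fixes f :: "real \<Rightarrow> 'b::{banach, second_countable_topology}"
  assumes "z \<in> {a..c}"
  shows "integral\<^sup>L (intv z c) f = (\<integral>t. indicator {z..} t *\<^sub>R f t \<partial>intv a c)"
  using assms
  by (auto simp: integral_restrict_space indicator_def intro!: Bochner_Integration.integral_cong)

lemma integrable_intv_sub:
  fixes f :: "real \<Rightarrow> 'b::{banach, second_countable_topology}"
  assumes "integrable (intv a c) f" "a \<le> x" "z \<le> c"
  shows "integrable (intv x z) f"
  using assms set_integrable_subset[of lborel "{a..c}" f "{x..z}"]
  by (simp add: set_integrable_intv[symmetric])

lemma sqi_intv_sub: "sqi (intv a c) f \<Longrightarrow> a \<le> x \<Longrightarrow> z \<le> c \<Longrightarrow> sqi (intv x z) f"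
  unfolding sqi_def
  by (auto intro: integrable_intv_sub intro!: measurable_restrict_mono[of f lborel "{a..c}" borel "{x..z}"])

lemma integral_intv_sub_mono:
  fixes f :: "real \<Rightarrow> real"
  assumes f: "integrable (intv a c) f" and z: "a \<le> x" "z \<le> c"
    and nn: "\<And>t. t \<in> {a..c} \<Longrightarrow> 0 \<le> f t"
  shows "integral\<^sup>L (intv x z) f \<le> integral\<^sup>L (intv a c) f"
proof -
  have "integral\<^sup>L (intv x z) f = (\<integral>t. indicator {x..z} t *\<^sub>R f t \<partial>lborel)"
    by (simp add: integral_restrict_space)
  also have "\<dots> \<le> (\<integral>t. indicator {a..c} t *\<^sub>R f t \<partial>lborel)"
    using f integrable_intv_sub[OF f z] z nn
    by (intro integral_mono) (auto simp: integrable_restrict_space indicator_def)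
  finally show ?thesis by (simp add: integral_restrict_space)
qed

lemma integral_intv_split:
  fixes f :: "real \<Rightarrow> complex"
  assumes f: "integrable (intv a c) f" and z: "a \<le> x" "x \<le> z" "z \<le> c"
  shows "integral\<^sup>L (intv a z) f = integral\<^sup>L (intv a x) f + integral\<^sup>L (intv x z) f"
proof -
  have "(LINT t:{a..x}|lborel. f t) + (LINT t:{x..z}|lborel. f t) = integral {a..x} f + integral {x..z} f"
    using f z by (simp add: set_borel_integral_eq_integral set_integrable_intv integrable_intv_sub)
  also have "\<dots> = integral {a..z} f"
    using f z by (intro Henstock_Kurzweil_Integration.integral_combine set_borel_integral_eq_integral(1))
      (auto simp: set_integrable_intv intro: integrable_intv_sub)
  also have "\<dots> = (LINT t:{a..z}|lborel. f t)"
    using f z by (simp add: set_borel_integral_eq_integral set_integrable_intv integrable_intv_sub)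
  finally show ?thesis by (simp add: set_integral_intv)
qed

text \<open>At a Lebesgue point the value is the limit of averages over short intervals, and each
  such average is a difference of two primitives.\<close>

lemma AE_zero_of_primitive_zero:
  fixes f :: "real \<Rightarrow> complex"
  assumes f: "integrable (intv a c) f" and z: "\<And>z. z \<in> {a..c} \<Longrightarrow> integral\<^sup>L (intv a z) f = 0"
  shows "AE x in intv a c. f x = 0"
proof -
  define g where "g = (\<lambda>x. indicator {a..c} x *\<^sub>R f x)"
  have g: "integrable lborel g"
    using f by (simp add: g_def integrable_restrict_space)
  then have "g integrable_on cbox x y" for x y
    using integrable_on_lborel integrable_on_subcbox by blast
  then obtain S where S: "negligible S" and
    lim: "\<And>x e. x \<notin> S \<Longrightarrow> 0 < e \<Longrightarrow>
      \<exists>d>0. \<forall>h. 0 < h \<and> h < d \<longrightarrow> norm (integral (cbox x (x + h *\<^sub>R One)) g /\<^sub>R h ^ DIM(real) - g x) < e"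
    using integrable_ccontinuous_explicit[of g] by blast
  \<comment> \<open>The averages extend to the right of x, so the endpoint c joins the exceptional
    set.\<close>
  have eq0: "f x = 0" if x: "x \<in> {a..c}" "x \<noteq> c" "x \<notin> S" for x
  proof (rule ccontr)
    assume "f x \<noteq> 0"
    then have "0 < norm (g x)" using x by (simp add: g_def)
    from lim[OF x(3) this] obtain e where e: "e > 0"
      "\<And>h. 0 < h \<Longrightarrow> h < e \<Longrightarrow> norm (integral {x..x+h} g /\<^sub>R h - g x) < norm (g x)"
      by auto
    define h where "h = min (e/2) (c - x)"
    have h: "0 < h" "h < e" "x + h \<le> c" using e x by (auto simp: h_def)
    have "integral {x..x+h} g = integral {x..x+h} f"
      by (rule Henstock_Kurzweil_Integration.integral_cong) (use x h in \<open>auto simp: g_def\<close>)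
    also have "\<dots> = integral\<^sup>L (intv x (x+h)) f"
      using integrable_intv_sub[OF f, of x "x+h"] x h
      by (simp add: set_integral_intv[symmetric] set_borel_integral_eq_integral set_integrable_intv)
    also have "\<dots> = integral\<^sup>L (intv a (x+h)) f - integral\<^sup>L (intv a x) f"
      using integral_intv_split[OF f, of x "x+h"] x h by simp
    also have "\<dots> = 0" using z x h by simp
    finally show False using e(2)[OF h(1,2)] by simp
  qed
  have "S \<union> {c} \<in> null_sets lebesgue"
    using S by (simp add: negligible_iff_null_sets[symmetric])
  then have "AE x in lebesgue. x \<notin> S \<union> {c}" by (rule AE_not_in)
  then have "AE x in lborel. x \<notin> S \<union> {c}" by (simp add: AE_completion_iff)
  then have "AE x in lborel. x \<in> {a..c} \<longrightarrow> f x = 0"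
    by (rule eventually_mono) (use eq0 in blast)
  then show ?thesis
    by (subst AE_restrict_space_iff) auto
qed

text \<open>Absolute continuity with derivative g, in increment form so that sums and multiples pass
  directly to the integrals. A Sobolev chain is a chain of such pairs.\<close>

definition ac_on :: "real \<Rightarrow> real \<Rightarrow> (real \<Rightarrow> complex) \<Rightarrow> (real \<Rightarrow> complex) \<Rightarrow> bool" where
  "ac_on a c f g \<longleftrightarrow> integrable (intv a c) g \<and> (\<forall>z\<in>{a..c}. f z - f a = integral\<^sup>L (intv a z) g)"

lemma zchain_ac_on:
  "zchain a c n D \<longleftrightarrow> (\<forall>i<n. ac_on a c (D i) (D (Suc i))) \<and> sqi (intv a c) (D n)"
proof -
  have *: "x = y + i \<longleftrightarrow> x - y = i" for x y i :: complex
    by (auto simp: algebra_simps)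
  show ?thesis
    unfolding zchain_def ac_on_def sqi_def set_integrable_intv set_integral_intv set_measurable_intv *
    by blast
qed

lemma ac_on_integrable: "ac_on a c f g \<Longrightarrow> integrable (intv a c) g"
  and ac_on_increment: "ac_on a c f g \<Longrightarrow> z \<in> {a..c} \<Longrightarrow> f z - f a = integral\<^sup>L (intv a z) g"
  unfolding ac_on_def by blast+

lemma ac_on_eq: "ac_on a c f g \<Longrightarrow> z \<in> {a..c} \<Longrightarrow> f z = f a + integral\<^sup>L (intv a z) g"
  by (subst ac_on_increment[symmetric]) auto

lemma ac_onI:
  "integrable (intv a c) g \<Longrightarrow> (\<And>z. z \<in> {a..c} \<Longrightarrow> f z - f a = integral\<^sup>L (intv a z) g) \<Longrightarrow> ac_on a c f g"
  unfolding ac_on_def by blast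

lemma ac_on_continuous:
  assumes "ac_on a c f g"
  shows "continuous_on {a..c} f"
proof -
  have g: "integrable (intv a c) g" and f: "\<And>z. z \<in> {a..c} \<Longrightarrow> f z = f a + integral\<^sup>L (intv a z) g"
    using ac_on_integrable[OF assms] ac_on_eq[OF assms] by blast+
  have "g integrable_on {a..c}"
    using g by (intro set_borel_integral_eq_integral(1)) (simp add: set_integrable_intv)
  then have "continuous_on {a..c} (\<lambda>z. f a + integral {a..z} g)"
    by (intro continuous_intros indefinite_integral_continuous_1)
  moreover have "f z = f a + integral {a..z} g" if "z \<in> {a..c}" for z
    using f[OF that] integrable_intv_sub[OF g, of a z] that
    by (simp add: set_integral_intv[symmetric] set_borel_integral_eq_integral set_integrable_intv)
  ultimately show ?thesis using continuous_on_cong by (metis (no_types, lifting))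
qed

lemma ac_on_sqi:
  assumes "ac_on a c f g"
  shows "sqi (intv a c) f"
proof (cases "a \<le> c")
  case True
  have cont: "continuous_on {a..c} f" by (rule ac_on_continuous[OF assms])
  then have "bounded (f ` {a..c})"
    using compact_imp_bounded compact_continuous_image by blast
  then obtain B where B: "\<And>x. x \<in> {a..c} \<Longrightarrow> cmod (f x) \<le> B"
    unfolding bounded_iff by blast
  have m: "f \<in> borel_measurable (intv a c)"
    using borel_measurable_continuous_on_restrict[OF cont]
    by (simp add: measurable_cong_sets[OF sets_restrict_space_cong[of borel lborel]])
  show ?thesis
  proof (rule sqi_bound[OF m, of "\<lambda>_. B\<^sup>2"])
    show "integrable (intv a c) (\<lambda>_. B\<^sup>2)"
      using finite_measure.integrable_const[OF finite_measure_intv] .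
  qed (use B in \<open>auto intro: power_mono\<close>)
next
  case False
  then have "f \<in> borel_measurable (intv a c)"
    by (intro measurableI) (auto simp: sets_restrict_space space_restrict_space)
  then show ?thesis using False by (intro sqi_bound[where G = "\<lambda>_. 0"]) auto
qed

lemma ac_on_integrable_sub: "ac_on a c f g \<Longrightarrow> z \<in> {a..c} \<Longrightarrow> integrable (intv a z) g"
  by (rule integrable_intv_sub[OF ac_on_integrable]) auto

lemma ac_on_add:
  assumes f: "ac_on a c f g" and f': "ac_on a c f' g'"
  shows "ac_on a c (\<lambda>x. f x + f' x) (\<lambda>x. g x + g' x)"
proof (rule ac_onI)
  show "integrable (intv a c) (\<lambda>x. g x + g' x)" using f f' by (simp add: ac_on_integrable)
  fix z assume z: "z \<in> {a..c}"
  show "f z + f' z - (f a + f' a) = integral\<^sup>L (intv a z) (\<lambda>x. g x + g' x)"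
    using ac_on_increment[OF f z] ac_on_increment[OF f' z]
      ac_on_integrable_sub[OF f z] ac_on_integrable_sub[OF f' z]
    by (simp add: algebra_simps)
qed

lemma ac_on_cmult:
  assumes f: "ac_on a c f g"
  shows "ac_on a c (\<lambda>x. r * f x) (\<lambda>x. r * g x)"
proof (rule ac_onI)
  show "integrable (intv a c) (\<lambda>x. r * g x)" using f by (simp add: ac_on_integrable)
  fix z assume z: "z \<in> {a..c}"
  show "r * f z - r * f a = integral\<^sup>L (intv a z) (\<lambda>x. r * g x)"
    using ac_on_increment[OF f z] by (simp add: right_diff_distrib[symmetric])
qed

lemma ac_on_diff: "ac_on a c f g \<Longrightarrow> ac_on a c f' g' \<Longrightarrow> ac_on a c (\<lambda>x. f x - f' x) (\<lambda>x. g x - g' x)"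
  using ac_on_add[OF _ ac_on_cmult[of a c f' g' "-1"], of f g] by simp

lemma ac_on_zero_AE:
  assumes "ac_on a c f g" "\<And>x. x \<in> {a..c} \<Longrightarrow> f x = 0"
  shows "AE x in intv a c. g x = 0"
  using ac_on_increment[OF assms(1)] assms(2)
  by (intro AE_zero_of_primitive_zero[OF ac_on_integrable[OF assms(1)]]) (metis atLeastAtMost_iff diff_zero order.trans order_refl)

text \<open>A continuous derivative vanishes at every point, not only almost everywhere. This makes
  the condition on the z derivative at the single point z = -xi independent of the chosen
  derivative.\<close>

lemma ac_on_zero_deriv:
  assumes "ac_on a c f g" "\<And>x. x \<in> {a..c} \<Longrightarrow> f x = 0" "continuous_on {a..c} g" "a < c" "x \<in> {a..c}"
  shows "g x = 0"
proof -
  have "((\<lambda>u. integral {a..u} g) has_vector_derivative g x) (at x within {a..c})"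
    using integral_has_vector_derivative[OF assms(3,5)] .
  moreover have "integral {a..u} g = 0" if "u \<in> {a..c}" for u
  proof -
    have "integrable (intv a u) g" using ac_on_integrable_sub[OF assms(1) that] .
    then have "integral {a..u} g = integral\<^sup>L (intv a u) g"
      by (simp add: set_integral_intv[symmetric] set_borel_integral_eq_integral set_integrable_intv)
    then show ?thesis using ac_on_increment[OF assms(1) that] assms(2,4) that by simp
  qed
  ultimately have "((\<lambda>u. 0) has_vector_derivative g x) (at x within {a..c})"
    using has_vector_derivative_transform[OF assms(5), of "\<lambda>u. 0" "\<lambda>u. integral {a..u} g"] by simp
  then show ?thesis
    using vector_derivative_unique_within_closed_interval[of a c x "\<lambda>u. 0" "g x" 0] assms by auto
qed

text \<open>One-dimensional Sobolev inequality: \<open>f z\<close> differs from \<open>f y\<close>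
  by an integral of g, and averaging over y removes the reference point. The first summand is the
  price for having no boundary value.\<close>

lemma ac_on_sup_bound:
  assumes ac: "ac_on a c f g" and g: "sqi (intv a c) g" and "a < c" and z: "z \<in> {a..c}"
  shows "(cmod (f z))\<^sup>2 \<le> 2 / (c - a) * (\<integral>x. (cmod (f x))\<^sup>2 \<partial>intv a c) + 2 * (c - a) * (\<integral>x. (cmod (g x))\<^sup>2 \<partial>intv a c)"
proof -
  interpret finite_measure "intv a c" by (rule finite_measure_intv)
  let ?G = "\<integral>x. (cmod (g x))\<^sup>2 \<partial>intv a c" and ?F = "\<integral>x. (cmod (f x))\<^sup>2 \<partial>intv a c"
  have gi: "integrable (intv a c) g" and f: "\<And>z. z \<in> {a..c} \<Longrightarrow> f z = f a + integral\<^sup>L (intv a z) g"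
    using ac_on_integrable[OF ac] ac_on_eq[OF ac] by blast+
  have fs: "sqi (intv a c) f" by (rule ac_on_sqi[OF ac])
  have G0: "(cmod (integral\<^sup>L (intv x y) g))\<^sup>2 \<le> (c - a) * ?G" if "a \<le> x" "x \<le> y" "y \<le> c" for x y
  proof -
    have "(cmod (integral\<^sup>L (intv x y) g))\<^sup>2 \<le> (y - x) * (\<integral>x. (cmod (g x))\<^sup>2 \<partial>intv x y)"
      using finite_measure.sqi_integrable(2)[OF finite_measure_intv sqi_intv_sub[OF g], of x y] that
      by (simp add: measure_intv)
    also have "\<dots> \<le> (c - a) * ?G"
      using that sqi_integrable_sq[OF g] by (intro mult_mono integral_intv_sub_mono) auto
    finally show ?thesis .
  qed
  have le: "(cmod (f z))\<^sup>2 \<le> 2 * (cmod (f y))\<^sup>2 + 2 * ((c - a) * ?G)" if y: "y \<in> {a..c}" for y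
  proof (cases "y \<le> z")
    case True
    have "f z = f y + integral\<^sup>L (intv y z) g"
      using f[OF y] f[OF z] integral_intv_split[OF gi, of y z] True y z by simp
    then show ?thesis
      using norm_add_sq_le[of "f y" "integral\<^sup>L (intv y z) g"] G0[of y z] True y z by simp
  next
    case False
    have "f z = f y - integral\<^sup>L (intv z y) g"
      using f[OF y] f[OF z] integral_intv_split[OF gi, of z y] False y z by simp
    then show ?thesis
      using norm_diff_sq_le[of "f y" "integral\<^sup>L (intv z y) g"] G0[of z y] False y z by simp
  qed
  have "(c - a) * (cmod (f z))\<^sup>2 = (\<integral>y. (cmod (f z))\<^sup>2 \<partial>intv a c)"
    using \<open>a < c\<close> by (simp add: measure_intv)
  also have "\<dots> \<le> (\<integral>y. 2 * (cmod (f y))\<^sup>2 + 2 * ((c - a) * ?G) \<partial>intv a c)"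
    using le fs by (intro integral_mono) (auto simp: sqi_def)
  also have "\<dots> = 2 * ?F + 2 * (c - a) * (c - a) * ?G"
    using fs \<open>a < c\<close> by (subst Bochner_Integration.integral_add) (auto simp: measure_intv sqi_def)
  finally show ?thesis
    using \<open>a < c\<close> by (simp add: field_simps)
qed

section \<open>The exponential weight\<close>

lemma wgt_pos [simp]: "0 < wgt lam z" and wgt_nonneg [simp]: "0 \<le> wgt lam z"
  by (simp_all add: wgt_def)

lemma wgt_0 [simp]: "wgt 0 z = 1"
  by (simp add: wgt_def)

lemma wgt_measurable [measurable]: "wgt lam \<in> borel_measurable borel"
  unfolding wgt_def by measurable

lemma wgt_bounds:
  assumes "z \<in> {a..c}"
  shows "wgt lam z \<le> exp (2 * \<bar>lam\<bar> * (\<bar>a\<bar> + \<bar>c\<bar>))"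
proof -
  have "-2 * lam * z \<le> 2 * (\<bar>lam\<bar> * \<bar>z\<bar>)"
    using abs_ge_minus_self[of "lam * z"] by (simp add: abs_mult)
  also have "\<dots> \<le> 2 * (\<bar>lam\<bar> * (\<bar>a\<bar> + \<bar>c\<bar>))"
    using assms by (intro mult_left_mono) auto
  finally show ?thesis by (simp add: wgt_def mult.assoc)
qed

text \<open>The decay of the weight gains the factor \<open>1 / (2 * lam)\<close> here; this is what makes every lower
  order term negligible against the second derivative.\<close>

lemma weighted_primitive_bound:
  assumes ac: "ac_on a c f g" and g: "sqi (intv a c) g" and fa: "f a = 0" and z: "z \<in> {a..c}"
    and m: "lam > 0 \<and> m = 1 / (2 * lam) \<or> lam = 0 \<and> m = c - a"
  shows "wgt lam z * (cmod (f z))\<^sup>2 \<le> m * (\<integral>x. (cmod (g x))\<^sup>2 * wgt lam x \<partial>intv a c)"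
proof -
  have az: "a \<le> z" "z \<le> c" using z by auto
  let ?e = "\<lambda>x. exp (2 * lam * x)"
  have inv: "?e x * wgt lam x = 1" for x by (simp add: wgt_def mult_exp_exp)
  have gm: "g \<in> borel_measurable (intv a c)" using g by (simp add: sqi_def)
  have gw: "integrable (intv a c) (\<lambda>x. (cmod (g x))\<^sup>2 * wgt lam x)"
  proof (rule Bochner_Integration.integrable_bound)
    show "integrable (intv a c) (\<lambda>x. (cmod (g x))\<^sup>2 * exp (2 * \<bar>lam\<bar> * (\<bar>a\<bar> + \<bar>c\<bar>)))"
      using g by (simp add: sqi_def)
    have "wgt lam \<in> borel_measurable (intv a c)" by (simp add: measurable_restrict_space1)
    then show "(\<lambda>x. (cmod (g x))\<^sup>2 * wgt lam x) \<in> borel_measurable (intv a c)"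
      using gm by measurable
    show "AE x in intv a c. norm ((cmod (g x))\<^sup>2 * wgt lam x) \<le> norm ((cmod (g x))\<^sup>2 * exp (2 * \<bar>lam\<bar> * (\<bar>a\<bar> + \<bar>c\<bar>)))"
      by (rule AE_I2) (auto simp: abs_mult intro!: mult_left_mono wgt_bounds)
  qed
  have eint: "integrable (intv a z) ?e"
    by (subst set_integrable_intv[symmetric]) (intro borel_integrable_atLeastAtMost' continuous_intros)
  have eval: "wgt lam z * integral\<^sup>L (intv a z) ?e \<le> m"
    using m
  proof
    assume l: "lam > 0 \<and> m = 1 / (2 * lam)"
    have "(?e has_integral (?e z / (2 * lam) - ?e a / (2 * lam))) {a..z}"
      using l az by (intro fundamental_theorem_of_calculus)
        (auto intro!: derivative_eq_intros simp: has_real_derivative_iff_has_vector_derivative[symmetric])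
    then have "integral\<^sup>L (intv a z) ?e = ?e z / (2 * lam) - ?e a / (2 * lam)"
      using eint by (simp add: set_integral_intv[symmetric] set_borel_integral_eq_integral(2) set_integrable_intv integral_unique)
    then have "wgt lam z * integral\<^sup>L (intv a z) ?e = 1 / (2 * lam) - wgt lam z * ?e a / (2 * lam)"
      using inv[of z] by (simp add: right_diff_distrib mult.commute)
    then show ?thesis using l by simp
  next
    assume "lam = 0 \<and> m = c - a"
    then show ?thesis using az by (simp add: measure_intv)
  qed
  have gmz: "g \<in> borel_measurable (intv a z)"
    using sqi_intv_sub[OF g, of a z] az by (simp add: sqi_def)
  have "(cmod (f z))\<^sup>2 = (cmod (integral\<^sup>L (intv a z) g))\<^sup>2"
    using ac_on_increment[OF ac z] fa by simp
  \<comment> \<open>Cauchy-Schwarz with the inverse weight \<open>?e\<close> in one factor.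
    Multiplied by \<open>wgt lam z\<close>, the integral of \<open>?e\<close> is at most
    \<open>1 / (2 * lam)\<close>, or the length of the interval when lam is 0.\<close>
  also have "\<dots> \<le> integral\<^sup>L (intv a z) ?e * (\<integral>x. (cmod (g x))\<^sup>2 * wgt lam x \<partial>intv a z)"
  proof (rule integral_cauchy_schwarz(2)[OF gmz eint])
    show "integrable (intv a z) (\<lambda>x. (cmod (g x))\<^sup>2 * wgt lam x)"
      using gw az by (auto intro: integrable_intv_sub)
    show "(cmod (g x))\<^sup>2 \<le> ?e x * ((cmod (g x))\<^sup>2 * wgt lam x)" for x
      using inv[of x] by (simp add: mult.left_commute)
  qed simp
  also have "\<dots> \<le> integral\<^sup>L (intv a z) ?e * (\<integral>x. (cmod (g x))\<^sup>2 * wgt lam x \<partial>intv a c)"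
    using gw az by (intro mult_left_mono integral_intv_sub_mono) (auto intro!: integral_nonneg_AE)
  finally have "wgt lam z * (cmod (f z))\<^sup>2 \<le> wgt lam z * integral\<^sup>L (intv a z) ?e * (\<integral>x. (cmod (g x))\<^sup>2 * wgt lam x \<partial>intv a c)"
    by (simp add: mult.assoc mult_left_mono)
  also have "\<dots> \<le> m * (\<integral>x. (cmod (g x))\<^sup>2 * wgt lam x \<partial>intv a c)"
    using eval by (intro mult_right_mono) (auto intro!: integral_nonneg_AE)
  finally show ?thesis .
qed

section \<open>Riesz representation and completeness\<close>

text \<open>The vector space operations are parameters because the function type in question
  carries no real vector space instance.\<close>

lemma riesz_representation:
  fixes H :: "'a set" and add :: "'a \<Rightarrow> 'a \<Rightarrow> 'a" and scl :: "real \<Rightarrow> 'a \<Rightarrow> 'a"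
    and B :: "'a \<Rightarrow> 'a \<Rightarrow> real" and T :: "'a \<Rightarrow> real"
  assumes ne: "H \<noteq> {}"
    and add: "\<And>x y. x \<in> H \<Longrightarrow> y \<in> H \<Longrightarrow> add x y \<in> H" and scl: "\<And>c x. x \<in> H \<Longrightarrow> scl c x \<in> H"
    and sym: "\<And>x y. x \<in> H \<Longrightarrow> y \<in> H \<Longrightarrow> B x y = B y x"
    and Badd: "\<And>x y z. x \<in> H \<Longrightarrow> y \<in> H \<Longrightarrow> z \<in> H \<Longrightarrow> B (add x y) z = B x z + B y z"
    and Bscl: "\<And>c x z. x \<in> H \<Longrightarrow> z \<in> H \<Longrightarrow> B (scl c x) z = c * B x z"
    and nn: "\<And>x. x \<in> H \<Longrightarrow> 0 \<le> B x x"
    and Tadd: "\<And>x y. x \<in> H \<Longrightarrow> y \<in> H \<Longrightarrow> T (add x y) = T x + T y"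
    and Tscl: "\<And>c x. x \<in> H \<Longrightarrow> T (scl c x) = c * T x"
    and Tbd: "\<And>x. x \<in> H \<Longrightarrow> \<bar>T x\<bar> \<le> C * sqrt (B x x)"
    and complete: "\<And>X. (\<And>n::nat. X n \<in> H) \<Longrightarrow>
      (\<And>e. 0 < e \<Longrightarrow> \<exists>K. \<forall>m\<ge>K. \<forall>n\<ge>K. B (add (X m) (scl (-1) (X n))) (add (X m) (scl (-1) (X n))) < e) \<Longrightarrow>
      \<exists>x\<in>H. (\<lambda>n. B (add (X n) (scl (-1) x)) (add (X n) (scl (-1) x))) \<longlonglongrightarrow> 0"
  shows "\<exists>g\<in>H. \<forall>r\<in>H. B g r = T r"
proof -
  \<comment> \<open>The representer will be the minimiser of this functional; completing the square
    with the bound on T keeps it above \<open>- C\<^sup>2\<close>.\<close>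
  define q where "q x = B x x - 2 * T x" for x
  have Bcomb: "B (add x (scl c y)) (add x (scl c y)) = B x x + 2 * c * B x y + c\<^sup>2 * B y y"
    if "x \<in> H" "y \<in> H" for x y c
  proof -
    have s: "scl c y \<in> H" "add x (scl c y) \<in> H" using that add scl by auto
    have "B (add x (scl c y)) (add x (scl c y)) = B x (add x (scl c y)) + c * B y (add x (scl c y))"
      using that s by (simp add: Badd Bscl)
    also have "B x (add x (scl c y)) = B x x + c * B y x"
      using that s by (subst sym) (simp_all add: Badd Bscl)
    also have "B y (add x (scl c y)) = B x y + c * B y y"
      using that s by (subst sym) (simp_all add: Badd Bscl)
    finally show ?thesis using sym[OF that] by (simp add: algebra_simps power2_eq_square)
  qed
  have Tcomb: "T (add x (scl c y)) = T x + c * T y" if "x \<in> H" "y \<in> H" for x y c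
    using that scl by (simp add: Tadd Tscl)
  have CS: "(B x y)\<^sup>2 \<le> B x x * B y y" if "x \<in> H" "y \<in> H" for x y
  proof -
    have "(\<bar>B x y\<bar>)\<^sup>2 \<le> B x x * B y y"
    proof (rule amgm_sq_bound)
      fix t :: real assume t: "0 < t"
      have "0 \<le> B x x + 2 * c * B x y + c\<^sup>2 * B y y" for c
        using nn[of "add x (scl c y)"] Bcomb[OF that, of c] add scl that by simp
      from this[of "1/t"] this[of "-1/t"]
      have "0 \<le> t * (B x x + 2 * (1/t) * B x y + (1/t)\<^sup>2 * B y y)"
        "0 \<le> t * (B x x - 2 * (1/t) * B x y + (1/t)\<^sup>2 * B y y)"
        using t by (auto intro!: mult_nonneg_nonneg)
      moreover have "t * (B x x + 2 * (1/t) * B x y + (1/t)\<^sup>2 * B y y) = t * B x x + 2 * B x y + B y y / t"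
        "t * (B x x - 2 * (1/t) * B x y + (1/t)\<^sup>2 * B y y) = t * B x x - 2 * B x y + B y y / t"
        using t by (simp_all add: power2_eq_square field_simps)
      ultimately have "0 \<le> t * B x x + 2 * B x y + B y y / t" "0 \<le> t * B x x - 2 * B x y + B y y / t"
        by (simp_all only:)
      moreover have "\<bar>w\<bar> \<le> (u + v) / 2" if "0 \<le> u + 2 * w + v" "0 \<le> u - 2 * w + v" for u v w :: real
        using that by (simp add: abs_if)
      ultimately show "\<bar>B x y\<bar> \<le> (t * B x x + B y y / t) / 2" by blast
    qed (use nn that in auto)
    then show ?thesis by simp
  qed
  have lower: "- C\<^sup>2 \<le> q x" if "x \<in> H" for x
  proof -
    have "0 \<le> (sqrt (B x x) - C)\<^sup>2" by simp
    then have "2 * (C * sqrt (B x x)) \<le> B x x + C\<^sup>2"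
      using nn[OF that] by (simp add: power2_diff mult.commute)
    then show ?thesis using Tbd[OF that] unfolding q_def by argo
  qed
  define m where "m = Inf (q ` H)"
  have bdd: "bdd_below (q ` H)" using lower by (auto intro!: bdd_belowI)
  have mle: "m \<le> q x" if "x \<in> H" for x unfolding m_def using bdd that by (auto intro: cInf_lower)
  have "\<exists>x\<in>H. q x < m + 1 / real (Suc n)" for n
    using cInf_lessD[of "q ` H" "m + 1 / real (Suc n)"] ne unfolding m_def by auto
  then obtain X where X: "\<And>n. X n \<in> H" "\<And>n. q (X n) < m + 1 / real (Suc n)" by metis
  \<comment> \<open>Parallelogram law: the midpoint of x and y also has value at least m, so two
    near-minimisers are close. A minimising sequence is therefore Cauchy.\<close>
  have par: "B (add x (scl (-1) y)) (add x (scl (-1) y)) \<le> 2 * (q x - m) + 2 * (q y - m)"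
    if "x \<in> H" "y \<in> H" for x y
  proof -
    have h: "add x (scl 1 y) \<in> H" using that add scl by auto
    then have h2: "scl (1/2) (add x (scl 1 y)) \<in> H" using scl by auto
    have "B (scl (1/2) (add x (scl 1 y))) (scl (1/2) (add x (scl 1 y))) = (B x x + 2 * B x y + B y y) / 4"
      using h h2 Bcomb[OF that, of 1] sym[OF h h2] by (simp add: Bscl)
    moreover have "T (scl (1/2) (add x (scl 1 y))) = (T x + T y) / 2"
      using h Tcomb[OF that, of 1] by (simp add: Tscl)
    ultimately have "4 * q (scl (1/2) (add x (scl 1 y))) = B x x + 2 * B x y + B y y - 4 * T x - 4 * T y"
      unfolding q_def by simp
    moreover have "B (add x (scl (-1) y)) (add x (scl (-1) y)) = B x x - 2 * B x y + B y y"
      using Bcomb[OF that, of "-1"] by simp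
    moreover have "d \<le> 2 * (b - 2 * u - m) + 2 * (c - 2 * v - m)"
      if "4 * w = b + 2 * z + c - 4 * u - 4 * v" "d = b - 2 * z + c" "m \<le> w" for b c d u v w z :: real
      using that by argo
    ultimately show ?thesis using mle[OF h2] unfolding q_def by blast
  qed
  have "\<exists>x\<in>H. (\<lambda>n. B (add (X n) (scl (-1) x)) (add (X n) (scl (-1) x))) \<longlonglongrightarrow> 0"
  proof (rule complete[OF X(1)])
    fix e :: real assume e: "0 < e"
    obtain K where K: "1 / real (Suc K) < e / 4" using e by (metis nat_approx_posE divide_pos_pos zero_less_numeral)
    show "\<exists>K. \<forall>m\<ge>K. \<forall>n\<ge>K. B (add (X m) (scl (-1) (X n))) (add (X m) (scl (-1) (X n))) < e"
    proof (intro exI allI impI)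
      fix i j assume ij: "K \<le> i" "K \<le> j"
      have "1 / real (Suc i) \<le> 1 / real (Suc K)" "1 / real (Suc j) \<le> 1 / real (Suc K)"
        using ij by (auto intro!: divide_left_mono)
      then show "B (add (X i) (scl (-1) (X j))) (add (X i) (scl (-1) (X j))) < e"
        using par[OF X(1) X(1), of i j] X(2)[of i] X(2)[of j] K by argo
    qed
  qed
  then obtain g where g: "g \<in> H" and lim: "(\<lambda>n. B (add (X n) (scl (-1) g)) (add (X n) (scl (-1) g))) \<longlonglongrightarrow> 0"
    by blast
  have "B g r = T r" if r: "r \<in> H" for r
  proof -
    have conv: "(\<lambda>n. B (X n) r) \<longlonglongrightarrow> B g r"
    proof -
      have "(\<lambda>n. sqrt (B (add (X n) (scl (-1) g)) (add (X n) (scl (-1) g)) * B r r)) \<longlonglongrightarrow> sqrt (0 * B r r)"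
        by (intro tendsto_intros lim)
      then have lim0: "(\<lambda>n. sqrt (B (add (X n) (scl (-1) g)) (add (X n) (scl (-1) g)) * B r r)) \<longlonglongrightarrow> 0"
        by (simp only: mult_zero_left real_sqrt_zero)
      have bd: "norm (B (X n) r - B g r) \<le> sqrt (B (add (X n) (scl (-1) g)) (add (X n) (scl (-1) g)) * B r r)" for n
      proof -
        have h: "scl (-1) g \<in> H" "add (X n) (scl (-1) g) \<in> H" using g X add scl by auto
        have "B (X n) r - B g r = B (add (X n) (scl (-1) g)) r"
          using h X g r by (simp add: Badd Bscl)
        then show ?thesis
          using real_sqrt_le_mono[OF CS[OF h(2) r]] by (simp only: real_sqrt_abs real_norm_def)
      qed
      have "(\<lambda>n. B (X n) r - B g r) \<longlonglongrightarrow> 0"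
        by (rule Lim_null_comparison[OF always_eventually lim0]) (intro allI bd)
      then show ?thesis by (simp add: LIM_zero_iff)
    qed
    \<comment> \<open>Perturbing \<open>X n\<close> lowers q by less than \<open>1 / Suc n\<close>;
      passing to the limit in this inequality gives near-optimality at g without evaluating q
      there.\<close>
    have ge: "0 \<le> t\<^sup>2 * B r r + 2 * t * (B g r - T r)" for t
    proof (rule LIMSEQ_le)
      show "(\<lambda>n. - 1 / real (Suc n)) \<longlonglongrightarrow> 0"
        using tendsto_minus[OF LIMSEQ_Suc[OF lim_1_over_n]] by simp
      show "(\<lambda>n. t\<^sup>2 * B r r + 2 * t * (B (X n) r - T r)) \<longlonglongrightarrow> t\<^sup>2 * B r r + 2 * t * (B g r - T r)"
        by (intro tendsto_intros conv)
      have "- 1 / real (Suc n) \<le> t\<^sup>2 * B r r + 2 * t * (B (X n) r - T r)" for n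
        using mle[of "add (X n) (scl t r)"] X[of n] add scl r Bcomb[OF X(1) r, of n t] Tcomb[OF X(1) r, of n t]
        unfolding q_def by (auto simp: algebra_simps)
      then show "\<exists>N. \<forall>n\<ge>N. - 1 / real (Suc n) \<le> t\<^sup>2 * B r r + 2 * t * (B (X n) r - T r)" by blast
    qed
    show "B g r = T r"
    proof (rule ccontr)
      assume ne: "B g r \<noteq> T r"
      let ?D = "B g r - T r"
      have b: "0 \<le> B r r" by (rule nn[OF r])
      \<comment> \<open>The quadratic would be minimal at \<open>- ?D / B r r\<close>; the added 1
        keeps the denominator positive when \<open>B r r\<close> is zero.\<close>
      let ?t = "- ?D / (B r r + 1)"
      have "?t\<^sup>2 * B r r + 2 * ?t * ?D = ?D\<^sup>2 / (B r r + 1) * (B r r / (B r r + 1) - 2)"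
      proof -
        have *: "(- D / c)\<^sup>2 * b + 2 * (- D / c) * D = D\<^sup>2 / c * (b / c - 2)" if "c \<noteq> 0" for D b c :: real
          using that by (simp add: power2_eq_square field_simps)
        show ?thesis by (rule *) (use b in simp)
      qed
      moreover have "0 < ?D\<^sup>2 / (B r r + 1)" using ne b by (auto intro!: divide_pos_pos)
      moreover have "B r r / (B r r + 1) - 2 < 0" using b by (simp add: field_simps)
      ultimately have "?t\<^sup>2 * B r r + 2 * ?t * ?D < 0" by (simp only: mult_pos_neg)
      with ge[of ?t] show False by argo
    qed
  qed
  then show ?thesis using g by blast
qed

text \<open>Multiplied by \<open>2^n\<close>, the squared increments still have integrals at most
  \<open>(1/2)^n\<close>, so almost everywhere these products are bounded in n and the increments
  are dominated by a geometric series of ratio \<open>sqrt (1/2)\<close>. The increments themselves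
  are never integrated, so the argument works for arbitrary measures.\<close>

lemma AE_convergent_of_fast_cauchy:
  fixes Y :: "nat \<Rightarrow> 'a \<Rightarrow> complex"
  assumes Y: "\<And>n. sqi M (Y n)"
    and fast: "\<And>n. (\<integral>x. (cmod (Y (Suc n) x - Y n x))\<^sup>2 \<partial>M) \<le> (1/4)^n"
  shows "AE x in M. convergent (\<lambda>n. Y n x)"
proof -
  define u where "u n x = 2^n * (cmod (Y (Suc n) x - Y n x))\<^sup>2" for n x
  have ui: "integrable M (u n)" for n
    unfolding u_def using sqi_integrable_sq[OF sqi_diff[OF Y Y, of "Suc n" n]] by simp
  then have um [measurable]: "u n \<in> borel_measurable M" for n by (rule borel_measurable_integrable)
  have unn: "0 \<le> u n x" for n x by (simp add: u_def)
  have "integral\<^sup>L M (u n) \<le> 2^n * (1/4)^n" for n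
    unfolding u_def using fast[of n] by simp
  then have ub: "integral\<^sup>L M (u n) \<le> (1/2)^n" for n
    by (simp add: power_mult_distrib[symmetric])
  have "(\<integral>\<^sup>+x. (\<Sum>n. ennreal (u n x)) \<partial>M) = (\<Sum>n. \<integral>\<^sup>+x. ennreal (u n x) \<partial>M)"
    by (rule nn_integral_suminf) measurable
  also have "\<dots> = (\<Sum>n. ennreal (integral\<^sup>L M (u n)))"
    using ui unn by (intro suminf_cong nn_integral_eq_integral) auto
  also have "\<dots> \<le> (\<Sum>n. ennreal ((1/2)^n))"
    using ub by (intro suminf_le ennreal_leI) auto
  also have "\<dots> = ennreal (\<Sum>n. (1/2)^n)"
    by (intro suminf_ennreal2) (auto intro!: summable_geometric)
  finally have "(\<integral>\<^sup>+x. (\<Sum>n. ennreal (u n x)) \<partial>M) \<noteq> \<infinity>" by (auto simp: top_unique)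
  then have "AE x in M. (\<Sum>n. ennreal (u n x)) \<noteq> \<infinity>"
    by (intro nn_integral_PInf_AE) measurable
  then show ?thesis
  proof (rule eventually_mono)
    fix x assume "(\<Sum>n. ennreal (u n x)) \<noteq> \<infinity>"
    then have "summable (\<lambda>n. u n x)"
      using unn summable_suminf_not_top by fastforce
    then have "Bseq (\<lambda>n. u n x)"
      by (intro convergent_imp_Bseq convergentI[OF summable_LIMSEQ_zero])
    then obtain C where C: "C > 0" "\<And>n. u n x \<le> C"
      unfolding Bseq_def real_norm_def by (meson abs_le_D1)
    have "norm (Y (Suc n) x - Y n x) \<le> sqrt C * (sqrt (1/2))^n" for n
    proof -
      have "(cmod (Y (Suc n) x - Y n x))\<^sup>2 \<le> C * (1/2)^n"
        using C(2)[of n] by (simp add: u_def field_simps power_divide)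
      then have "cmod (Y (Suc n) x - Y n x) \<le> sqrt (C * (1/2)^n)"
        by (rule real_le_rsqrt)
      then show ?thesis by (simp only: real_sqrt_mult real_sqrt_power)
    qed
    note dec = this
    have "summable (\<lambda>n. sqrt C * (sqrt (1/2))^n)"
    proof (intro summable_mult summable_geometric)
      have "sqrt (1/2) < sqrt 1" by (subst real_sqrt_less_iff) simp
      then show "norm (sqrt (1/2)) < 1" by simp
    qed
    then have "summable (\<lambda>n. Y (Suc n) x - Y n x)"
      by (rule summable_comparison_test'[where N = 0]) (rule dec)
    then have "convergent (\<lambda>n. \<Sum>i<n. Y (Suc i) x - Y i x)"
      by (simp add: summable_iff_convergent)
    then have "convergent (\<lambda>n. (Y n x - Y 0 x) + Y 0 x)"
      unfolding sum_lessThan_telescope[of "\<lambda>i. Y i x"] by (intro convergent_add convergent_const)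
    then show "convergent (\<lambda>n. Y n x)" by simp
  qed
qed

text \<open>Riesz-Fischer: a fast subsequence converges almost everywhere, and Fatou's lemma turns
  the Cauchy bound between \<open>X m\<close> and the subsequence into one between
  \<open>X m\<close> and its limit.\<close>

lemma sqi_complete:
  fixes X :: "nat \<Rightarrow> 'a \<Rightarrow> complex"
  assumes X: "\<And>n. sqi M (X n)"
    and cauchy: "\<And>e. 0 < e \<Longrightarrow> \<exists>K. \<forall>m\<ge>K. \<forall>n\<ge>K. (\<integral>x. (cmod (X m x - X n x))\<^sup>2 \<partial>M) < e"
  shows "\<exists>f. sqi M f \<and> (\<lambda>n. \<integral>x. (cmod (X n x - f x))\<^sup>2 \<partial>M) \<longlonglongrightarrow> 0"
proof -
  have "\<forall>i::nat. \<exists>K. \<forall>m\<ge>K. \<forall>n\<ge>K. (\<integral>x. (cmod (X m x - X n x))\<^sup>2 \<partial>M) < (1/4)^i"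
    using cauchy by simp
  then obtain K where K: "\<And>i m n. K i \<le> m \<Longrightarrow> K i \<le> n \<Longrightarrow> (\<integral>x. (cmod (X m x - X n x))\<^sup>2 \<partial>M) < (1/4)^i"
    by metis
  \<comment> \<open>Adding i and summing all thresholds makes the indices increasing, beyond
    \<open>K i\<close>, and unbounded.\<close>
  define s where "s i = i + (\<Sum>j\<le>i. K j)" for i
  have sK: "K i \<le> s i" for i
    unfolding s_def using member_le_sum[of i "{..i}" K] by simp
  have sS: "s i \<le> s (Suc i)" for i unfolding s_def by simp
  have si: "i \<le> s i" for i unfolding s_def by simp
  define Y where "Y n = X (s n)" for n
  have Y: "sqi M (Y n)" for n by (simp add: Y_def X)
  have Ym [measurable]: "Y n \<in> borel_measurable M" "X n \<in> borel_measurable M" for n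
    using Y X by (auto simp: sqi_def)
  have "(\<integral>x. (cmod (Y (Suc n) x - Y n x))\<^sup>2 \<partial>M) \<le> (1/4)^n" for n
    unfolding Y_def using K[of n "s (Suc n)" "s n"] sK[of n] sS[of n] by linarith
  then have conv: "AE x in M. convergent (\<lambda>n. Y n x)"
    by (rule AE_convergent_of_fast_cauchy[OF Y])
  \<comment> \<open>\<open>lim\<close> is total, so f is measurable whatever its values off the
    convergence set.\<close>
  define f where "f x = lim (\<lambda>n. Y n x)" for x
  have fm [measurable]: "f \<in> borel_measurable M"
    unfolding f_def by (rule borel_measurable_lim_metric) (rule Ym)
  have bound: "(\<integral>\<^sup>+x. ennreal ((cmod (X m x - f x))\<^sup>2) \<partial>M) \<le> ennreal e"
    if e: "0 < e" and L: "\<And>m n. L \<le> m \<Longrightarrow> L \<le> n \<Longrightarrow> (\<integral>x. (cmod (X m x - X n x))\<^sup>2 \<partial>M) < e" and m: "L \<le> m" for e L m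
  proof -
    have "(\<integral>\<^sup>+x. ennreal ((cmod (X m x - f x))\<^sup>2) \<partial>M)
        = (\<integral>\<^sup>+x. liminf (\<lambda>n. ennreal ((cmod (X m x - Y n x))\<^sup>2)) \<partial>M)"
    proof (rule nn_integral_cong_AE, use conv in \<open>rule eventually_mono\<close>)
      fix x assume "convergent (\<lambda>n. Y n x)"
      then have "(\<lambda>n. Y n x) \<longlonglongrightarrow> f x" by (simp add: f_def convergent_LIMSEQ_iff)
      then have "(\<lambda>n. ennreal ((cmod (X m x - Y n x))\<^sup>2)) \<longlonglongrightarrow> ennreal ((cmod (X m x - f x))\<^sup>2)"
        by (intro tendsto_ennrealI tendsto_intros)
      then show "ennreal ((cmod (X m x - f x))\<^sup>2) = liminf (\<lambda>n. ennreal ((cmod (X m x - Y n x))\<^sup>2))"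
        using lim_imp_Liminf[OF sequentially_bot] by metis
    qed
    also have "\<dots> \<le> liminf (\<lambda>n. \<integral>\<^sup>+x. ennreal ((cmod (X m x - Y n x))\<^sup>2) \<partial>M)"
      by (rule nn_integral_liminf) measurable
    also have "\<dots> \<le> ennreal e"
    proof (rule Liminf_le)
      show "\<forall>\<^sub>F n in sequentially. (\<integral>\<^sup>+x. ennreal ((cmod (X m x - Y n x))\<^sup>2) \<partial>M) \<le> ennreal e"
      proof (rule eventually_sequentiallyI)
        fix n assume "L \<le> n"
        then have "L \<le> s n" using si[of n] by simp
        have "(\<integral>\<^sup>+x. ennreal ((cmod (X m x - Y n x))\<^sup>2) \<partial>M) = ennreal (\<integral>x. (cmod (X m x - Y n x))\<^sup>2 \<partial>M)"
          using sqi_diff[OF X Y, of m n] by (intro nn_integral_eq_integral) (auto simp: sqi_def)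
        also have "\<dots> \<le> ennreal e"
          using L[OF m \<open>L \<le> s n\<close>] by (intro ennreal_leI) (simp add: Y_def)
        finally show "(\<integral>\<^sup>+x. ennreal ((cmod (X m x - Y n x))\<^sup>2) \<partial>M) \<le> ennreal e" .
      qed
    qed simp
    finally show ?thesis .
  qed
  have dsq: "sqi M (\<lambda>x. X m x - f x)" if "0 < e" "\<And>m n. L \<le> m \<Longrightarrow> L \<le> n \<Longrightarrow> (\<integral>x. (cmod (X m x - X n x))\<^sup>2 \<partial>M) < e" "L \<le> m" for e L m
    unfolding sqi_def
  proof
    show "integrable M (\<lambda>x. (cmod (X m x - f x))\<^sup>2)"
      by (rule integrableI_bounded) (use bound[OF that] in \<open>auto intro: le_less_trans\<close>)
  qed measurable
  obtain L1 where L1: "\<And>m n. L1 \<le> m \<Longrightarrow> L1 \<le> n \<Longrightarrow> (\<integral>x. (cmod (X m x - X n x))\<^sup>2 \<partial>M) < 1"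
    using cauchy[of 1] by auto
  have "sqi M (\<lambda>x. X L1 x - (X L1 x - f x))"
    by (rule sqi_diff[OF X dsq[OF _ L1]]) auto
  then have fs: "sqi M f" by simp
  have "(\<lambda>n. \<integral>x. (cmod (X n x - f x))\<^sup>2 \<partial>M) \<longlonglongrightarrow> 0"
  proof (rule LIMSEQ_I)
    fix r :: real assume r: "0 < r"
    obtain L where L: "\<And>m n. L \<le> m \<Longrightarrow> L \<le> n \<Longrightarrow> (\<integral>x. (cmod (X m x - X n x))\<^sup>2 \<partial>M) < r / 2"
      using cauchy[of "r/2"] r by auto
    have "(\<integral>x. (cmod (X n x - f x))\<^sup>2 \<partial>M) < r" if n: "L \<le> n" for n
    proof -
      have "ennreal (\<integral>x. (cmod (X n x - f x))\<^sup>2 \<partial>M) = (\<integral>\<^sup>+x. ennreal ((cmod (X n x - f x))\<^sup>2) \<partial>M)"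
        using sqi_diff[OF X fs, of n] by (intro nn_integral_eq_integral[symmetric]) (auto simp: sqi_def)
      also have "\<dots> \<le> ennreal (r / 2)" using bound[OF _ L n] r by simp
      finally show ?thesis using r by (simp add: ennreal_le_iff)
    qed
    then show "\<exists>no. \<forall>n\<ge>no. norm ((\<integral>x. (cmod (X n x - f x))\<^sup>2 \<partial>M) - 0) < r"
      by (intro exI[of _ L]) auto
  qed
  with fs show ?thesis by blast
qed

section \<open>Functions on the box\<close>

lemma wgt_neq_0 [simp]: "wgt lam z \<noteq> 0"
  by (simp add: wgt_def)

locale semidiscrete_grid =
  fixes N :: nat and h \<xi> d kl ku :: real
  assumes h_pos: "0 < h" and xi_pos: "0 < \<xi>" and d_pos: "0 < d" and kl_pos: "0 < kl" and kl_less: "kl < ku"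
begin

abbreviation "A \<equiv> {-\<xi>..d}"
abbreviation "K \<equiv> {kl..ku}"
abbreviation "Mz \<equiv> intv (-\<xi>) d"
abbreviation "Mk \<equiv> intv kl ku"
abbreviation "\<nu> \<equiv> Mz \<Otimes>\<^sub>M Mk"

lemma ku_pos: "0 < ku" and ku_ge: "0 \<le> ku - kl" and len_pos: "0 < d + \<xi>"
  using kl_pos kl_less xi_pos d_pos by auto

sublocale z: finite_measure Mz by (rule finite_measure_intv)
sublocale k: finite_measure Mk by (rule finite_measure_intv)
sublocale zk: pair_sigma_finite Mz Mk ..

lemma measure_Mz [simp]: "measure Mz A = d + \<xi>"
  using xi_pos d_pos by (subst measure_intv) auto

lemma measure_Mk [simp]: "measure Mk K = ku - kl"
  using kl_less by (subst measure_intv) auto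

lemma space_nu [simp]: "space \<nu> = A \<times> K"
  by (simp add: space_pair_measure)

text \<open>The definitions measure functions on a rectangle in the plane, while Fubini and the
  slice estimates work on a product of two finite measures; this identity connects them. A product
  measure is determined by its values on rectangles.\<close>

lemma box_restrict_space: "restrict_space lborel (A \<times> K) = \<nu>"
proof (rule sym, rule pair_measure_eqI)
  show "sigma_finite_measure Mz" "sigma_finite_measure Mk" by unfold_locales
  let ?R = "restrict_space (lborel :: (real \<times> real) measure) (A \<times> K)"
  have sp: "space ?R = A \<times> K" by (simp add: space_restrict_space)
  have idz: "(\<lambda>x. x) \<in> measurable Mz lborel" and idk: "(\<lambda>x. x) \<in> measurable Mk lborel"
    by (simp_all add: measurable_restrict_space1)
  have 1: "(\<lambda>x. x) \<in> measurable \<nu> ?R"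
  proof (rule measurable_restrict_space2)
    have "(\<lambda>x. (fst x, snd x)) \<in> measurable \<nu> (lborel \<Otimes>\<^sub>M lborel)"
      using measurable_compose[OF measurable_fst idz] measurable_compose[OF measurable_snd idk]
      by (rule measurable_Pair)
    then show "(\<lambda>x. x) \<in> measurable \<nu> lborel" by (simp add: lborel_prod)
  qed (auto simp: space_pair_measure)
  have f: "fst \<in> measurable (lborel :: (real \<times> real) measure) (lborel :: real measure)"
    and s: "snd \<in> measurable (lborel :: (real \<times> real) measure) (lborel :: real measure)"
    unfolding lborel_prod[symmetric] by measurable
  have "(\<lambda>x. (fst x, snd x)) \<in> measurable ?R \<nu>"
  proof (rule measurable_Pair)
    show "fst \<in> measurable ?R Mz"
      by (rule measurable_restrict_space2) (use measurable_restrict_space1[OF f] in \<open>auto simp: sp\<close>)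
    show "snd \<in> measurable ?R Mk"
      by (rule measurable_restrict_space2) (use measurable_restrict_space1[OF s] in \<open>auto simp: sp\<close>)
  qed
  then have 2: "(\<lambda>x. x) \<in> measurable ?R \<nu>" by simp
  show "sets \<nu> = sets ?R"
  proof
    show "sets \<nu> \<subseteq> sets ?R"
    proof
      fix X assume X: "X \<in> sets \<nu>"
      have "X \<subseteq> A \<times> K" using sets.sets_into_space[OF X] by simp
      then show "X \<in> sets ?R" using measurable_sets[OF 2 X] by (simp add: sp Int_absorb2)
    qed
    show "sets ?R \<subseteq> sets \<nu>"
    proof
      fix X assume X: "X \<in> sets ?R"
      have "X \<subseteq> A \<times> K" using sets.sets_into_space[OF X] sp by simp
      then show "X \<in> sets \<nu>" using measurable_sets[OF 1 X] by (simp add: Int_absorb2)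
    qed
  qed
  fix X Y assume X: "X \<in> sets Mz" and Y: "Y \<in> sets Mk"
  then have XY: "X \<subseteq> A" "Y \<subseteq> K" "X \<in> sets lborel" "Y \<in> sets lborel"
    by (auto simp: sets_restrict_space)
  have "emeasure ?R (X \<times> Y) = emeasure (lborel \<Otimes>\<^sub>M lborel) (X \<times> Y)"
    using XY borel_closed[OF closed_Times[of A K]] by (subst emeasure_restrict_space) (auto simp: lborel_prod)
  also have "\<dots> = emeasure lborel X * emeasure lborel Y"
    using XY by (intro lborel.emeasure_pair_measure_Times) auto
  also have "\<dots> = emeasure Mz X * emeasure Mk Y"
    using XY by (simp add: emeasure_restrict_space)
  finally show "emeasure Mz X * emeasure Mk Y = emeasure ?R (X \<times> Y)" by simp
qed

lemma box_set_measurable: "set_borel_measurable lborel (A \<times> K) f \<longleftrightarrow> f \<in> borel_measurable \<nu>"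
  for f :: "real \<times> real \<Rightarrow> complex"
  unfolding box_restrict_space[symmetric] set_borel_measurable_def
  by (subst borel_measurable_restrict_space_iff) (simp_all add: lborel_prod[symmetric])

lemma box_set_integrable: "set_integrable lborel (A \<times> K) f \<longleftrightarrow> integrable \<nu> f"
  for f :: "real \<times> real \<Rightarrow> real"
  unfolding box_restrict_space[symmetric]
  by (rule set_integrable_eq) (simp add: lborel_prod[symmetric])

lemma box_iterated_integral:
  fixes f :: "real \<Rightarrow> real \<Rightarrow> 'b::{banach, second_countable_topology}"
  assumes "integrable \<nu> (case_prod f)"
  shows "(LINT k:K|lborel. LINT z:A|lborel. f z k) = integral\<^sup>L \<nu> (case_prod f)"
  unfolding set_integral_intv by (rule zk.integral_snd[OF assms])

abbreviation L2 :: "(real \<Rightarrow> real \<Rightarrow> complex) \<Rightarrow> bool" where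
  "L2 u \<equiv> sqi \<nu> (case_prod u)"

definition nsq :: "real \<Rightarrow> (real \<Rightarrow> real \<Rightarrow> complex) \<Rightarrow> real" where
  "nsq lam u = (\<integral>(z,k). (cmod (u z k))\<^sup>2 * wgt lam z \<partial>\<nu>)"

lemma wgt_measurable_nu [measurable]: "(\<lambda>x. wgt lam (fst x)) \<in> borel_measurable \<nu>"
proof -
  have "wgt lam \<in> borel_measurable Mz" by (simp add: measurable_restrict_space1)
  then show ?thesis by (rule measurable_compose[OF measurable_fst])
qed

lemma integrable_wgt:
  fixes f :: "real \<times> real \<Rightarrow> real"
  assumes f: "integrable \<nu> f"
  shows "integrable \<nu> (\<lambda>x. f x * wgt lam (fst x))"
proof (rule Bochner_Integration.integrable_bound)
  show "integrable \<nu> (\<lambda>x. f x * exp (2 * \<bar>lam\<bar> * (\<bar>-\<xi>\<bar> + \<bar>d\<bar>)))" using f by simp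
  show "(\<lambda>x. f x * wgt lam (fst x)) \<in> borel_measurable \<nu>"
    using borel_measurable_integrable[OF f] by measurable
  show "AE x in \<nu>. norm (f x * wgt lam (fst x)) \<le> norm (f x * exp (2 * \<bar>lam\<bar> * (\<bar>-\<xi>\<bar> + \<bar>d\<bar>)))"
  proof (rule AE_I2)
    fix x assume "x \<in> space \<nu>"
    then have "wgt lam (fst x) \<le> exp (2 * \<bar>lam\<bar> * (\<bar>-\<xi>\<bar> + \<bar>d\<bar>))" by (intro wgt_bounds) auto
    then show "norm (f x * wgt lam (fst x)) \<le> norm (f x * exp (2 * \<bar>lam\<bar> * (\<bar>-\<xi>\<bar> + \<bar>d\<bar>)))"
      by (simp only: real_norm_def abs_mult) (intro mult_left_mono, simp_all)
  qed
qed

lemma nsq_integrable: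
  assumes "L2 u"
  shows "integrable \<nu> (\<lambda>(z,k). (cmod (u z k))\<^sup>2 * wgt lam z)"
  using integrable_wgt[OF sqi_integrable_sq[OF assms], of lam] by (simp add: case_prod_unfold)

lemma nsq_nonneg: "0 \<le> nsq lam u"
  unfolding nsq_def by (rule integral_nonneg_AE) (simp add: case_prod_unfold)

lemma nsq_0: "nsq 0 u = (\<integral>(z,k). (cmod (u z k))\<^sup>2 \<partial>\<nu>)"
  by (simp add: nsq_def)

lemma nsq_mono:
  assumes "L2 u" "\<And>z k. z \<in> A \<Longrightarrow> k \<in> K \<Longrightarrow> wgt lam' z \<le> c * wgt lam z"
  shows "nsq lam' u \<le> c * nsq lam u"
proof -
  have "nsq lam' u \<le> (\<integral>x. c * (case x of (z,k) \<Rightarrow> (cmod (u z k))\<^sup>2 * wgt lam z) \<partial>\<nu>)"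
    unfolding nsq_def
  proof (rule integral_mono)
    show "integrable \<nu> (\<lambda>(z,k). (cmod (u z k))\<^sup>2 * wgt lam' z)" by (rule nsq_integrable[OF assms(1)])
    show "integrable \<nu> (\<lambda>x. c * (case x of (z,k) \<Rightarrow> (cmod (u z k))\<^sup>2 * wgt lam z))"
      using nsq_integrable[OF assms(1)] by simp
    fix x assume "x \<in> space \<nu>"
    then show "(case x of (z,k) \<Rightarrow> (cmod (u z k))\<^sup>2 * wgt lam' z) \<le> c * (case x of (z,k) \<Rightarrow> (cmod (u z k))\<^sup>2 * wgt lam z)"
      using assms(2)[of "fst x" "snd x"]
      by (auto simp: mult.left_commute[of c] intro!: mult_left_mono)
  qed
  then show ?thesis by (simp add: nsq_def)
qed

lemma nsq_add: "L2 u \<Longrightarrow> L2 v \<Longrightarrow> nsq lam (\<lambda>z k. u z k + v z k) \<le> 2 * nsq lam u + 2 * nsq lam v"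
proof -
  assume uv: "L2 u" "L2 v"
  have s: "L2 (\<lambda>z k. u z k + v z k)" using sqi_add[OF uv] by (simp add: case_prod_unfold)
  have "nsq lam (\<lambda>z k. u z k + v z k) \<le> (\<integral>x. 2 * (case x of (z,k) \<Rightarrow> (cmod (u z k))\<^sup>2 * wgt lam z)
     + 2 * (case x of (z,k) \<Rightarrow> (cmod (v z k))\<^sup>2 * wgt lam z) \<partial>\<nu>)"
    unfolding nsq_def
  proof (rule integral_mono)
    fix x
    show "(case x of (z,k) \<Rightarrow> (cmod (u z k + v z k))\<^sup>2 * wgt lam z) \<le>
      2 * (case x of (z,k) \<Rightarrow> (cmod (u z k))\<^sup>2 * wgt lam z) + 2 * (case x of (z,k) \<Rightarrow> (cmod (v z k))\<^sup>2 * wgt lam z)"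
      using mult_right_mono[OF norm_add_sq_le[of "u (fst x) (snd x)" "v (fst x) (snd x)"], of "wgt lam (fst x)"]
      by (simp add: case_prod_unfold algebra_simps)
  qed (use nsq_integrable[OF s] nsq_integrable[OF uv(1)] nsq_integrable[OF uv(2)] in auto)
  also have "\<dots> = 2 * nsq lam u + 2 * nsq lam v"
    using nsq_integrable[OF uv(1)] nsq_integrable[OF uv(2)] by (simp add: nsq_def)
  finally show ?thesis .
qed

lemma nsq_cmult: "nsq lam (\<lambda>z k. c * u z k) = (cmod c)\<^sup>2 * nsq lam u"
proof -
  have "nsq lam (\<lambda>z k. c * u z k) = (\<integral>x. (cmod c)\<^sup>2 * (case x of (z,k) \<Rightarrow> (cmod (u z k))\<^sup>2 * wgt lam z) \<partial>\<nu>)"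
    unfolding nsq_def by (intro Bochner_Integration.integral_cong) (auto simp: norm_mult power_mult_distrib)
  then show ?thesis by (simp add: nsq_def)
qed

section \<open>Slices, and mixed bounds in z and k\<close>

lemma slice_measurable:
  assumes "case_prod u \<in> borel_measurable \<nu>"
  shows "z \<in> A \<Longrightarrow> (\<lambda>k. u z k) \<in> borel_measurable Mk" "k \<in> K \<Longrightarrow> (\<lambda>z. u z k) \<in> borel_measurable Mz"
  using measurable_compose[OF measurable_Pair1' assms, of z] measurable_compose[OF measurable_Pair2' assms, of k]
  by auto

text \<open>A function bounded as in \<open>Sb\<close> times one bounded as in \<open>Bd\<close> is again bounded as in \<open>Sb\<close>;
  this is what controls the quadratic part of the operator.\<close>

definition Sb :: "real \<Rightarrow> (real \<Rightarrow> real \<Rightarrow> complex) \<Rightarrow> real \<Rightarrow> bool" where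
  "Sb lam u s \<longleftrightarrow> case_prod u \<in> borel_measurable \<nu> \<and>
     (\<forall>z\<in>A. integrable Mk (\<lambda>k. (cmod (u z k))\<^sup>2) \<and> wgt lam z * (\<integral>k. (cmod (u z k))\<^sup>2 \<partial>Mk) \<le> s)"

definition Bd :: "real \<Rightarrow> (real \<Rightarrow> real \<Rightarrow> complex) \<Rightarrow> real \<Rightarrow> bool" where
  "Bd lam u s \<longleftrightarrow> case_prod u \<in> borel_measurable \<nu> \<and> (\<forall>z\<in>A. \<forall>k\<in>K. wgt lam z * (cmod (u z k))\<^sup>2 \<le> s)"

lemma Sb_sqi: "Sb lam u s \<Longrightarrow> z \<in> A \<Longrightarrow> sqi Mk (u z)"
  unfolding Sb_def sqi_def using slice_measurable(1) by blast

lemma Sb_nonneg: "Sb lam u s \<Longrightarrow> 0 \<le> s"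
proof -
  assume *: "Sb lam u s"
  have "0 \<le> wgt lam d * (\<integral>k. (cmod (u d k))\<^sup>2 \<partial>Mk)" by (intro mult_nonneg_nonneg integral_nonneg_AE) auto
  also have "\<dots> \<le> s" using * xi_pos d_pos unfolding Sb_def by auto
  finally show ?thesis .
qed

lemma Bd_nonneg: "Bd lam u s \<Longrightarrow> 0 \<le> s"
proof -
  assume *: "Bd lam u s"
  have "0 \<le> wgt lam d * (cmod (u d ku))\<^sup>2" by simp
  also have "\<dots> \<le> s" using * xi_pos d_pos kl_less unfolding Bd_def by auto
  finally show ?thesis .
qed

lemma Sb_mono: "Sb lam u s \<Longrightarrow> s \<le> t \<Longrightarrow> Sb lam u t"
  unfolding Sb_def by (meson order_trans)

text \<open>The basic \<open>Sb\<close> estimates all reduce to a pointwise majorant of the squared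
  modulus whose integral in k is known; measurability and integrability of the slices are settled
  once here.\<close>

lemma Sb_dominated:
  assumes u: "case_prod u \<in> borel_measurable \<nu>"
    and G: "\<And>z. z \<in> A \<Longrightarrow> integrable Mk (G z)"
    and le: "\<And>z k. z \<in> A \<Longrightarrow> k \<in> K \<Longrightarrow> (cmod (u z k))\<^sup>2 \<le> G z k"
    and s: "\<And>z. z \<in> A \<Longrightarrow> wgt lam z * (\<integral>k. G z k \<partial>Mk) \<le> s"
  shows "Sb lam u s"
  unfolding Sb_def
proof (intro conjI ballI u)
  fix z assume z: "z \<in> A"
  have sq: "sqi Mk (u z)"
    by (rule sqi_bound[OF _ G[OF z]]) (use slice_measurable(1)[OF u z] le z in auto)
  then show "integrable Mk (\<lambda>k. (cmod (u z k))\<^sup>2)" by (simp add: sqi_def)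
  have "(\<integral>k. (cmod (u z k))\<^sup>2 \<partial>Mk) \<le> (\<integral>k. G z k \<partial>Mk)"
    using sq G[OF z] le z by (intro integral_mono) (auto simp: sqi_def)
  then have "wgt lam z * (\<integral>k. (cmod (u z k))\<^sup>2 \<partial>Mk) \<le> wgt lam z * (\<integral>k. G z k \<partial>Mk)"
    by (intro mult_left_mono) auto
  then show "wgt lam z * (\<integral>k. (cmod (u z k))\<^sup>2 \<partial>Mk) \<le> s" using s[OF z] by linarith
qed

lemma Sb_add: 
  assumes u: "Sb lam u s" and v: "Sb lam v t"
  shows "Sb lam (\<lambda>z k. u z k + v z k) (2 * s + 2 * t)"
proof (rule Sb_dominated[where G = "\<lambda>z k. 2 * (cmod (u z k))\<^sup>2 + 2 * (cmod (v z k))\<^sup>2"])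
  show "(\<lambda>(z,k). u z k + v z k) \<in> borel_measurable \<nu>"
    using u v borel_measurable_add[of "case_prod u" \<nu> "case_prod v"] by (simp add: Sb_def case_prod_unfold)
  fix z assume z: "z \<in> A"
  then show "integrable Mk (\<lambda>k. 2 * (cmod (u z k))\<^sup>2 + 2 * (cmod (v z k))\<^sup>2)"
    using u v by (auto simp: Sb_def)
  have "wgt lam z * (\<integral>k. 2 * (cmod (u z k))\<^sup>2 + 2 * (cmod (v z k))\<^sup>2 \<partial>Mk)
     = 2 * (wgt lam z * (\<integral>k. (cmod (u z k))\<^sup>2 \<partial>Mk)) + 2 * (wgt lam z * (\<integral>k. (cmod (v z k))\<^sup>2 \<partial>Mk))"
    using u v z by (subst Bochner_Integration.integral_add) (auto simp: Sb_def algebra_simps)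
  also have "\<dots> \<le> 2 * s + 2 * t" using u v z by (intro add_mono mult_left_mono) (auto simp: Sb_def)
  finally show "wgt lam z * (\<integral>k. 2 * (cmod (u z k))\<^sup>2 + 2 * (cmod (v z k))\<^sup>2 \<partial>Mk) \<le> 2 * s + 2 * t" .
qed (rule norm_add_sq_le)

lemma Sb_mult_bounded:
  assumes u: "Sb lam u s" and b: "case_prod b \<in> borel_measurable \<nu>"
    and le: "\<And>z k. z \<in> A \<Longrightarrow> k \<in> K \<Longrightarrow> (cmod (b z k))\<^sup>2 \<le> c"
  shows "Sb lam (\<lambda>z k. b z k * u z k) (c * s)"
proof (rule Sb_dominated[where G = "\<lambda>z k. c * (cmod (u z k))\<^sup>2"])
  have "(cmod (b d ku))\<^sup>2 \<le> c" by (rule le) (use xi_pos d_pos kl_less in auto)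
  then have c: "0 \<le> c" by (rule order_trans[rotated]) simp
  show "(\<lambda>(z,k). b z k * u z k) \<in> borel_measurable \<nu>"
    using u b borel_measurable_times[of "case_prod b" \<nu> "case_prod u"] by (simp add: Sb_def case_prod_unfold)
  fix z assume z: "z \<in> A"
  then show "integrable Mk (\<lambda>k. c * (cmod (u z k))\<^sup>2)" using u by (auto simp: Sb_def)
  show "(cmod (b z k * u z k))\<^sup>2 \<le> c * (cmod (u z k))\<^sup>2" if "k \<in> K" for k
    using le[OF z that] by (simp add: norm_mult power_mult_distrib mult_right_mono)
  show "wgt lam z * (\<integral>k. c * (cmod (u z k))\<^sup>2 \<partial>Mk) \<le> c * s"
    using u z c by (auto simp: Sb_def mult.left_commute intro!: mult_left_mono)
qed

lemma Sb_cmult: "Sb lam u s \<Longrightarrow> Sb lam (\<lambda>z k. c * u z k) ((cmod c)\<^sup>2 * s)"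
  by (rule Sb_mult_bounded) auto

lemma k_measurable: "(\<lambda>(z,k). complex_of_real k) \<in> borel_measurable \<nu>"
proof -
  have s: "snd \<in> borel_measurable \<nu>"
    using measurable_compose[OF measurable_snd id_measurable_intv[of kl ku], of Mz] by simp
  have "(\<lambda>x. complex_of_real (snd x)) \<in> borel_measurable \<nu>"
    by (intro borel_measurable_continuous_onI[of complex_of_real, THEN measurable_compose[rotated]] continuous_intros s)
  then show ?thesis by (simp add: case_prod_unfold)
qed

lemma Sb_kmult: "Sb lam u s \<Longrightarrow> Sb lam (\<lambda>z k. complex_of_real k * u z k) (ku\<^sup>2 * s)"
  using kl_pos by (intro Sb_mult_bounded k_measurable) (auto intro!: power_mono)

lemma Sb_diff: "Sb lam u s \<Longrightarrow> Sb lam v t \<Longrightarrow> Sb lam (\<lambda>z k. u z k - v z k) (2 * s + 2 * t)"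
  using Sb_add[of lam u s "\<lambda>z k. -1 * v z k" t] Sb_cmult[of lam v t "-1"] by simp

lemma Bd_imp_Sb:
  assumes "Bd lam u s"
  shows "Sb lam u ((ku - kl) * s)"
proof (rule Sb_dominated[where G = "\<lambda>z k. s / wgt lam z"])
  show "case_prod u \<in> borel_measurable \<nu>" using assms by (simp add: Bd_def)
  fix z k assume "z \<in> A" "k \<in> K"
  then show "(cmod (u z k))\<^sup>2 \<le> s / wgt lam z" using assms by (auto simp: Bd_def field_simps)
qed (use wgt_pos[THEN less_imp_neq] in auto)

text \<open>The weights are exponentials, so their exponents add. In the applications at least one
  exponent is 0: either factor can be made to carry the whole weight.\<close>

lemma Bd_mult_Sb:
  assumes b: "Bd lam b s" and u: "Sb lam' u t"
  shows "Sb (lam + lam') (\<lambda>z k. b z k * u z k) (s * t)"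
proof (rule Sb_dominated[where G = "\<lambda>z k. (s / wgt lam z) * (cmod (u z k))\<^sup>2"])
  have s: "0 \<le> s" by (rule Bd_nonneg[OF b])
  show "(\<lambda>(z,k). b z k * u z k) \<in> borel_measurable \<nu>"
    using u b borel_measurable_times[of "case_prod b" \<nu> "case_prod u"] by (simp add: Sb_def Bd_def case_prod_unfold)
  fix z assume z: "z \<in> A"
  then show "integrable Mk (\<lambda>k. (s / wgt lam z) * (cmod (u z k))\<^sup>2)" using u by (auto simp: Sb_def)
  show "(cmod (b z k * u z k))\<^sup>2 \<le> (s / wgt lam z) * (cmod (u z k))\<^sup>2" if "k \<in> K" for k
  proof -
    have "(cmod (b z k))\<^sup>2 \<le> s / wgt lam z" using b z that by (auto simp: Bd_def field_simps)
    from mult_right_mono[OF this, of "(cmod (u z k))\<^sup>2"] show ?thesis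
      by (simp add: norm_mult power_mult_distrib)
  qed
  have "wgt (lam + lam') z = wgt lam z * wgt lam' z"
    by (simp add: wgt_def mult_exp_exp algebra_simps)
  then have "wgt (lam + lam') z * (\<integral>k. (s / wgt lam z) * (cmod (u z k))\<^sup>2 \<partial>Mk)
      = s * (wgt lam' z * (\<integral>k. (cmod (u z k))\<^sup>2 \<partial>Mk))"
    using wgt_pos[of lam z] by (simp add: field_simps)
  also have "\<dots> \<le> s * t" using u z s by (auto simp: Sb_def intro!: mult_left_mono)
  finally show "wgt (lam + lam') z * (\<integral>k. (s / wgt lam z) * (cmod (u z k))\<^sup>2 \<partial>Mk) \<le> s * t" .
qed

text \<open>Integrating a bound that is uniform in z costs the length
  \<open>d + \<xi>\<close>.\<close>

lemma Sb_L2: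
  assumes u: "Sb lam u s"
  shows "L2 u" "nsq lam u \<le> (d + \<xi>) * s"
proof -
  have m [measurable]: "case_prod u \<in> borel_measurable \<nu>" using u by (simp add: Sb_def)
  have m2: "(\<lambda>(z,k). (cmod (u z k))\<^sup>2) \<in> borel_measurable \<nu>"
    using m by (simp add: case_prod_unfold)
  define F where "F z = (\<integral>k. (cmod (u z k))\<^sup>2 \<partial>Mk)" for z
  have Fm: "F \<in> borel_measurable Mz"
    unfolding F_def using m2 by (rule k.borel_measurable_lebesgue_integral)
  have F0: "0 \<le> F z" for z unfolding F_def by (rule integral_nonneg_AE) simp
  have Fle: "wgt lam z * F z \<le> s" if "z \<in> A" for z using u that by (auto simp: Sb_def F_def)
  have s0: "0 \<le> s" by (rule Sb_nonneg[OF u])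
  \<comment> \<open>Dividing by the weight bounds the slice norms themselves, which gives the joint
    integrability required by Fubini.\<close>
  have Fb: "F z \<le> s * exp (2 * \<bar>-lam\<bar> * (\<bar>-\<xi>\<bar> + \<bar>d\<bar>))" if z: "z \<in> A" for z
  proof -
    have "wgt (-lam) z * wgt lam z = 1" by (simp add: wgt_def mult_exp_exp)
    then have "F z = (wgt lam z * F z) * wgt (-lam) z" by (simp add: mult.commute mult.left_commute)
    also have "\<dots> \<le> s * exp (2 * \<bar>-lam\<bar> * (\<bar>-\<xi>\<bar> + \<bar>d\<bar>))"
      using Fle[OF z] wgt_bounds[OF z, of "-lam"] s0 by (intro mult_mono) auto
    finally show ?thesis .
  qed
  have "integrable Mz F"
  proof (rule Bochner_Integration.integrable_bound)
    show "integrable Mz (\<lambda>_. s * exp (2 * \<bar>-lam\<bar> * (\<bar>-\<xi>\<bar> + \<bar>d\<bar>)))" by simp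
    show "AE x in Mz. norm (F x) \<le> norm (s * exp (2 * \<bar>-lam\<bar> * (\<bar>-\<xi>\<bar> + \<bar>d\<bar>)))"
      using Fb F0 s0 by (intro AE_I2) (simp add: abs_mult)
  qed (rule Fm)
  then have "integrable \<nu> (\<lambda>(z,k). (cmod (u z k))\<^sup>2)"
    using u m2 by (intro zk.Fubini_integrable) (auto simp: F_def[symmetric] Sb_def intro!: AE_I2)
  then show L: "L2 u" using m by (simp add: sqi_def case_prod_unfold)
  have "nsq lam u = (\<integral>z. (\<integral>k. (cmod (u z k))\<^sup>2 * wgt lam z \<partial>Mk) \<partial>Mz)"
    unfolding nsq_def using zk.integral_fst[of "\<lambda>z k. (cmod (u z k))\<^sup>2 * wgt lam z"] nsq_integrable[OF L, of lam]
    by (simp add: case_prod_unfold)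
  also have "\<dots> = (\<integral>z. wgt lam z * F z \<partial>Mz)" by (simp add: F_def mult.commute)
  also have "\<dots> \<le> (\<integral>z. s \<partial>Mz)"
  proof (rule integral_mono)
    show "integrable Mz (\<lambda>z. wgt lam z * F z)"
    proof (rule Bochner_Integration.integrable_bound)
      show "integrable Mz (\<lambda>_. s)" by simp
      have "wgt lam \<in> borel_measurable Mz" by (simp add: measurable_restrict_space1)
      then show "(\<lambda>z. wgt lam z * F z) \<in> borel_measurable Mz" using Fm by measurable
      show "AE x in Mz. norm (wgt lam x * F x) \<le> norm s"
        using Fle F0 s0 by (intro AE_I2) (simp add: abs_mult)
    qed
  qed (use Fle in auto)
  finally show "nsq lam u \<le> (d + \<xi>) * s" by simp
qed

lemma L2_slice_integrable:
  assumes v: "L2 v"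
  shows "integrable Mk (\<lambda>k. \<integral>z. (cmod (v z k))\<^sup>2 * wgt lam z \<partial>Mz)"
    "(\<integral>k. (\<integral>z. (cmod (v z k))\<^sup>2 * wgt lam z \<partial>Mz) \<partial>Mk) = nsq lam v"
  using zk.integrable_snd[of "\<lambda>z k. (cmod (v z k))\<^sup>2 * wgt lam z"]
    zk.integral_snd[of "\<lambda>z k. (cmod (v z k))\<^sup>2 * wgt lam z"] nsq_integrable[OF v, of lam]
  by (simp_all add: nsq_def case_prod_unfold)

text \<open>The bound for primitives holds on each slice separately and is then integrated in k. For
  lam = 0 the gain \<open>1 / (2 * lam)\<close> is replaced by the length of the interval.\<close>

lemma Sb_primitive:
  assumes u: "case_prod u \<in> borel_measurable \<nu>" and v: "L2 v"
    and ac: "\<And>k. k \<in> K \<Longrightarrow> ac_on (-\<xi>) d (\<lambda>z. u z k) (\<lambda>z. v z k)"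
    and sq: "\<And>k. k \<in> K \<Longrightarrow> sqi Mz (\<lambda>z. v z k)"
    and 0: "\<And>k. k \<in> K \<Longrightarrow> u (-\<xi>) k = 0"
    and m: "lam > 0 \<and> m = 1 / (2 * lam) \<or> lam = 0 \<and> m = d + \<xi>"
  shows "Sb lam u (m * nsq lam v)"
proof (rule Sb_dominated[where G = "\<lambda>z k. (m * (\<integral>z. (cmod (v z k))\<^sup>2 * wgt lam z \<partial>Mz)) / wgt lam z"])
  fix z assume z: "z \<in> A"
  show "integrable Mk (\<lambda>k. (m * (\<integral>z. (cmod (v z k))\<^sup>2 * wgt lam z \<partial>Mz)) / wgt lam z)"
    using L2_slice_integrable(1)[OF v, of lam] by simp
  show "(cmod (u z k))\<^sup>2 \<le> (m * (\<integral>z. (cmod (v z k))\<^sup>2 * wgt lam z \<partial>Mz)) / wgt lam z" if "k \<in> K" for k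
    using weighted_primitive_bound[OF ac[OF that] sq[OF that] 0[OF that] z, of lam m] m wgt_pos[of lam z]
    by (auto simp: field_simps)
  show "wgt lam z * (\<integral>k. (m * (\<integral>z. (cmod (v z k))\<^sup>2 * wgt lam z \<partial>Mz)) / wgt lam z \<partial>Mk) \<le> m * nsq lam v"
    using L2_slice_integrable[OF v, of lam] wgt_pos[of lam z] by simp
qed (rule u)

text \<open>The substitute for the primitive bound when there are no zero boundary values, as for p
  + F and for the exact tail.\<close>

lemma Sb_sobolev:
  assumes u: "L2 u" and v: "L2 v"
    and ac: "\<And>k. k \<in> K \<Longrightarrow> ac_on (-\<xi>) d (\<lambda>z. u z k) (\<lambda>z. v z k)"
    and sq: "\<And>k. k \<in> K \<Longrightarrow> sqi Mz (\<lambda>z. v z k)"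
  shows "Sb 0 u (2 / (d + \<xi>) * nsq 0 u + 2 * (d + \<xi>) * nsq 0 v)"
proof (rule Sb_dominated[where G = "\<lambda>z k. 2 / (d + \<xi>) * (\<integral>z. (cmod (u z k))\<^sup>2 * wgt 0 z \<partial>Mz)
     + 2 * (d + \<xi>) * (\<integral>z. (cmod (v z k))\<^sup>2 * wgt 0 z \<partial>Mz)"])
  show "case_prod u \<in> borel_measurable \<nu>" using u by (simp add: sqi_def)
  fix z assume z: "z \<in> A"
  show "integrable Mk (\<lambda>k. 2 / (d + \<xi>) * (\<integral>z. (cmod (u z k))\<^sup>2 * wgt 0 z \<partial>Mz)
     + 2 * (d + \<xi>) * (\<integral>z. (cmod (v z k))\<^sup>2 * wgt 0 z \<partial>Mz))"
    by (intro Bochner_Integration.integrable_add integrable_mult_right L2_slice_integrable(1) u v)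
  show "(cmod (u z k))\<^sup>2 \<le> 2 / (d + \<xi>) * (\<integral>z. (cmod (u z k))\<^sup>2 * wgt 0 z \<partial>Mz)
     + 2 * (d + \<xi>) * (\<integral>z. (cmod (v z k))\<^sup>2 * wgt 0 z \<partial>Mz)" if "k \<in> K" for k
    using ac_on_sup_bound[OF ac[OF that] sq[OF that] _ z] xi_pos d_pos by simp
  show "wgt 0 z * (\<integral>k. 2 / (d + \<xi>) * (\<integral>z. (cmod (u z k))\<^sup>2 * wgt 0 z \<partial>Mz)
     + 2 * (d + \<xi>) * (\<integral>z. (cmod (v z k))\<^sup>2 * wgt 0 z \<partial>Mz) \<partial>Mk)
     \<le> 2 / (d + \<xi>) * nsq 0 u + 2 * (d + \<xi>) * nsq 0 v"
    using L2_slice_integrable[OF u, of 0] L2_slice_integrable[OF v, of 0]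
    by (subst Bochner_Integration.integral_add) (auto intro!: integrable_mult_right)
qed

section \<open>The integral operator in k\<close>

definition Iop :: "(real \<Rightarrow> real \<Rightarrow> complex) \<Rightarrow> real \<Rightarrow> real \<Rightarrow> complex" where
  "Iop u z k = (LINT \<kappa>:{k..ku}|lborel. u z \<kappa>)"

lemma Iop_eq: "k \<in> K \<Longrightarrow> Iop u z k = (\<integral>\<kappa>. indicator {k..} \<kappa> *\<^sub>R u z \<kappa> \<partial>Mk)"
  unfolding Iop_def set_integral_intv by (rule integral_intv_up)

lemma Sb_slice_integrable:
  assumes "Sb lam u s" "z \<in> A" "k \<in> K"
  shows "integrable (intv k ku) (u z)"
  using finite_measure.sqi_integrable(1)[OF finite_measure_intv Sb_sqi[OF assms(1,2)]] assms(3)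
  by (auto intro: integrable_intv_sub)

lemma Iop_add:
  assumes "Sb lam u s" "Sb lam' v t" "z \<in> A" "k \<in> K"
  shows "Iop (\<lambda>z k. u z k + v z k) z k = Iop u z k + Iop v z k"
  unfolding Iop_def set_integral_intv
  using Sb_slice_integrable[OF assms(1,3,4)] Sb_slice_integrable[OF assms(2,3,4)] by simp

lemma Iop_cmult: "Iop (\<lambda>z k. c * u z k) z k = c * Iop u z k"
  unfolding Iop_def set_integral_intv by simp

lemma Iop_cong:
  assumes "\<And>\<kappa>. \<kappa> \<in> K \<Longrightarrow> u z \<kappa> = v z \<kappa>" "k \<in> K"
  shows "Iop u z k = Iop v z k"
  unfolding Iop_def set_integral_intv
  by (rule Bochner_Integration.integral_cong) (use assms in auto)

text \<open>Cauchy-Schwarz on \<open>{k..ku}\<close>: integration in k upgrades a mean-square bound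
  in k to a pointwise one. This smoothing is what makes the products in the operator
  estimable.\<close>

lemma Bd_Iop:
  assumes u: "Sb lam u s"
  shows "Bd lam (Iop u) ((ku - kl) * s)"
  unfolding Bd_def
proof (intro conjI ballI)
  have m [measurable]: "case_prod u \<in> borel_measurable \<nu>" using u by (simp add: Sb_def)
  \<comment> \<open>With an indicator instead of a variable lower limit, joint measurability becomes
    a property of integrals depending on a parameter.\<close>
  have "(\<lambda>x. \<integral>\<kappa>. indicator {snd x..} \<kappa> *\<^sub>R u (fst x) \<kappa> \<partial>Mk) \<in> borel_measurable \<nu>"
  proof (rule k.borel_measurable_lebesgue_integral)
    have 1: "(\<lambda>y. u (fst (fst y)) (snd y)) \<in> borel_measurable (\<nu> \<Otimes>\<^sub>M Mk)"
    proof -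
      have "(\<lambda>y. (fst (fst y), snd y)) \<in> measurable (\<nu> \<Otimes>\<^sub>M Mk) \<nu>" by measurable
      from measurable_compose[OF this m] show ?thesis by simp
    qed
    have a: "(\<lambda>y. snd (fst y)) \<in> borel_measurable (\<nu> \<Otimes>\<^sub>M Mk)"
      by (intro measurable_compose[OF _ id_measurable_intv[of kl ku]]) measurable
    have b: "snd \<in> borel_measurable (\<nu> \<Otimes>\<^sub>M Mk)"
      using measurable_compose[OF measurable_snd id_measurable_intv[of kl ku], of \<nu>] by simp
    have 2: "(\<lambda>y. indicator {y. snd (fst y) \<le> snd y} y :: real) \<in> borel_measurable (\<nu> \<Otimes>\<^sub>M Mk)"
      by (rule borel_measurable_indicator') (use a b in measurable)
    have "(\<lambda>y. indicator {y. snd (fst y) \<le> snd y} y *\<^sub>R u (fst (fst y)) (snd y)) \<in> borel_measurable (\<nu> \<Otimes>\<^sub>M Mk)"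
      using 1 2 by (rule borel_measurable_scaleR[rotated])
    then show "(\<lambda>(x, \<kappa>). indicator {snd x..} \<kappa> *\<^sub>R u (fst x) \<kappa>) \<in> borel_measurable (\<nu> \<Otimes>\<^sub>M Mk)"
      by (simp add: case_prod_unfold indicator_def)
  qed
  then show "case_prod (Iop u) \<in> borel_measurable \<nu>"
    by (subst measurable_cong[where g = "\<lambda>x. \<integral>\<kappa>. indicator {snd x..} \<kappa> *\<^sub>R u (fst x) \<kappa> \<partial>Mk"])
       (auto simp: Iop_eq)
  fix z k assume z: "z \<in> A" and k: "k \<in> K"
  have s: "sqi Mk (u z)" by (rule Sb_sqi[OF u z])
  have "(cmod (Iop u z k))\<^sup>2 \<le> (ku - k) * (\<integral>\<kappa>. (cmod (u z \<kappa>))\<^sup>2 \<partial>intv k ku)"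
    unfolding Iop_def set_integral_intv
    using finite_measure.sqi_integrable(2)[OF finite_measure_intv sqi_intv_sub[OF s], of k ku] k
    by (simp add: measure_intv)
  also have "\<dots> \<le> (ku - kl) * (\<integral>\<kappa>. (cmod (u z \<kappa>))\<^sup>2 \<partial>Mk)"
    using s k by (intro mult_mono integral_intv_sub_mono) (auto simp: sqi_def intro!: integral_nonneg_AE)
  finally have "wgt lam z * (cmod (Iop u z k))\<^sup>2 \<le> wgt lam z * ((ku - kl) * (\<integral>\<kappa>. (cmod (u z \<kappa>))\<^sup>2 \<partial>Mk))"
    by (intro mult_left_mono) auto
  also have "\<dots> = (ku - kl) * (wgt lam z * (\<integral>\<kappa>. (cmod (u z \<kappa>))\<^sup>2 \<partial>Mk))" by simp
  also have "\<dots> \<le> (ku - kl) * s"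
    using u z ku_ge by (intro mult_left_mono) (auto simp: Sb_def)
  finally show "wgt lam z * (cmod (Iop u z k))\<^sup>2 \<le> (ku - kl) * s" .
qed

section \<open>The semidiscrete Sobolev spaces\<close>

abbreviation "HK \<equiv> Hk N \<xi> d kl ku 2"
abbreviation "H0 \<equiv> Hk02 N \<xi> d kl ku"
abbreviation "deriv2 \<equiv> Hk_derivs N \<xi> d kl ku 2"
abbreviation "dd \<equiv> dzk N \<xi> d kl ku 2"
abbreviation "ip \<equiv> ipHk N h \<xi> d kl ku 2"
abbreviation "nrm \<equiv> normHk N h \<xi> d kl ku 2"

lemma Hk_derivs_iff:
  "Hk_derivs N \<xi> d kl ku n f D \<longleftrightarrow> (\<forall>j\<le>N. \<forall>s\<le>N.
     (\<forall>k\<in>K. \<forall>z\<in>A. D 0 j s z k = f j s z k) \<and>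
     (\<forall>k\<in>K. (\<forall>i<n. ac_on (-\<xi>) d (\<lambda>z. D i j s z k) (\<lambda>z. D (Suc i) j s z k)) \<and> sqi Mz (\<lambda>z. D n j s z k)) \<and>
     (\<forall>i\<le>n. L2 (D i j s)))"
  unfolding Hk_derivs_def zchain_ac_on box_set_measurable box_set_integrable sqi_def
  by (simp add: case_prod_unfold)

lemma all_less_2: "(\<forall>i<2::nat. P i) \<longleftrightarrow> P 0 \<and> P 1"
  by (auto simp: less_2_cases_iff)

lemma all_le_2: "(\<forall>i\<le>2::nat. P i) \<longleftrightarrow> P 0 \<and> P 1 \<and> P 2"
  by (auto simp: numeral_2_eq_2 le_Suc_eq)

lemma deriv2_iff:
  "deriv2 f D \<longleftrightarrow> (\<forall>j\<le>N. \<forall>s\<le>N.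
     (\<forall>k\<in>K. \<forall>z\<in>A. D 0 j s z k = f j s z k) \<and>
     (\<forall>k\<in>K. ac_on (-\<xi>) d (\<lambda>z. D 0 j s z k) (\<lambda>z. D 1 j s z k) \<and>
        ac_on (-\<xi>) d (\<lambda>z. D 1 j s z k) (\<lambda>z. D 2 j s z k) \<and> sqi Mz (\<lambda>z. D 2 j s z k)) \<and>
     L2 (D 0 j s) \<and> L2 (D 1 j s) \<and> L2 (D 2 j s))"
  unfolding Hk_derivs_iff all_less_2 all_le_2 by (simp add: numeral_2_eq_2)

lemma deriv2D:
  assumes "deriv2 f D" "j \<le> N" "s \<le> N"
  shows "z \<in> A \<Longrightarrow> k \<in> K \<Longrightarrow> D 0 j s z k = f j s z k"
    "k \<in> K \<Longrightarrow> ac_on (-\<xi>) d (\<lambda>z. D 0 j s z k) (\<lambda>z. D 1 j s z k)"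
    "k \<in> K \<Longrightarrow> ac_on (-\<xi>) d (\<lambda>z. D 1 j s z k) (\<lambda>z. D 2 j s z k)"
    "k \<in> K \<Longrightarrow> sqi Mz (\<lambda>z. D 2 j s z k)"
    "L2 (D 0 j s)" "L2 (D 1 j s)" "L2 (D 2 j s)"
  using assms unfolding deriv2_iff by blast+

lemma deriv2_L2: "deriv2 f D \<Longrightarrow> j \<le> N \<Longrightarrow> s \<le> N \<Longrightarrow> i \<le> 2 \<Longrightarrow> L2 (D i j s)"
  unfolding Hk_derivs_iff by blast

lemma deriv2_dd: "f \<in> HK \<Longrightarrow> deriv2 f (dd f)"
proof -
  assume "f \<in> HK"
  then have "\<exists>D. deriv2 f D" by (simp add: Hk_def)
  then show ?thesis unfolding dzk_def by (rule someI_ex)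
qed

lemma Re_mult_cnj: "Re (w * cnj w) = (cmod w)\<^sup>2"
  by (simp only: cmod_power2) (simp add: power2_eq_square)

lemma deriv2_HK: "deriv2 f D \<Longrightarrow> f \<in> HK"
  unfolding Hk_def by blast

section \<open>Uniqueness of the derivatives\<close>

lemma ac_on_unique:
  assumes f: "ac_on a c f0 f1" "ac_on a c f1 f2" and g: "ac_on a c g0 g1" "ac_on a c g1 g2"
    and eq: "\<And>x. x \<in> {a..c} \<Longrightarrow> f0 x = g0 x" and "a < c"
  shows "x \<in> {a..c} \<Longrightarrow> f1 x = g1 x" "AE x in intv a c. f2 x = g2 x"
proof -
  have 0: "ac_on a c (\<lambda>x. f0 x - g0 x) (\<lambda>x. f1 x - g1 x)" by (rule ac_on_diff[OF f(1) g(1)])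
  have 1: "ac_on a c (\<lambda>x. f1 x - g1 x) (\<lambda>x. f2 x - g2 x)" by (rule ac_on_diff[OF f(2) g(2)])
  have z: "f1 x - g1 x = 0" if "x \<in> {a..c}" for x
    by (rule ac_on_zero_deriv[OF 0 _ ac_on_continuous[OF 1] \<open>a < c\<close> that]) (simp add: eq)
  then show "x \<in> {a..c} \<Longrightarrow> f1 x = g1 x" by force
  have "AE x in intv a c. f2 x - g2 x = 0"
    by (rule ac_on_zero_AE[OF 1 z])
  then show "AE x in intv a c. f2 x = g2 x" by simp
qed

text \<open>This is what makes the choice of derivatives by \<open>SOME\<close> harmless: any two
  families agree pointwise up to order one and almost everywhere in order two.\<close>

lemma deriv2_unique:
  assumes D: "deriv2 f D" and E: "deriv2 g E" and js: "j \<le> N" "s \<le> N"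
    and eq: "\<And>z k. z \<in> A \<Longrightarrow> k \<in> K \<Longrightarrow> f j s z k = g j s z k"
  shows "z \<in> A \<Longrightarrow> k \<in> K \<Longrightarrow> D 0 j s z k = E 0 j s z k"
    "z \<in> A \<Longrightarrow> k \<in> K \<Longrightarrow> D 1 j s z k = E 1 j s z k"
    "AE x in \<nu>. D 2 j s (fst x) (snd x) = E 2 j s (fst x) (snd x)"
proof -
  note d = deriv2D[OF D js] and e = deriv2D[OF E js]
  show 0: "D 0 j s z k = E 0 j s z k" if "z \<in> A" "k \<in> K" for z k
    using d(1) e(1) eq that by simp
  have lt: "-\<xi> < d" using xi_pos d_pos by simp
  show "z \<in> A \<Longrightarrow> k \<in> K \<Longrightarrow> D 1 j s z k = E 1 j s z k"
    by (rule ac_on_unique(1)[OF d(2,3) e(2,3) 0 lt])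
  have AEz: "AE z in Mz. D 2 j s z k = E 2 j s z k" if "k \<in> K" for k
    by (rule ac_on_unique(2)[OF d(2,3) e(2,3) 0 lt]) (use that in auto)
  have L: "L2 (\<lambda>z k. D 2 j s z k - E 2 j s z k)"
    using sqi_diff[OF d(7) e(7)] by (simp add: case_prod_unfold)
  \<comment> \<open>Fubini is applied to the square of the difference rather than to the exceptional
    set: the inner integral is zero for every k.\<close>
  have "nsq 0 (\<lambda>z k. D 2 j s z k - E 2 j s z k) = (\<integral>k. (\<integral>z. (cmod (D 2 j s z k - E 2 j s z k))\<^sup>2 \<partial>Mz) \<partial>Mk)"
    using L2_slice_integrable(2)[OF L, of 0] by simp
  also have "\<dots> = (\<integral>k. 0 \<partial>Mk)"
  proof (rule Bochner_Integration.integral_cong[OF refl])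
    fix k assume "k \<in> space Mk"
    then have "AE z in Mz. (cmod (D 2 j s z k - E 2 j s z k))\<^sup>2 = 0"
      using AEz[of k] by (auto elim: eventually_mono)
    then show "(\<integral>z. (cmod (D 2 j s z k - E 2 j s z k))\<^sup>2 \<partial>Mz) = 0"
      by (rule integral_eq_zero_AE)
  qed
  finally have "(\<integral>x. (cmod (case x of (z,k) \<Rightarrow> D 2 j s z k - E 2 j s z k))\<^sup>2 \<partial>\<nu>) = 0"
    by (simp add: nsq_0 case_prod_unfold)
  then have "AE x in \<nu>. (cmod (case x of (z,k) \<Rightarrow> D 2 j s z k - E 2 j s z k))\<^sup>2 = 0"
    by (subst (asm) integral_nonneg_eq_0_iff_AE) (use sqi_integrable_sq[OF L] in auto)
  then show "AE x in \<nu>. D 2 j s (fst x) (snd x) = E 2 j s (fst x) (snd x)"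
    by (simp add: case_prod_unfold)
qed

section \<open>Linear structure and scalar product\<close>

definition kscale :: "real \<Rightarrow> kfun \<Rightarrow> kfun" where
  "kscale c f = (\<lambda>j s z k. complex_of_real c * f j s z k)"

lemma deriv2_add:
  assumes D: "deriv2 f D" and E: "deriv2 g E"
  shows "deriv2 (kadd f g) (\<lambda>i j s z k. D i j s z k + E i j s z k)"
  unfolding deriv2_iff
proof (intro allI impI conjI ballI)
  fix j s assume js: "j \<le> N" "s \<le> N"
  note d = deriv2D[OF D js] and e = deriv2D[OF E js]
  show "D 0 j s z k + E 0 j s z k = kadd f g j s z k" if "k \<in> K" "z \<in> A" for z k
    using d(1) e(1) that by (simp add: kadd_def)
  show "ac_on (-\<xi>) d (\<lambda>z. D 0 j s z k + E 0 j s z k) (\<lambda>z. D 1 j s z k + E 1 j s z k)"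
    "ac_on (-\<xi>) d (\<lambda>z. D 1 j s z k + E 1 j s z k) (\<lambda>z. D 2 j s z k + E 2 j s z k)"
    "sqi Mz (\<lambda>z. D 2 j s z k + E 2 j s z k)" if "k \<in> K" for k
    using ac_on_add[OF d(2) e(2)] ac_on_add[OF d(3) e(3)] sqi_add[OF d(4) e(4)] that by auto
  show "L2 (\<lambda>z k. D 0 j s z k + E 0 j s z k)" "L2 (\<lambda>z k. D 1 j s z k + E 1 j s z k)"
    "L2 (\<lambda>z k. D 2 j s z k + E 2 j s z k)"
    using sqi_add[OF d(5) e(5)] sqi_add[OF d(6) e(6)] sqi_add[OF d(7) e(7)] by (simp_all add: case_prod_unfold)
qed

lemma deriv2_scale:
  assumes D: "deriv2 f D"
  shows "deriv2 (kscale c f) (\<lambda>i j s z k. complex_of_real c * D i j s z k)"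
  unfolding deriv2_iff
proof (intro allI impI conjI ballI)
  fix j s assume js: "j \<le> N" "s \<le> N"
  note d = deriv2D[OF D js]
  show "complex_of_real c * D 0 j s z k = kscale c f j s z k" if "k \<in> K" "z \<in> A" for z k
    using d(1) that by (simp add: kscale_def)
  show "ac_on (-\<xi>) d (\<lambda>z. complex_of_real c * D 0 j s z k) (\<lambda>z. complex_of_real c * D 1 j s z k)"
    "ac_on (-\<xi>) d (\<lambda>z. complex_of_real c * D 1 j s z k) (\<lambda>z. complex_of_real c * D 2 j s z k)"
    "sqi Mz (\<lambda>z. complex_of_real c * D 2 j s z k)" if "k \<in> K" for k
    using ac_on_cmult[OF d(2)] ac_on_cmult[OF d(3)] sqi_cmult[OF d(4)] that by auto
  show "L2 (\<lambda>z k. complex_of_real c * D 0 j s z k)" "L2 (\<lambda>z k. complex_of_real c * D 1 j s z k)"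
    "L2 (\<lambda>z k. complex_of_real c * D 2 j s z k)"
    using sqi_cmult[OF d(5)] sqi_cmult[OF d(6)] sqi_cmult[OF d(7)] by (simp_all add: case_prod_unfold)
qed

definition rip :: "(real \<Rightarrow> real \<Rightarrow> complex) \<Rightarrow> (real \<Rightarrow> real \<Rightarrow> complex) \<Rightarrow> real" where
  "rip u v = (\<integral>(z,k). Re (u z k * cnj (v z k)) \<partial>\<nu>)"

lemma rip_integrable: "L2 u \<Longrightarrow> L2 v \<Longrightarrow> integrable \<nu> (\<lambda>(z,k). Re (u z k * cnj (v z k)))"
  using sqi_Re_cnj_integrable[of \<nu> "case_prod u" "case_prod v"] by (simp add: case_prod_unfold)

lemma rip_cong_AE:
  assumes "L2 u" "L2 v" "L2 u'" "L2 v'"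
    and "AE x in \<nu>. u (fst x) (snd x) = u' (fst x) (snd x)" "AE x in \<nu>. v (fst x) (snd x) = v' (fst x) (snd x)"
  shows "rip u v = rip u' v'"
  unfolding rip_def
proof (rule integral_cong_AE)
  show "AE x in \<nu>. (case x of (z, k) \<Rightarrow> Re (u z k * cnj (v z k))) = (case x of (z, k) \<Rightarrow> Re (u' z k * cnj (v' z k)))"
    using assms(5,6) by eventually_elim (simp add: case_prod_unfold)
qed (use rip_integrable[OF assms(1,2)] rip_integrable[OF assms(3,4)] in auto)

lemma rip_self: "rip u u = nsq 0 u"
  unfolding rip_def nsq_0
  by (simp only: Re_mult_cnj)

lemma deriv2_AE_unique:
  assumes D: "deriv2 f D" and E: "deriv2 f E" and js: "j \<le> N" "s \<le> N" and r: "r \<le> 2"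
  shows "AE x in \<nu>. D r j s (fst x) (snd x) = E r j s (fst x) (snd x)"
proof -
  note u = deriv2_unique[OF D E js refl]
  have "r = 0 \<or> r = 1 \<or> r = 2" using r by auto
  then show ?thesis
  proof (elim disjE)
    assume "r = 0" then show ?thesis using u(1) by (intro AE_I2) auto
  next
    assume "r = 1" then show ?thesis using u(2) by (intro AE_I2) auto
  qed (use u(3) in simp)
qed

text \<open>Any derivative families compute the scalar product, so sums and multiples can be handled
  with the evident families instead of the chosen ones.\<close>

lemma ip_eq:
  assumes D: "deriv2 f D" and E: "deriv2 g E"
  shows "ip f g = (\<Sum>j\<le>N. \<Sum>s\<le>N. \<Sum>r\<le>2. h\<^sup>2 * rip (D r j s) (E r j s))"
  unfolding ipHk_def
proof (intro sum.cong refl)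
  fix j s r :: nat assume "j \<in> {..N}" "s \<in> {..N}" "r \<in> {..2}"
  then have js: "j \<le> N" "s \<le> N" and r: "r \<le> 2" by auto
  note Df = deriv2_dd[OF deriv2_HK[OF D]] and Eg = deriv2_dd[OF deriv2_HK[OF E]]
  note L = deriv2_L2[OF _ js r]
  have "(LINT k:{kl..ku}|lborel. LINT z:{-\<xi>..d}|lborel. Re (dd f r j s z k * cnj (dd g r j s z k))) = rip (dd f r j s) (dd g r j s)"
    unfolding rip_def by (rule box_iterated_integral[OF rip_integrable[OF L[OF Df] L[OF Eg]]])
  also have "\<dots> = rip (D r j s) (E r j s)"
    by (intro rip_cong_AE L[OF Df] L[OF Eg] L[OF D] L[OF E] deriv2_AE_unique[OF Df D js r] deriv2_AE_unique[OF Eg E js r])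
  finally show "h\<^sup>2 * (LINT k:{kl..ku}|lborel. LINT z:{-\<xi>..d}|lborel. Re (dd f r j s z k * cnj (dd g r j s z k))) = h\<^sup>2 * rip (D r j s) (E r j s)"
    by simp
qed

lemma ip_self: "deriv2 f D \<Longrightarrow> ip f f = (\<Sum>j\<le>N. \<Sum>s\<le>N. \<Sum>r\<le>2. h\<^sup>2 * nsq 0 (D r j s))"
  by (simp add: ip_eq rip_self)

lemma nrm_eq: "nrm f = sqrt (ip f f)"
  unfolding normHk_def ipHk_def by (simp only: Re_mult_cnj)

lemma ip_nonneg: "f \<in> HK \<Longrightarrow> 0 \<le> ip f f"
  unfolding ip_self[OF deriv2_dd] by (intro sum_nonneg mult_nonneg_nonneg nsq_nonneg) auto

lemma nrm_sq: "f \<in> HK \<Longrightarrow> (nrm f)\<^sup>2 = ip f f"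
  using ip_nonneg by (simp add: nrm_eq)

lemma triple_sum_member_le:
  fixes g :: "nat \<Rightarrow> nat \<Rightarrow> nat \<Rightarrow> real"
  assumes nn: "\<And>j s r. 0 \<le> g j s r" and "j \<le> N" "s \<le> N" "r \<le> n"
  shows "g j s r \<le> (\<Sum>j\<le>N. \<Sum>s\<le>N. \<Sum>r\<le>n. g j s r)"
proof -
  have "g j s r \<le> (\<Sum>r\<le>n. g j s r)" using assms by (intro member_le_sum) auto
  also have "\<dots> \<le> (\<Sum>s\<le>N. \<Sum>r\<le>n. g j s r)"
    using assms by (intro member_le_sum[where f = "\<lambda>s. \<Sum>r\<le>n. g j s r"]) (auto intro!: sum_nonneg)
  also have "\<dots> \<le> (\<Sum>j\<le>N. \<Sum>s\<le>N. \<Sum>r\<le>n. g j s r)"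
    using assms by (intro member_le_sum[where f = "\<lambda>j. \<Sum>s\<le>N. \<Sum>r\<le>n. g j s r"]) (auto intro!: sum_nonneg)
  finally show ?thesis .
qed

lemma nsq_le_nrm:
  assumes D: "deriv2 f D" and "j \<le> N" "s \<le> N" "r \<le> 2"
  shows "h\<^sup>2 * nsq 0 (D r j s) \<le> (nrm f)\<^sup>2"
  unfolding nrm_sq[OF deriv2_HK[OF D]] ip_self[OF D]
  by (rule triple_sum_member_le[where g = "\<lambda>j s r. h\<^sup>2 * nsq 0 (D r j s)"]) (use assms nsq_nonneg in auto)

lemma rip_add_left:
  "L2 u \<Longrightarrow> L2 v \<Longrightarrow> L2 w \<Longrightarrow> rip (\<lambda>z k. u z k + v z k) w = rip u w + rip v w"
proof -
  assume L: "L2 u" "L2 v" "L2 w"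
  have "rip (\<lambda>z k. u z k + v z k) w = (\<integral>x. (case x of (z,k) \<Rightarrow> Re (u z k * cnj (w z k))) + (case x of (z,k) \<Rightarrow> Re (v z k * cnj (w z k))) \<partial>\<nu>)"
    unfolding rip_def by (intro Bochner_Integration.integral_cong) (auto simp: algebra_simps)
  then show ?thesis using rip_integrable[OF L(1,3)] rip_integrable[OF L(2,3)] by (simp add: rip_def)
qed

lemma rip_scale_left: "rip (\<lambda>z k. complex_of_real c * u z k) w = c * rip u w"
proof -
  have "rip (\<lambda>z k. complex_of_real c * u z k) w = (\<integral>x. c * (case x of (z,k) \<Rightarrow> Re (u z k * cnj (w z k))) \<partial>\<nu>)"
    unfolding rip_def by (intro Bochner_Integration.integral_cong) (auto simp: algebra_simps)
  then show ?thesis by (simp add: rip_def)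
qed

lemma ip_add_left:
  assumes "f \<in> HK" "g \<in> HK" "r \<in> HK"
  shows "ip (kadd f g) r = ip f r + ip g r"
proof -
  note f = deriv2_dd[OF assms(1)] and g = deriv2_dd[OF assms(2)] and r = deriv2_dd[OF assms(3)]
  have "ip (kadd f g) r = (\<Sum>j\<le>N. \<Sum>s\<le>N. \<Sum>i\<le>2. h\<^sup>2 * rip (dd f i j s) (dd r i j s) + h\<^sup>2 * rip (dd g i j s) (dd r i j s))"
    unfolding ip_eq[OF deriv2_add[OF f g] r]
    by (intro sum.cong refl) (simp add: rip_add_left deriv2_L2[OF f] deriv2_L2[OF g] deriv2_L2[OF r] distrib_left)
  then show ?thesis by (simp add: ip_eq[OF f r] ip_eq[OF g r] sum.distrib)
qed

lemma ip_scale_left: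
  assumes "f \<in> HK" "r \<in> HK"
  shows "ip (kscale c f) r = c * ip f r"
proof -
  note f = deriv2_dd[OF assms(1)] and r = deriv2_dd[OF assms(2)]
  show ?thesis
    unfolding ip_eq[OF deriv2_scale[OF f] r] ip_eq[OF f r]
    by (simp add: rip_scale_left sum_distrib_left mult.left_commute)
qed

lemma ip_sym: "ip f g = ip g f"
  unfolding ipHk_def by (simp add: mult.commute)

lemma kadd_HK: "f \<in> HK \<Longrightarrow> g \<in> HK \<Longrightarrow> kadd f g \<in> HK"
  and kscale_HK: "f \<in> HK \<Longrightarrow> kscale c f \<in> HK"
  using deriv2_add deriv2_scale deriv2_dd deriv2_HK by blast+

section \<open>The subspace with zero boundary conditions\<close>

lemma H0_HK: "f \<in> H0 \<Longrightarrow> f \<in> HK"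
  by (simp add: Hk02_def)

definition lateral :: "nat \<Rightarrow> nat \<Rightarrow> bool" where
  "lateral j s \<longleftrightarrow> j = 0 \<or> j = N \<or> s = 0 \<or> s = N"

text \<open>Membership can be tested with any derivative family because the first derivative is
  unique at every point, in particular at z = -xi.\<close>

lemma H0_iff:
  assumes D: "deriv2 f D"
  shows "f \<in> H0 \<longleftrightarrow> (\<forall>j\<le>N. \<forall>s\<le>N. \<forall>k\<in>K. (lateral j s \<longrightarrow> (\<forall>z\<in>A. f j s z k = 0)) \<and>
     f j s (-\<xi>) k = 0 \<and> f j s d k = 0 \<and> D 1 j s (-\<xi>) k = 0)"
proof -
  have "dd f 1 j s (-\<xi>) k = D 1 j s (-\<xi>) k" if "j \<le> N" "s \<le> N" "k \<in> K" for j s k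
    using deriv2_unique(2)[OF deriv2_dd[OF deriv2_HK[OF D]] D that(1,2), of "-\<xi>" k] that xi_pos d_pos by simp
  note dD = this
  show ?thesis
  proof
    assume f: "f \<in> H0"
    show "\<forall>j\<le>N. \<forall>s\<le>N. \<forall>k\<in>K. (lateral j s \<longrightarrow> (\<forall>z\<in>A. f j s z k = 0)) \<and>
      f j s (-\<xi>) k = 0 \<and> f j s d k = 0 \<and> D 1 j s (-\<xi>) k = 0"
    proof (intro allI impI ballI)
      fix j s k assume js: "j \<le> N" "s \<le> N" and k: "k \<in> K"
      have "lateral j s \<longrightarrow> (\<forall>z\<in>A. f j s z k = 0)"
        using f js k unfolding Hk02_def lateral_def by blast
      moreover have "f j s (-\<xi>) k = 0 \<and> f j s d k = 0 \<and> dd f 1 j s (-\<xi>) k = 0"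
        using f js k unfolding Hk02_def by blast
      ultimately show "(lateral j s \<longrightarrow> (\<forall>z\<in>A. f j s z k = 0)) \<and>
        f j s (-\<xi>) k = 0 \<and> f j s d k = 0 \<and> D 1 j s (-\<xi>) k = 0"
        using dD[OF js k] by metis
    qed
  next
    assume r: "\<forall>j\<le>N. \<forall>s\<le>N. \<forall>k\<in>K. (lateral j s \<longrightarrow> (\<forall>z\<in>A. f j s z k = 0)) \<and>
      f j s (-\<xi>) k = 0 \<and> f j s d k = 0 \<and> D 1 j s (-\<xi>) k = 0"
    show "f \<in> H0"
      unfolding Hk02_def mem_Collect_eq
    proof (intro conjI ballI allI impI)
      fix j s k assume js: "j \<le> N" "s \<le> N" and k: "k \<in> K"
      show "f j s (-\<xi>) k = 0" "f j s d k = 0" using r js k by blast+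
      show "dd f 1 j s (-\<xi>) k = 0" using r js k dD[OF js k] by metis
      fix z assume "j = 0 \<or> j = N \<or> s = 0 \<or> s = N" "z \<in> A"
      then show "f j s z k = 0" using r js k unfolding lateral_def by blast
    qed (rule deriv2_HK[OF D])
  qed
qed

lemma kadd_H0:
  assumes "f \<in> H0" "g \<in> H0"
  shows "kadd f g \<in> H0"
proof -
  note f = deriv2_dd[OF H0_HK[OF assms(1)]] and g = deriv2_dd[OF H0_HK[OF assms(2)]]
  show ?thesis
    using assms unfolding H0_iff[OF f] H0_iff[OF g] H0_iff[OF deriv2_add[OF f g]] by (simp add: kadd_def)
qed

lemma kscale_H0:
  assumes "f \<in> H0"
  shows "kscale c f \<in> H0"
proof -
  note f = deriv2_dd[OF H0_HK[OF assms(1)]]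
  show ?thesis
    using assms unfolding H0_iff[OF f] H0_iff[OF deriv2_scale[OF f]] by (simp add: kscale_def)
qed

text \<open>Both the function and its z derivative vanish at z = -xi, so the primitive bound applies
  twice. Between the two applications the bound for the derivative is turned into a weighted norm,
  which costs \<open>d + \<xi>\<close> but gains a second factor m.\<close>

lemma H0_jets:
  assumes f: "f \<in> H0" and D: "deriv2 f D" and js: "j \<le> N" "s \<le> N"
    and m: "lam > 0 \<and> m = 1 / (2 * lam) \<or> lam = 0 \<and> m = d + \<xi>"
  shows "Sb lam (D 1 j s) (m * nsq lam (D 2 j s))"
    "Sb lam (D 0 j s) (m * ((d + \<xi>) * (m * nsq lam (D 2 j s))))"
proof -
  note e = deriv2D[OF D js]
  have bc: "D 1 j s (-\<xi>) k = 0" "D 0 j s (-\<xi>) k = 0" if "k \<in> K" for k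
    using f js that e(1)[of "-\<xi>" k] xi_pos d_pos unfolding H0_iff[OF D] by auto
  show 1: "Sb lam (D 1 j s) (m * nsq lam (D 2 j s))"
    by (rule Sb_primitive[OF sqi_measurable[OF e(6)] e(7) e(3) e(4) bc(1) m])
  have "sqi Mz (\<lambda>z. D 1 j s z k)" if "k \<in> K" for k by (rule ac_on_sqi[OF e(3)[OF that]])
  then have "Sb lam (D 0 j s) (m * nsq lam (D 1 j s))"
    by (intro Sb_primitive[OF sqi_measurable[OF e(5)] e(6) e(2) _ bc(2) m]) auto
  moreover have "m * nsq lam (D 1 j s) \<le> m * ((d + \<xi>) * (m * nsq lam (D 2 j s)))"
    using Sb_L2(2)[OF 1] m len_pos by (intro mult_left_mono) auto
  ultimately show "Sb lam (D 0 j s) (m * ((d + \<xi>) * (m * nsq lam (D 2 j s))))" by (rule Sb_mono)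
qed

lemma deriv2_zero: "deriv2 (\<lambda>j s z k. 0) (\<lambda>i j s z k. 0)"
  unfolding deriv2_iff by (auto simp: ac_on_def sqi_zero case_prod_unfold)

text \<open>The norm runs over all nodes but the functional only over interior ones; this closes the
  gap. On a lateral node the chosen second derivative is one of the zero function.\<close>

lemma H0_lateral:
  assumes f: "f \<in> H0" and D: "deriv2 f D" and js: "j \<le> N" "s \<le> N" and l: "lateral j s"
  shows "nsq lam (D 2 j s) = 0"
proof -
  have eq: "f j s z k = 0" if "z \<in> A" "k \<in> K" for z k
    using f js l that unfolding H0_iff[OF D] by blast
  have "AE x in \<nu>. D 2 j s (fst x) (snd x) = 0"
    using deriv2_unique(3)[OF D deriv2_zero js eq] .
  then have "AE x in \<nu>. (case x of (z,k) \<Rightarrow> (cmod (D 2 j s z k))\<^sup>2 * wgt lam z) = 0"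
    by eventually_elim (simp add: case_prod_unfold)
  then show ?thesis unfolding nsq_def by (rule integral_eq_zero_AE)
qed

text \<open>The unweighted case of the jet bounds: each integration from z = -xi costs
  \<open>(d + \<xi>)\<^sup>2\<close> in the squared norm, so the second derivatives alone control
  everything.\<close>

lemma H0_norm_le:
  assumes f: "f \<in> H0" and D: "deriv2 f D"
  shows "(nrm f)\<^sup>2 \<le> (1 + (d + \<xi>)\<^sup>2 + (d + \<xi>)^4) * (\<Sum>j\<le>N. \<Sum>s\<le>N. h\<^sup>2 * nsq 0 (D 2 j s))"
proof -
  have "(nrm f)\<^sup>2 = (\<Sum>j\<le>N. \<Sum>s\<le>N. \<Sum>r\<le>2. h\<^sup>2 * nsq 0 (D r j s))"
    by (simp add: nrm_sq[OF deriv2_HK[OF D]] ip_self[OF D])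
  also have "\<dots> \<le> (\<Sum>j\<le>N. \<Sum>s\<le>N. (1 + (d + \<xi>)\<^sup>2 + (d + \<xi>)^4) * (h\<^sup>2 * nsq 0 (D 2 j s)))"
  proof (intro sum_mono)
    fix j s assume "j \<in> {..N}" "s \<in> {..N}"
    then have js: "j \<le> N" "s \<le> N" by auto
    note S = H0_jets[OF f D js disjI2, of 0 "d + \<xi>", simplified]
    have a: "nsq 0 (D 1 j s) \<le> (d + \<xi>)\<^sup>2 * nsq 0 (D 2 j s)"
      using Sb_L2(2)[OF S(1)] by (simp add: power2_eq_square mult.assoc)
    have b: "nsq 0 (D 0 j s) \<le> (d + \<xi>)^4 * nsq 0 (D 2 j s)"
      using Sb_L2(2)[OF S(2)] by (simp add: power4_eq_xxxx mult.assoc)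
    have "(\<Sum>r\<le>2. h\<^sup>2 * nsq 0 (D r j s)) = h\<^sup>2 * (nsq 0 (D 0 j s) + nsq 0 (D 1 j s) + nsq 0 (D 2 j s))"
      by (simp add: numeral_2_eq_2 algebra_simps)
    also have "\<dots> \<le> h\<^sup>2 * ((1 + (d + \<xi>)\<^sup>2 + (d + \<xi>)^4) * nsq 0 (D 2 j s))"
      using a b by (intro mult_left_mono) (auto simp: algebra_simps)
    finally show "(\<Sum>r\<le>2. h\<^sup>2 * nsq 0 (D r j s)) \<le> (1 + (d + \<xi>)\<^sup>2 + (d + \<xi>)^4) * (h\<^sup>2 * nsq 0 (D 2 j s))"
      by (simp add: mult.left_commute)
  qed
  finally show ?thesis by (simp add: sum_distrib_left)
qed

text \<open>The top member of the shortened chain is absolutely continuous on a bounded interval,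
  hence square integrable there.\<close>

lemma deriv3_imp_deriv2:
  assumes D: "Hk_derivs N \<xi> d kl ku 3 f D"
  shows "deriv2 f D"
proof -
  have *: "(\<forall>i<3::nat. P i) \<longleftrightarrow> P 0 \<and> P 1 \<and> P 2" for P
    by (auto simp: numeral_3_eq_3 numeral_2_eq_2 less_Suc_eq)
  show ?thesis
    unfolding deriv2_iff using D unfolding Hk_derivs_iff *
    by (auto simp: numeral_2_eq_2 intro: ac_on_sqi)
qed

lemma Hk3_norm_le:
  assumes "f \<in> Hk N \<xi> d kl ku 3"
  shows "f \<in> HK" "nrm f \<le> normHk N h \<xi> d kl ku 3 f"
proof -
  let ?D = "dzk N \<xi> d kl ku 3 f"
  have D3: "Hk_derivs N \<xi> d kl ku 3 f ?D"
  proof -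
    have "\<exists>D. Hk_derivs N \<xi> d kl ku 3 f D" using assms by (simp add: Hk_def)
    then show ?thesis unfolding dzk_def by (rule someI_ex)
  qed
  note D = deriv3_imp_deriv2[OF D3]
  show "f \<in> HK" by (rule deriv2_HK[OF D])
  have L: "(LINT k:{kl..ku}|lborel. LINT z:{-\<xi>..d}|lborel. (cmod (?D r j s z k))\<^sup>2) = nsq 0 (?D r j s)"
    if "j \<le> N" "s \<le> N" "r \<le> 3" for j s r
    unfolding nsq_0 using D3 that sqi_integrable_sq[of \<nu> "case_prod (?D r j s)"]
    by (intro box_iterated_integral) (auto simp: Hk_derivs_iff case_prod_unfold)
  have "ip f f \<le> (\<Sum>j\<le>N. \<Sum>s\<le>N. \<Sum>r\<le>3. h\<^sup>2 * nsq 0 (?D r j s))"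
    unfolding ip_self[OF D] by (intro sum_mono sum_mono2) (auto intro!: mult_nonneg_nonneg nsq_nonneg)
  also have "\<dots> = (\<Sum>j\<le>N. \<Sum>s\<le>N. \<Sum>r\<le>3. h\<^sup>2 * (LINT k:{kl..ku}|lborel. LINT z:{-\<xi>..d}|lborel. (cmod (?D r j s z k))\<^sup>2))"
    by (intro sum.cong refl) (simp add: L)
  finally show "nrm f \<le> normHk N h \<xi> d kl ku 3 f"
    unfolding nrm_eq normHk_def[of _ _ _ _ _ _ 3] by (rule real_sqrt_le_mono)
qed

lemma nrm_add_sq_le: "f \<in> HK \<Longrightarrow> g \<in> HK \<Longrightarrow> (nrm (kadd f g))\<^sup>2 \<le> 2 * (nrm f)\<^sup>2 + 2 * (nrm g)\<^sup>2"
proof -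
  assume fg: "f \<in> HK" "g \<in> HK"
  note f = deriv2_dd[OF fg(1)] and g = deriv2_dd[OF fg(2)]
  have "ip (kadd f g) (kadd f g) \<le> (\<Sum>j\<le>N. \<Sum>s\<le>N. \<Sum>r\<le>2. 2 * (h\<^sup>2 * nsq 0 (dd f r j s)) + 2 * (h\<^sup>2 * nsq 0 (dd g r j s)))"
    unfolding ip_self[OF deriv2_add[OF f g]]
  proof (intro sum_mono)
    fix j s r :: nat assume "j \<in> {..N}" "s \<in> {..N}" "r \<in> {..2}"
    then have "nsq 0 (\<lambda>z k. dd f r j s z k + dd g r j s z k) \<le> 2 * nsq 0 (dd f r j s) + 2 * nsq 0 (dd g r j s)"
      by (intro nsq_add deriv2_L2[OF f] deriv2_L2[OF g]) auto
    then have "h\<^sup>2 * nsq 0 (\<lambda>z k. dd f r j s z k + dd g r j s z k) \<le> h\<^sup>2 * (2 * nsq 0 (dd f r j s) + 2 * nsq 0 (dd g r j s))"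
      by (rule mult_left_mono) simp
    then show "h\<^sup>2 * nsq 0 (\<lambda>z k. dd f r j s z k + dd g r j s z k) \<le> 2 * (h\<^sup>2 * nsq 0 (dd f r j s)) + 2 * (h\<^sup>2 * nsq 0 (dd g r j s))"
      by (simp add: algebra_simps)
  qed
  then show ?thesis
    using fg kadd_HK by (simp add: nrm_sq ip_self[OF f] ip_self[OF g] sum.distrib sum_distrib_left)
qed

section \<open>Recovering a function from its second derivative; completeness\<close>

definition Prim :: "(real \<Rightarrow> real \<Rightarrow> complex) \<Rightarrow> real \<Rightarrow> real \<Rightarrow> complex" where
  "Prim u z k = (\<integral>t. indicator {..z} t *\<^sub>R u t k \<partial>Mz)"

lemma Prim_eq: "z \<in> A \<Longrightarrow> Prim u z k = integral\<^sup>L (intv (-\<xi>) z) (\<lambda>t. u t k)"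
  unfolding Prim_def by (rule integral_intv_sub[symmetric])

lemma Prim_0 [simp]: "Prim u (-\<xi>) k = 0"
proof -
  have "AE t in lborel. t \<noteq> -\<xi>" by (rule AE_lborel_singleton)
  then have "(\<integral>t. indicator {-\<xi>..-\<xi>} t *\<^sub>R u t k \<partial>lborel) = 0"
    by (intro integral_eq_zero_AE) (auto elim!: eventually_mono)
  then show ?thesis
    using xi_pos d_pos by (subst Prim_eq) (auto simp: integral_restrict_space)
qed

lemma ac_on_Prim:
  assumes "integrable Mz (\<lambda>z. u z k)"
  shows "ac_on (-\<xi>) d (\<lambda>z. Prim u z k) (\<lambda>z. u z k)"
  using assms by (intro ac_onI) (auto simp: Prim_eq)

lemma Prim_measurable:
  assumes m: "case_prod u \<in> borel_measurable \<nu>"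
  shows "case_prod (Prim u) \<in> borel_measurable \<nu>"
proof -
  have "(\<lambda>x. \<integral>t. indicator {..fst x} t *\<^sub>R u t (snd x) \<partial>Mz) \<in> borel_measurable \<nu>"
  proof (rule z.borel_measurable_lebesgue_integral)
    have 1: "(\<lambda>y. u (snd y) (snd (fst y))) \<in> borel_measurable (\<nu> \<Otimes>\<^sub>M Mz)"
    proof -
      have "(\<lambda>y. (snd y, snd (fst y))) \<in> measurable (\<nu> \<Otimes>\<^sub>M Mz) \<nu>" by measurable
      from measurable_compose[OF this m] show ?thesis by simp
    qed
    have a: "(\<lambda>y. fst (fst y)) \<in> borel_measurable (\<nu> \<Otimes>\<^sub>M Mz)"
      by (intro measurable_compose[OF _ id_measurable_intv[of "-\<xi>" d]]) measurable
    have b: "snd \<in> borel_measurable (\<nu> \<Otimes>\<^sub>M Mz)"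
      using measurable_compose[OF measurable_snd id_measurable_intv[of "-\<xi>" d], of \<nu>] by simp
    have 2: "(\<lambda>y. indicator {y. snd y \<le> fst (fst y)} y :: real) \<in> borel_measurable (\<nu> \<Otimes>\<^sub>M Mz)"
      by (rule borel_measurable_indicator') (use a b in measurable)
    have "(\<lambda>y. indicator {y. snd y \<le> fst (fst y)} y *\<^sub>R u (snd y) (snd (fst y))) \<in> borel_measurable (\<nu> \<Otimes>\<^sub>M Mz)"
      using 1 2 by (rule borel_measurable_scaleR[rotated])
    then show "(\<lambda>(x, t). indicator {..fst x} t *\<^sub>R u t (snd x)) \<in> borel_measurable (\<nu> \<Otimes>\<^sub>M Mz)"
      by (simp add: case_prod_unfold indicator_def)
  qed
  then show ?thesis by (simp add: Prim_def case_prod_unfold)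
qed

text \<open>Integrating twice from z = -xi enforces both conditions at that end, so at an interior
  node the value at z = d is the only constraint left on the second derivative.\<close>

lemma H0_of_second_derivative:
  assumes S: "\<And>j s. j \<le> N \<Longrightarrow> s \<le> N \<Longrightarrow> L2 (S j s)"
    and sq: "\<And>j s k. j \<le> N \<Longrightarrow> s \<le> N \<Longrightarrow> k \<in> K \<Longrightarrow> sqi Mz (\<lambda>z. S j s z k)"
    and end0: "\<And>j s k. j \<le> N \<Longrightarrow> s \<le> N \<Longrightarrow> k \<in> K \<Longrightarrow> Prim (Prim (S j s)) d k = 0"
    and lat: "\<And>j s z k. lateral j s \<Longrightarrow> S j s z k = 0"
  shows "\<exists>f D. f \<in> H0 \<and> deriv2 f D \<and> D 2 = S"
proof -
  define f :: kfun where "f = (\<lambda>j s. Prim (Prim (S j s)))"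
  define D :: "nat \<Rightarrow> kfun" where "D i = (if i = 0 then f else if i = 1 then (\<lambda>j s. Prim (S j s)) else S)" for i
  have Dv: "D 0 = f" "D 1 = (\<lambda>j s. Prim (S j s))" "D 2 = S" by (auto simp: D_def)
  have D: "deriv2 f D"
    unfolding deriv2_iff Dv
  proof (intro allI impI conjI ballI)
    fix j s assume js: "j \<le> N" "s \<le> N"
    have m: "case_prod (S j s) \<in> borel_measurable \<nu>" using S[OF js] by (rule sqi_measurable)
    have ac1: "ac_on (-\<xi>) d (\<lambda>z. Prim (S j s) z k) (\<lambda>z. S j s z k)" if "k \<in> K" for k
      using z.sqi_integrable(1)[OF sq[OF js that]] by (rule ac_on_Prim)
    have sq1: "sqi Mz (\<lambda>z. Prim (S j s) z k)" if "k \<in> K" for k by (rule ac_on_sqi[OF ac1[OF that]])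
    have ac0: "ac_on (-\<xi>) d (\<lambda>z. Prim (Prim (S j s)) z k) (\<lambda>z. Prim (S j s) z k)" if "k \<in> K" for k
      using z.sqi_integrable(1)[OF sq1[OF that]] by (rule ac_on_Prim)
    show "ac_on (-\<xi>) d (\<lambda>z. f j s z k) (\<lambda>z. Prim (S j s) z k)" "ac_on (-\<xi>) d (\<lambda>z. Prim (S j s) z k) (\<lambda>z. S j s z k)" if "k \<in> K" for k
      using ac0 ac1 that by (auto simp: f_def)
    have L1: "L2 (Prim (S j s))"
      by (rule Sb_L2(1)[OF Sb_primitive[OF Prim_measurable[OF m] S[OF js] ac1 sq[OF js] _ disjI2[of "0 = 0 \<and> d + \<xi> = d + \<xi>"]]]) auto
    have "L2 (Prim (Prim (S j s)))"
      by (rule Sb_L2(1)[OF Sb_primitive[OF Prim_measurable[OF sqi_measurable[OF L1]] L1 ac0 sq1 _ disjI2[of "0 = 0 \<and> d + \<xi> = d + \<xi>"]]]) auto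
    with L1 show "L2 (Prim (S j s))" "L2 (f j s)" by (auto simp: f_def)
  qed (use S sq in auto)
  have "f \<in> H0"
    unfolding H0_iff[OF D]
  proof (intro allI impI conjI ballI)
    fix j s k z assume "lateral j s"
    then show "f j s z k = 0" by (simp add: f_def Prim_def lat)
  qed (auto simp: f_def Dv end0 simp del: One_nat_def)
  then show ?thesis using D Dv by blast
qed

text \<open>The boundary conditions are demanded for every k, but L2 convergence of the second
  derivatives determines the limit for almost every k only. The limit is set to zero at the
  exceptional k, which affects neither its L2 class nor the convergence.\<close>

lemma node_limit:
  fixes D :: "nat \<Rightarrow> nat \<Rightarrow> real \<Rightarrow> real \<Rightarrow> complex"
  assumes ac0: "\<And>n k. k \<in> K \<Longrightarrow> ac_on (-\<xi>) d (\<lambda>z. D n 0 z k) (\<lambda>z. D n 1 z k)"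
    and ac1: "\<And>n k. k \<in> K \<Longrightarrow> ac_on (-\<xi>) d (\<lambda>z. D n 1 z k) (\<lambda>z. D n 2 z k)"
    and sq: "\<And>n k. k \<in> K \<Longrightarrow> sqi Mz (\<lambda>z. D n 2 z k)" and L: "\<And>n. L2 (D n 2)"
    and bc: "\<And>n k. k \<in> K \<Longrightarrow> D n 0 (-\<xi>) k = 0" "\<And>n k. k \<in> K \<Longrightarrow> D n 1 (-\<xi>) k = 0" "\<And>n k. k \<in> K \<Longrightarrow> D n 0 d k = 0"
    and cauchy: "\<And>e. 0 < e \<Longrightarrow> \<exists>M. \<forall>m\<ge>M. \<forall>n\<ge>M. nsq 0 (\<lambda>z k. D m 2 z k - D n 2 z k) < e"
  shows "\<exists>S. L2 S \<and> (\<forall>k\<in>K. sqi Mz (\<lambda>z. S z k)) \<and> (\<forall>k\<in>K. Prim (Prim S) d k = 0) \<and>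
    (\<lambda>n. nsq 0 (\<lambda>z k. D n 2 z k - S z k)) \<longlonglongrightarrow> 0"
proof -
  have "\<exists>T. sqi \<nu> T \<and> (\<lambda>n. \<integral>x. (cmod (case_prod (D n 2) x - T x))\<^sup>2 \<partial>\<nu>) \<longlonglongrightarrow> 0"
    by (rule sqi_complete[OF L]) (use cauchy in \<open>simp add: nsq_0 case_prod_unfold\<close>)
  then obtain T where T: "sqi \<nu> T" and Tlim: "(\<lambda>n. \<integral>x. (cmod (case_prod (D n 2) x - T x))\<^sup>2 \<partial>\<nu>) \<longlonglongrightarrow> 0"
    by blast
  define S0 where "S0 z k = T (z, k)" for z k
  have S0: "L2 S0" using T by (simp add: S0_def case_prod_unfold)
  have lim0: "(\<lambda>n. nsq 0 (\<lambda>z k. D n 2 z k - S0 z k)) \<longlonglongrightarrow> 0"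
    using Tlim by (simp add: nsq_0 S0_def case_prod_unfold)
  have m0 [measurable]: "case_prod S0 \<in> borel_measurable \<nu>" using S0 by (rule sqi_measurable)
  define P where "P k = Prim (Prim S0) d k" for k
  have Pm: "P \<in> borel_measurable Mk"
    unfolding P_def using slice_measurable(1)[OF Prim_measurable[OF Prim_measurable[OF m0]], of d] xi_pos d_pos by simp
  define good where "good k \<longleftrightarrow> integrable Mz (\<lambda>z. (cmod (S0 z k))\<^sup>2) \<and> P k = 0" for k
  have sq0: "sqi Mz (\<lambda>z. S0 z k)" if "k \<in> K" "integrable Mz (\<lambda>z. (cmod (S0 z k))\<^sup>2)" for k
    using that slice_measurable(2)[OF m0] by (simp add: sqi_def)
  have meas_int: "Measurable.pred Mk (\<lambda>k. integrable Mz (\<lambda>z. (cmod (S0 z k))\<^sup>2))"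
  proof (rule z.borel_measurable_lebesgue_integrable)
    have "(\<lambda>y. S0 (snd y) (fst y)) \<in> borel_measurable (Mk \<Otimes>\<^sub>M Mz)"
    proof -
      have "(\<lambda>y. (snd y, fst y)) \<in> measurable (Mk \<Otimes>\<^sub>M Mz) \<nu>" by measurable
      from measurable_compose[OF this m0] show ?thesis by simp
    qed
    then show "(\<lambda>(k, z). (cmod (S0 z k))\<^sup>2) \<in> borel_measurable (Mk \<Otimes>\<^sub>M Mz)" by (simp add: case_prod_unfold)
  qed
  have AEint: "AE k in Mk. integrable Mz (\<lambda>z. (cmod (S0 z k))\<^sup>2)"
    using zk.AE_integrable_snd[of "\<lambda>z k. (cmod (S0 z k))\<^sup>2"] sqi_integrable_sq[OF S0] by (simp add: case_prod_unfold)
  have w: "L2 (\<lambda>z k. D n 2 z k - S0 z k)" for n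
    using sqi_diff[OF L S0, of n] by (simp add: case_prod_unfold)
  \<comment> \<open>The cube collects one length from each of the two integrations and one from
    integrating the bound for the first primitive over z.\<close>
  define G where "G n k = (d + \<xi>) ^ 3 * (\<integral>z. (cmod (D n 2 z k - S0 z k))\<^sup>2 * wgt 0 z \<partial>Mz)" for n k
  have G: "integrable Mk (G n)" "(\<integral>k. G n k \<partial>Mk) = (d + \<xi>) ^ 3 * nsq 0 (\<lambda>z k. D n 2 z k - S0 z k)" for n
    unfolding G_def using L2_slice_integrable[OF w[of n], of 0] by simp_all
  text \<open>Every \<open>D n 0\<close> vanishes at \<open>z = d\<close>, so the primitive of the limit inherits this for almost every \<open>k\<close>.\<close>
  have PG: "(cmod (P k))\<^sup>2 \<le> G n k" if k: "k \<in> K" and i: "integrable Mz (\<lambda>z. (cmod (S0 z k))\<^sup>2)" for n k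
  proof -
    have a1: "ac_on (-\<xi>) d (\<lambda>z. D n 1 z k - Prim S0 z k) (\<lambda>z. D n 2 z k - S0 z k)"
      by (intro ac_on_diff ac1 k ac_on_Prim z.sqi_integrable(1) sq0 i)
    have a0: "ac_on (-\<xi>) d (\<lambda>z. D n 0 z k - Prim (Prim S0) z k) (\<lambda>z. D n 1 z k - Prim S0 z k)"
    proof (intro ac_on_diff ac0 k ac_on_Prim z.sqi_integrable(1))
      show "sqi Mz (\<lambda>z. Prim S0 z k)"
        by (rule ac_on_sqi[OF ac_on_Prim[of S0 k, OF z.sqi_integrable(1)[OF sq0[OF k i]]]])
    qed
    let ?w = "\<integral>z. (cmod (D n 2 z k - S0 z k))\<^sup>2 \<partial>Mz"
    have b1: "(cmod (D n 1 z k - Prim S0 z k))\<^sup>2 \<le> (d + \<xi>) * ?w" if "z \<in> A" for z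
      using weighted_primitive_bound[OF a1 sqi_diff[OF sq[OF k] sq0[OF k i]] _ that, of 0 "d + \<xi>"] bc k by simp
    have "(cmod (D n 0 d k - Prim (Prim S0) d k))\<^sup>2 \<le> (d + \<xi>) * (\<integral>z. (cmod (D n 1 z k - Prim S0 z k))\<^sup>2 \<partial>Mz)"
      using weighted_primitive_bound[OF a0 ac_on_sqi[OF a1], of d 0 "d + \<xi>"] bc k xi_pos d_pos by simp
    also have "(\<integral>z. (cmod (D n 1 z k - Prim S0 z k))\<^sup>2 \<partial>Mz) \<le> (\<integral>z. (d + \<xi>) * ?w \<partial>Mz)"
      using sqi_integrable_sq[OF ac_on_sqi[OF a1]] b1 by (intro integral_mono) auto
    finally show ?thesis
      using bc(3)[OF k] len_pos by (simp add: P_def G_def power3_eq_cube mult.assoc)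
  qed
  have AEP: "AE k in Mk. P k = 0"
  proof -
    have le: "AE k in Mk. (cmod (P k))\<^sup>2 \<le> G n k" for n
      using AEint AE_space by eventually_elim (use PG in auto)
    have int: "integrable Mk (\<lambda>k. (cmod (P k))\<^sup>2)"
    proof (rule Bochner_Integration.integrable_bound[OF G(1)[of 0]])
      show "AE k in Mk. norm ((cmod (P k))\<^sup>2) \<le> norm (G 0 k)"
        using le[of 0] by eventually_elim simp
    qed (use Pm in measurable)
    have "(\<integral>k. (cmod (P k))\<^sup>2 \<partial>Mk) \<le> (d + \<xi>) ^ 3 * nsq 0 (\<lambda>z k. D n 2 z k - S0 z k)" for n
      unfolding G(2)[symmetric] by (rule integral_mono_AE[OF int G(1) le])
    moreover have "(\<lambda>n. (d + \<xi>) ^ 3 * nsq 0 (\<lambda>z k. D n 2 z k - S0 z k)) \<longlonglongrightarrow> (d + \<xi>) ^ 3 * 0"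
      by (intro tendsto_intros lim0)
    ultimately have "(\<integral>k. (cmod (P k))\<^sup>2 \<partial>Mk) \<le> (d + \<xi>) ^ 3 * 0"
      by (intro LIMSEQ_le_const) auto
    moreover have "0 \<le> (\<integral>k. (cmod (P k))\<^sup>2 \<partial>Mk)" by (rule integral_nonneg_AE) simp
    ultimately have "(\<integral>k. (cmod (P k))\<^sup>2 \<partial>Mk) = 0" by simp
    then show ?thesis by (subst (asm) integral_nonneg_eq_0_iff_AE[OF int]) auto
  qed
  have AEgood: "AE k in Mk. good k"
    using AEint AEP by eventually_elim (simp add: good_def)
  have goodm: "Measurable.pred Mk good"
    unfolding good_def using meas_int Pm by measurable
  \<comment> \<open>The zero slice meets every requirement, so it is a valid replacement;
    measurability of \<open>good\<close> keeps S measurable on the box.\<close>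
  define S where "S z k = (if good k then S0 z k else 0)" for z k
  have Pset: "Measurable.pred \<nu> (\<lambda>x. good (snd x))"
    using measurable_compose[OF measurable_snd goodm] .
  have AEeq: "AE x in \<nu>. case_prod S x = case_prod S0 x"
  proof -
    have "AE x in \<nu>. good (snd x)"
    proof (rule zk.AE_pair_measure)
      show "{x \<in> space \<nu>. good (snd x)} \<in> sets \<nu>" using Pset by (simp add: pred_def)
      show "AE x in Mz. AE y in Mk. good (snd (x, y))" using AEgood by simp
    qed
    then show ?thesis by eventually_elim (simp add: S_def case_prod_unfold)
  qed
  have Sm: "case_prod S \<in> borel_measurable \<nu>"
    unfolding S_def case_prod_unfold using Pset m0 by (auto simp: case_prod_unfold)
  have SL: "L2 S" by (rule sqi_cong_AE[OF S0 Sm AEeq])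
  moreover have "sqi Mz (\<lambda>z. S z k)" if "k \<in> K" for k
    using sq0[OF that] by (cases "good k") (auto simp: S_def good_def sqi_zero)
  moreover have "Prim (Prim S) d k = 0" if "k \<in> K" for k
  proof (cases "good k")
    case True
    have "Prim S z k = Prim S0 z k" for z using True by (simp add: Prim_def S_def)
    then have "Prim (Prim S) d k = P k" by (simp add: P_def Prim_def[of "Prim S"] Prim_def[of "Prim S0"])
    then show ?thesis using True by (simp add: good_def)
  next
    case False
    then show ?thesis by (simp add: Prim_def S_def)
  qed
  moreover have "nsq 0 (\<lambda>z k. D n 2 z k - S z k) = nsq 0 (\<lambda>z k. D n 2 z k - S0 z k)" for n
    unfolding nsq_0
  proof (rule integral_cong_AE)
    have "L2 (\<lambda>z k. D n 2 z k - S z k)" using sqi_diff[OF L SL, of n] by (simp add: case_prod_unfold)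
    then show "(\<lambda>(z, k). (cmod (D n 2 z k - S z k))\<^sup>2) \<in> borel_measurable \<nu>"
      using borel_measurable_integrable[OF sqi_integrable_sq] by (simp add: case_prod_unfold)
    show "(\<lambda>(z, k). (cmod (D n 2 z k - S0 z k))\<^sup>2) \<in> borel_measurable \<nu>"
      using borel_measurable_integrable[OF sqi_integrable_sq[OF w[of n]]] by (simp add: case_prod_unfold)
    show "AE x in \<nu>. (case x of (z, k) \<Rightarrow> (cmod (D n 2 z k - S z k))\<^sup>2) = (case x of (z, k) \<Rightarrow> (cmod (D n 2 z k - S0 z k))\<^sup>2)"
      using AEeq by eventually_elim (simp add: case_prod_unfold)
  qed
  ultimately show ?thesis using lim0 by auto
qed

lemma deriv2_combine:
  assumes "deriv2 f D" "deriv2 g E"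
  shows "deriv2 (kadd f (kscale (-1) g)) (\<lambda>i j s z k. D i j s z k - E i j s z k)"
  using deriv2_add[OF assms(1) deriv2_scale[OF assms(2), of "-1"]] by simp

text \<open>The limit is assembled node by node from limits of second derivatives. Convergence in
  the full norm then follows because on this subspace the second derivatives control that
  norm.\<close>

lemma H0_complete:
  assumes X: "\<And>n::nat. X n \<in> H0"
    and cauchy: "\<And>e. 0 < e \<Longrightarrow> \<exists>M. \<forall>m\<ge>M. \<forall>n\<ge>M. ip (kadd (X m) (kscale (-1) (X n))) (kadd (X m) (kscale (-1) (X n))) < e"
  shows "\<exists>x\<in>H0. (\<lambda>n. ip (kadd (X n) (kscale (-1) x)) (kadd (X n) (kscale (-1) x))) \<longlonglongrightarrow> 0"
proof -
  define D where "D n = dd (X n)" for n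
  have D: "deriv2 (X n) (D n)" for n unfolding D_def by (rule deriv2_dd[OF H0_HK[OF X]])
  define Q where "Q j s S \<longleftrightarrow> L2 S \<and> (\<forall>k\<in>K. sqi Mz (\<lambda>z. S z k)) \<and> (\<forall>k\<in>K. Prim (Prim S) d k = 0) \<and>
    (\<lambda>n. nsq 0 (\<lambda>z k. D n 2 j s z k - S z k)) \<longlonglongrightarrow> 0 \<and> (lateral j s \<longrightarrow> S = (\<lambda>z k. 0))" for j s S
  have "\<exists>S. Q j s S"
    if js: "j \<le> N" "s \<le> N" for j s
  proof (cases "lateral j s")
    case True
    have "nsq 0 (D n 2 j s) = 0" for n by (rule H0_lateral[OF X D js True])
    \<comment> \<open>At a lateral node the limit must vanish identically, not just almost
      everywhere, so it is prescribed instead of obtained from completeness.\<close>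
    then have "Q j s (\<lambda>z k. 0)"
      by (simp add: Q_def sqi_zero case_prod_unfold Prim_def)
    then show ?thesis by blast
  next
    case False
    have bc: "D n 0 j s (-\<xi>) k = 0" "D n 1 j s (-\<xi>) k = 0" "D n 0 j s d k = 0" if "k \<in> K" for n k
      using X[of n] js that deriv2D(1)[OF D js, of "-\<xi>" k n] deriv2D(1)[OF D js, of d k n] xi_pos d_pos
      unfolding H0_iff[OF D] by auto
    have "\<exists>S. L2 S \<and> (\<forall>k\<in>K. sqi Mz (\<lambda>z. S z k)) \<and> (\<forall>k\<in>K. Prim (Prim S) d k = 0) \<and>
      (\<lambda>n. nsq 0 (\<lambda>z k. D n 2 j s z k - S z k)) \<longlonglongrightarrow> 0"
    proof (rule node_limit[of "\<lambda>n i. D n i j s"])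
      fix e :: real assume e: "0 < e"
      then have "0 < h\<^sup>2 * e" using h_pos by simp
      from cauchy[OF this] obtain M where M: "\<And>m n. M \<le> m \<Longrightarrow> M \<le> n \<Longrightarrow>
        ip (kadd (X m) (kscale (-1) (X n))) (kadd (X m) (kscale (-1) (X n))) < h\<^sup>2 * e" by blast
      have "nsq 0 (\<lambda>z k. D m 2 j s z k - D n 2 j s z k) < e" if "M \<le> m" "M \<le> n" for m n
      proof -
        note C = deriv2_combine[OF D D, of m n]
        have "h\<^sup>2 * nsq 0 (\<lambda>z k. D m 2 j s z k - D n 2 j s z k) < h\<^sup>2 * e"
          using nsq_le_nrm[OF C js, of 2] M[OF that] nrm_sq[OF deriv2_HK[OF C]] by simp
        then show ?thesis using h_pos by simp
      qed
      then show "\<exists>M. \<forall>m\<ge>M. \<forall>n\<ge>M. nsq 0 (\<lambda>z k. D m 2 j s z k - D n 2 j s z k) < e" by blast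
    qed (use bc deriv2D(2,3,4,7)[OF D js] in auto)
    then obtain S where S: "L2 S" "\<forall>k\<in>K. sqi Mz (\<lambda>z. S z k)" "\<forall>k\<in>K. Prim (Prim S) d k = 0"
      "(\<lambda>n. nsq 0 (\<lambda>z k. D n 2 j s z k - S z k)) \<longlonglongrightarrow> 0"
      by (elim exE conjE)
    have "Q j s S" unfolding Q_def by (intro conjI S) (simp add: False)
    then show ?thesis by blast
  qed
  then have "\<forall>j. \<forall>s. \<exists>S. j \<le> N \<longrightarrow> s \<le> N \<longrightarrow> Q j s S"
    by blast
  then obtain S0 where "\<And>j s. j \<le> N \<Longrightarrow> s \<le> N \<Longrightarrow> Q j s (S0 j s)"
    by metis
  note S0 = this[unfolded Q_def]
  \<comment> \<open>\<open>H0_of_second_derivative\<close> wants zero at every lateral index pair,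
    including pairs with an index beyond N, where \<open>S0\<close> is arbitrary.\<close>
  define S where "S j s = (if lateral j s then (\<lambda>z k. 0) else S0 j s)" for j s
  have SS0: "S j s = S0 j s" if "j \<le> N" "s \<le> N" for j s using S0[OF that] by (simp add: S_def)
  have "\<exists>f E. f \<in> H0 \<and> deriv2 f E \<and> E 2 = S"
  proof (rule H0_of_second_derivative)
    fix j s assume js: "j \<le> N" "s \<le> N"
    show "L2 (S j s)" unfolding SS0[OF js] using S0[OF js] by blast
    fix k assume k: "k \<in> K"
    show "sqi Mz (\<lambda>z. S j s z k)" "Prim (Prim (S j s)) d k = 0" unfolding SS0[OF js] using S0[OF js] k by blast+
  qed (simp add: S_def)
  then obtain f E where f: "f \<in> H0" and E: "deriv2 f E" and E2: "E 2 = S" by blast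
  let ?C = "1 + (d + \<xi>)\<^sup>2 + (d + \<xi>)^4"
  have lim: "(\<lambda>n. ?C * (\<Sum>j\<le>N. \<Sum>s\<le>N. h\<^sup>2 * nsq 0 (\<lambda>z k. D n 2 j s z k - S j s z k))) \<longlonglongrightarrow> ?C * (\<Sum>j\<le>N. \<Sum>s\<le>N. h\<^sup>2 * 0)"
  proof (intro tendsto_intros)
    fix j s assume "j \<in> {..N}" "s \<in> {..N}"
    then have js: "j \<le> N" "s \<le> N" by auto
    show "(\<lambda>n. nsq 0 (\<lambda>z k. D n 2 j s z k - S j s z k)) \<longlonglongrightarrow> 0" unfolding SS0[OF js] using S0[OF js] by blast
  qed
  have le: "ip (kadd (X n) (kscale (-1) f)) (kadd (X n) (kscale (-1) f))
      \<le> ?C * (\<Sum>j\<le>N. \<Sum>s\<le>N. h\<^sup>2 * nsq 0 (\<lambda>z k. D n 2 j s z k - S j s z k))" for n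
  proof -
    note C = deriv2_combine[OF D E, of n]
    have "kadd (X n) (kscale (-1) f) \<in> H0" by (intro kadd_H0 kscale_H0 X f)
    from H0_norm_le[OF this C] show ?thesis by (simp add: nrm_sq[OF deriv2_HK[OF C]] E2)
  qed
  have ge: "0 \<le> ip (kadd (X n) (kscale (-1) f)) (kadd (X n) (kscale (-1) f))" for n
    by (intro ip_nonneg H0_HK kadd_H0 kscale_H0 X f)
  have "(\<lambda>n. ip (kadd (X n) (kscale (-1) f)) (kadd (X n) (kscale (-1) f))) \<longlonglongrightarrow> 0"
    by (rule tendsto_sandwich[OF always_eventually always_eventually tendsto_const])
      (use lim le ge in auto)
  with f show ?thesis by blast
qed

lemma zero_H0: "(\<lambda>j s z k. 0) \<in> H0"
  unfolding H0_iff[OF deriv2_zero] by simp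

lemma H0_riesz:
  assumes "\<And>x y. x \<in> H0 \<Longrightarrow> y \<in> H0 \<Longrightarrow> T (kadd x y) = T x + T y"
    and "\<And>c x. x \<in> H0 \<Longrightarrow> T (kscale c x) = c * T x"
    and "\<And>x. x \<in> H0 \<Longrightarrow> \<bar>T x\<bar> \<le> C * nrm x"
  shows "\<exists>g\<in>H0. \<forall>r\<in>H0. ip g r = T r"
  by (rule riesz_representation[of H0 kadd kscale ip T C])
    (use assms zero_H0 kadd_H0 kscale_H0 ip_sym ip_add_left ip_scale_left ip_nonneg H0_HK H0_complete nrm_eq in auto)

end

section \<open>The nonlinear operator\<close>

text \<open>Numbering the components turns \<open>dot3\<close> into a sum over \<open>m < 3\<close>,
  so each estimate is proved for one generic component.\<close>

definition comp3 :: "nat \<Rightarrow> complex \<times> complex \<times> complex \<Rightarrow> complex" where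
  "comp3 m a = (if m = 0 then fst a else if m = 1 then fst (snd a) else snd (snd a))"

lemma sum_lessThan_3: "(\<Sum>m<3. f m) = f 0 + f 1 + f (2::nat)"
  by (simp add: numeral_3_eq_3 numeral_2_eq_2)

lemma dot3_comp3: "dot3 a b = (\<Sum>m<3. comp3 m a * comp3 m b)"
  by (simp add: dot3_def comp3_def sum_lessThan_3)

lemma bounded_linear_comp3: "bounded_linear (comp3 m)"
proof -
  have "comp3 m = (if m = 0 then fst else if m = 1 then (\<lambda>a. fst (snd a)) else (\<lambda>a. snd (snd a)))"
    by (auto simp: comp3_def)
  then show ?thesis
    by (simp add: bounded_linear_fst bounded_linear_compose[OF bounded_linear_fst bounded_linear_snd]
      bounded_linear_compose[OF bounded_linear_snd bounded_linear_snd])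
qed

lemma comp3_diff: "comp3 m (a - b) = comp3 m a - comp3 m b"
  and comp3_add: "comp3 m (a + b) = comp3 m a + comp3 m b"
  and comp3_scaleR: "comp3 m (c *\<^sub>R a) = c *\<^sub>R comp3 m a"
  by (simp_all add: comp3_def)

text \<open>The operator integrates a triple-valued gradient; a component may be moved through that
  integral once the triple itself is known to be integrable.\<close>

lemma comp3_integrable:
  assumes "\<And>m. m < 3 \<Longrightarrow> integrable M (\<lambda>x. comp3 m (g x))"
  shows "integrable M g"
proof -
  have g: "g = (\<lambda>x. (comp3 0 (g x), 0, 0) + (0, comp3 1 (g x), 0) + (0, 0, comp3 2 (g x)))"
    by (simp add: comp3_def)
  have b: "bounded_linear (\<lambda>x::complex. (x, 0::complex, 0::complex))"
    "bounded_linear (\<lambda>x::complex. (0::complex, x, 0::complex))" "bounded_linear (\<lambda>x::complex. (0::complex, 0::complex, x))"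
    by (intro bounded_linear_Pair bounded_linear_ident bounded_linear_zero)+
  have "integrable M (\<lambda>x. (comp3 0 (g x), 0, 0) + (0, comp3 1 (g x), 0) + (0, 0, comp3 2 (g x)))"
    by (intro Bochner_Integration.integrable_add integrable_bounded_linear[OF b(1)]
        integrable_bounded_linear[OF b(2)] integrable_bounded_linear[OF b(3)] assms) simp_all
  then show ?thesis by (subst g)
qed

context semidiscrete_grid
begin

section \<open>The operator as a quadratic polynomial in discrete jets\<close>

abbreviation "\<kappa>0 \<equiv> ku - kl"

definition jet :: "(nat \<Rightarrow> kfun) \<Rightarrow> nat \<Rightarrow> nat \<Rightarrow> nat \<Rightarrow> real \<Rightarrow> real \<Rightarrow> complex" where
  "jet D j s m z k = comp3 m (gradh h (\<lambda>j s. D 0 j s z k) (\<lambda>j s. D 1 j s z k) j s)"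

text \<open>The lateral part of the discrete Laplacian: the slot of the second z derivative is
  filled with zero, because that derivative is treated separately.\<close>

definition lp :: "(nat \<Rightarrow> kfun) \<Rightarrow> nat \<Rightarrow> nat \<Rightarrow> real \<Rightarrow> real \<Rightarrow> complex" where
  "lp D j s z k = laph h (\<lambda>j s. D 0 j s z k) (\<lambda>_ _. 0) j s"

definition gvec :: "sfun \<Rightarrow> nat \<Rightarrow> nat \<Rightarrow> nat \<Rightarrow> real \<Rightarrow> complex" where
  "gvec V j s m z = comp3 m (gradh h (\<lambda>j s. V j s z) (\<lambda>j s. dzs N \<xi> d 2 V 1 j s z) j s)"

lemma jet_simps:
  "jet D j s 0 = (\<lambda>z k. (1 / complex_of_real (2 * h)) * (D 0 (j+1) s z k - D 0 (j-1) s z k))"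
  "jet D j s 1 = (\<lambda>z k. (1 / complex_of_real (2 * h)) * (D 0 j (s+1) z k - D 0 j (s-1) z k))"
  "jet D j s 2 = D 1 j s"
  by (auto simp: jet_def comp3_def gradh_def fun_eq_iff)

lemma gvec_simps:
  "gvec V j s 0 = (\<lambda>z. (1 / complex_of_real (2 * h)) * (V (j+1) s z - V (j-1) s z))"
  "gvec V j s 1 = (\<lambda>z. (1 / complex_of_real (2 * h)) * (V j (s+1) z - V j (s-1) z))"
  "gvec V j s 2 = dzs N \<xi> d 2 V 1 j s"
  by (auto simp: gvec_def comp3_def gradh_def fun_eq_iff)

lemma lp_eq: "lp D j s = (\<lambda>z k. (1 / complex_of_real (h\<^sup>2)) *
   ((D 0 (j-1) s z k + D 0 (j+1) s z k) + (D 0 j (s-1) z k + D 0 j (s+1) z k) - 4 * D 0 j s z k))"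
  by (auto simp: lp_def laph_def fun_eq_iff field_simps diff_divide_distrib add_divide_distrib)

text \<open>The operator with its ingredients separated: G is the gradient of the tail, x the
  discrete gradient of q, e the lateral part of its Laplacian, w its second z derivative. Only w
  lacks a bound uniform in z.\<close>

definition LL :: "(nat \<Rightarrow> real \<Rightarrow> complex) \<Rightarrow> (nat \<Rightarrow> real \<Rightarrow> real \<Rightarrow> complex) \<Rightarrow> (real \<Rightarrow> real \<Rightarrow> complex) \<Rightarrow>
    (real \<Rightarrow> real \<Rightarrow> complex) \<Rightarrow> real \<Rightarrow> real \<Rightarrow> complex" where
  "LL G x e w z k = w z k + e z k
     + 2 * complex_of_real k * (\<Sum>m<3. (G m z - Iop (x m) z k) * (complex_of_real k * (x m z k + G m z) - Iop (x m) z k))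
     + 2 * \<i> * (complex_of_real k * x 2 z k + G 2 z - Iop (x 2) z k)"

text \<open>The derivative of the operator at x in the direction y, apart from the second z
  derivative of that direction.\<close>

definition Rest :: "(nat \<Rightarrow> real \<Rightarrow> complex) \<Rightarrow> (nat \<Rightarrow> real \<Rightarrow> real \<Rightarrow> complex) \<Rightarrow> (nat \<Rightarrow> real \<Rightarrow> real \<Rightarrow> complex) \<Rightarrow>
    (real \<Rightarrow> real \<Rightarrow> complex) \<Rightarrow> real \<Rightarrow> real \<Rightarrow> complex" where
  "Rest G x y e z k = e z k
     + 2 * (complex_of_real k * (\<Sum>m<3. (G m z - Iop (x m) z k) * (complex_of_real k * y m z k - Iop (y m) z k)
         - Iop (y m) z k * (complex_of_real k * (x m z k + G m z) - Iop (x m) z k)))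
     + (2 * \<i>) * (complex_of_real k * y 2 z k - Iop (y 2) z k)"

definition Quad :: "(nat \<Rightarrow> real \<Rightarrow> real \<Rightarrow> complex) \<Rightarrow> real \<Rightarrow> real \<Rightarrow> complex" where
  "Quad y z k = (- 2) * (complex_of_real k * (\<Sum>m<3. Iop (y m) z k * (complex_of_real k * y m z k - Iop (y m) z k)))"

text \<open>The operator is a polynomial of degree two, so the expansion is exact; the mean-square
  bounds serve only to split the integrals in k.\<close>

lemma LL_add:
  assumes x: "\<And>m. m < 3 \<Longrightarrow> Sb 0 (x m) a" and y: "\<And>m. m < 3 \<Longrightarrow> Sb 0 (y m) b" and zk: "z \<in> A" "k \<in> K"
  shows "LL G (\<lambda>m z k. x m z k + y m z k) (\<lambda>z k. e z k + e' z k) (\<lambda>z k. w z k + w' z k) z k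
     = LL G x e w z k + (w' z k + Rest G x y e' z k) + Quad y z k"
proof -
  have I: "Iop (\<lambda>z k. x m z k + y m z k) z k = Iop (x m) z k + Iop (y m) z k" if "m < 3" for m
    by (rule Iop_add[OF x[OF that] y[OF that] zk])
  show ?thesis
    unfolding LL_def Rest_def Quad_def sum_lessThan_3 using I[of 0] I[of 1] I[of 2]
    by (simp add: algebra_simps)
qed

text \<open>One constant for three bounds on squares: \<open>1 / h\<^sup>2\<close> for a central
  difference, 1 for the z derivative, and \<open>64 / h^4\<close> for the five-point lateral
  Laplacian, where the estimate of a squared sum by twice the sum of squares is iterated.\<close>

definition cJ :: real where "cJ = 1 + 1 / h\<^sup>2 + 64 / h^4"

lemma cJ_ge: "1 / h\<^sup>2 \<le> cJ" "1 \<le> cJ" "64 / h^4 \<le> cJ" "0 \<le> cJ"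
  by (auto simp: cJ_def)

lemma jet_Sb:
  assumes D: "\<And>j s. j \<le> N \<Longrightarrow> s \<le> N \<Longrightarrow> Sb lam (D 0 j s) a \<and> Sb lam (D 1 j s) a"
    and js: "1 \<le> j" "j < N" "1 \<le> s" "s < N" and m: "m < 3"
  shows "Sb lam (jet D j s m) (cJ * a)" "Sb lam (lp D j s) (cJ * a)"
proof -
  have a: "0 \<le> a" using D[of 0 0] Sb_nonneg by blast
  have mono: "Sb lam u (t * a) \<Longrightarrow> t \<le> cJ \<Longrightarrow> Sb lam u (cJ * a)" for u t
    using a by (auto elim!: Sb_mono intro: mult_right_mono)
  have df: "Sb lam (\<lambda>z k. (1 / complex_of_real (2 * h)) * (u z k - v z k)) (cJ * a)" if "Sb lam u a" "Sb lam v a" for u v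
  proof (rule mono[OF _ cJ_ge(1)])
    have "Sb lam (\<lambda>z k. (1 / complex_of_real (2 * h)) * (u z k - v z k)) ((cmod (1 / complex_of_real (2 * h)))\<^sup>2 * (2 * a + 2 * a))"
      by (intro Sb_cmult Sb_diff that)
    then show "Sb lam (\<lambda>z k. (1 / complex_of_real (2 * h)) * (u z k - v z k)) ((1 / h\<^sup>2) * a)"
      using h_pos by (simp add: norm_divide norm_mult power_divide power_mult_distrib)
  qed
  have "m = 0 \<or> m = 1 \<or> m = 2" using m by auto
  then show "Sb lam (jet D j s m) (cJ * a)"
  proof (elim disjE)
    assume "m = 0" then show ?thesis unfolding jet_simps using df[of "D 0 (j+1) s" "D 0 (j-1) s"] D js by (simp add: jet_simps)
  next
    assume "m = 1" then show ?thesis using df[of "D 0 j (s+1)" "D 0 j (s-1)"] D js by (simp add: jet_simps del: One_nat_def)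
  next
    assume "m = 2" then show ?thesis using mono[of "D 1 j s" 1] cJ_ge(2) D[of j s] js by (simp add: jet_simps)
  qed
  show "Sb lam (lp D j s) (cJ * a)"
  proof (rule mono[OF _ cJ_ge(3)])
    have "Sb lam (lp D j s) ((cmod (1 / complex_of_real (h\<^sup>2)))\<^sup>2 *
      (2 * (2 * (2 * a + 2 * a) + 2 * (2 * a + 2 * a)) + 2 * ((cmod 4)\<^sup>2 * a)))"
      unfolding lp_eq by (intro Sb_cmult Sb_diff Sb_add conjunct1[OF D]) (use js in auto)
    then show "Sb lam (lp D j s) ((64 / h^4) * a)"
      using h_pos by (simp add: norm_divide power_divide norm_power flip: power_mult)
  qed
qed

lemma Sb_sum3:
  fixes u :: "nat \<Rightarrow> real \<Rightarrow> real \<Rightarrow> complex"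
  assumes "\<And>m. m < 3 \<Longrightarrow> Sb lam (u m) t"
  shows "Sb lam (\<lambda>z k. \<Sum>m<3. u m z k) (10 * t)"
proof -
  have "Sb lam (\<lambda>z k. u 0 z k + u 1 z k + u 2 z k) (2 * (2 * t + 2 * t) + 2 * t)"
    by (intro Sb_add assms) auto
  then show ?thesis by (simp add: sum_lessThan_3)
qed

lemma Bd_diff:
  assumes u: "Bd lam u s" and v: "Bd lam v t"
  shows "Bd lam (\<lambda>z k. u z k - v z k) (2 * s + 2 * t)"
  unfolding Bd_def
proof (intro conjI ballI)
  show "(\<lambda>(z, k). u z k - v z k) \<in> borel_measurable \<nu>"
    using u v borel_measurable_diff[of "case_prod u" \<nu> "case_prod v"] by (simp add: Bd_def case_prod_unfold)
  fix z k assume "z \<in> A" "k \<in> K"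
  then have "wgt lam z * (cmod (u z k))\<^sup>2 \<le> s" "wgt lam z * (cmod (v z k))\<^sup>2 \<le> t" using u v by (auto simp: Bd_def)
  moreover have "wgt lam z * (cmod (u z k - v z k))\<^sup>2 \<le> wgt lam z * (2 * (cmod (u z k))\<^sup>2 + 2 * (cmod (v z k))\<^sup>2)"
    by (intro mult_left_mono norm_diff_sq_le) auto
  ultimately show "wgt lam z * (cmod (u z k - v z k))\<^sup>2 \<le> 2 * s + 2 * t" by (simp add: algebra_simps)
qed

text \<open>The factor for \<open>k * y - Iop y\<close>. The integral contributes
  \<open>\<kappa>0\<close> twice: once from Cauchy-Schwarz in k, once from returning from a
  pointwise to a mean-square bound.\<close>

definition cC :: real where "cC = 2 * ku\<^sup>2 + 2 * (\<kappa>0 * \<kappa>0)"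

lemma cC_nonneg: "0 \<le> cC" by (simp add: cC_def)

lemma shifted_Sb:
  assumes "Sb lam y s"
  shows "Sb lam (\<lambda>z k. complex_of_real k * y z k - Iop y z k) (cC * s)"
proof -
  have "Sb lam (\<lambda>z k. complex_of_real k * y z k - Iop y z k) (2 * (ku\<^sup>2 * s) + 2 * (\<kappa>0 * (\<kappa>0 * s)))"
    by (intro Sb_diff Sb_kmult Bd_imp_Sb Bd_Iop assms)
  then show ?thesis by (simp add: cC_def algebra_simps)
qed

text \<open>In each product the integrated factor carries the weight and the other is measured
  without it. The bound is therefore linear in the weighted quantity s, and t only enters its
  coefficient.\<close>

lemma Quad_Sb:
  assumes y: "\<And>m. m < 3 \<Longrightarrow> Sb lam (y m) s" and y0: "\<And>m. m < 3 \<Longrightarrow> Sb 0 (y m) t"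
  shows "Sb lam (Quad y) (4 * (ku\<^sup>2 * (10 * ((\<kappa>0 * s) * (cC * t)))))"
proof -
  have "Sb (lam + 0) (\<lambda>z k. Iop (y m) z k * (complex_of_real k * y m z k - Iop (y m) z k)) ((\<kappa>0 * s) * (cC * t))" if "m < 3" for m
    by (intro Bd_mult_Sb Bd_Iop shifted_Sb y y0 that)
  then have "Sb lam (Quad y) ((cmod (- 2))\<^sup>2 * (ku\<^sup>2 * (10 * ((\<kappa>0 * s) * (cC * t)))))"
    unfolding Quad_def by (intro Sb_cmult Sb_kmult Sb_sum3) simp
  then show ?thesis by simp
qed

definition CR :: "real \<Rightarrow> real \<Rightarrow> real" where
  "CR g M = 4 + 160 * ku\<^sup>2 * (2 * ((2 * g + 2 * (\<kappa>0 * M)) * cC)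
     + 2 * (\<kappa>0 * (2 * (ku\<^sup>2 * (2 * M + 2 * (\<kappa>0 * g))) + 2 * (\<kappa>0 * (\<kappa>0 * M))))) + 8 * cC"

text \<open>The two kinds of products are split in opposite ways. The coefficient
  \<open>G - Iop x\<close> is bounded pointwise, so y may stay mean square and weighted; a
  coefficient containing x itself is only mean square in k, and there \<open>Iop y\<close> supplies
  the weighted pointwise bound.\<close>

lemma Rest_Sb:
  assumes G: "\<And>m. m < 3 \<Longrightarrow> Bd 0 (\<lambda>z k. G m z) g" and x: "\<And>m. m < 3 \<Longrightarrow> Sb 0 (x m) M"
    and y: "\<And>m. m < 3 \<Longrightarrow> Sb lam (y m) s" and e: "Sb lam e s"
  shows "Sb lam (Rest G x y e) (CR g M * s)"
proof -
  let ?b = "2 * (ku\<^sup>2 * (2 * M + 2 * (\<kappa>0 * g))) + 2 * (\<kappa>0 * (\<kappa>0 * M))"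
  let ?t = "2 * ((2 * g + 2 * (\<kappa>0 * M)) * (cC * s)) + 2 * ((\<kappa>0 * s) * ?b)"
  have 1: "Sb (0 + lam) (\<lambda>z k. (G m z - Iop (x m) z k) * (complex_of_real k * y m z k - Iop (y m) z k))
      ((2 * g + 2 * (\<kappa>0 * M)) * (cC * s))" if "m < 3" for m
    by (intro Bd_mult_Sb Bd_diff G x y Bd_Iop shifted_Sb that)
  have 2: "Sb (lam + 0) (\<lambda>z k. Iop (y m) z k * (complex_of_real k * (x m z k + G m z) - Iop (x m) z k)) ((\<kappa>0 * s) * ?b)" if "m < 3" for m
    by (intro Bd_mult_Sb Sb_diff Sb_kmult Sb_add Bd_imp_Sb G x y Bd_Iop that)
  have "Sb lam (Rest G x y e) (2 * (2 * s + 2 * ((cmod 2)\<^sup>2 * (ku\<^sup>2 * (10 * ?t)))) + 2 * ((cmod (2 * \<i>))\<^sup>2 * (cC * s)))"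
    unfolding Rest_def by (intro Sb_add Sb_cmult Sb_kmult Sb_sum3 Sb_diff shifted_Sb e y 1[simplified] 2[simplified]) auto
  moreover have "2 * (2 * s + 2 * ((cmod 2)\<^sup>2 * (ku\<^sup>2 * (10 * ?t)))) + 2 * ((cmod (2 * \<i>))\<^sup>2 * (cC * s)) = CR g M * s"
    by (simp add: CR_def norm_mult algebra_simps)
  ultimately show ?thesis by simp
qed

definition CB :: "real \<Rightarrow> real \<Rightarrow> real" where
  "CB g M = 2 * (2 * (2 * (4 * (ku\<^sup>2 * (ku\<^sup>2 * (10 * (g * (\<kappa>0 * g)))))) + 2 * (4 * (\<kappa>0 * g))) + 2 * (CR g 0 * M))
     + 2 * (4 * (ku\<^sup>2 * (10 * ((\<kappa>0 * M) * (cC * M)))))"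

lemma Sb_zero: "Sb lam (\<lambda>z k. 0) 0"
  by (simp add: Sb_def case_prod_unfold)

lemma Iop_zero: "Iop (\<lambda>z k. 0) z k = 0"
  using Iop_cmult[of 0 "\<lambda>z k. 0"] by simp

lemma Sb_cong:
  assumes u: "Sb lam u s" and eq: "\<And>z k. z \<in> A \<Longrightarrow> k \<in> K \<Longrightarrow> u z k = v z k"
  shows "Sb lam v s"
proof (rule Sb_dominated[where G = "\<lambda>z k. (cmod (u z k))\<^sup>2"])
  have "case_prod u \<in> borel_measurable \<nu>" using u by (simp add: Sb_def)
  then show "case_prod v \<in> borel_measurable \<nu>"
    by (subst measurable_cong[where g = "case_prod u"]) (use eq in auto)
qed (use u eq in \<open>auto simp: Sb_def\<close>)

text \<open>Expanding the operator around zero reuses the bounds for its linear and quadratic parts.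
  The second derivative slot is empty because that term is controlled in L2 only and is added
  later.\<close>

lemma LL_Sb:
  assumes G: "\<And>m. m < 3 \<Longrightarrow> Bd 0 (\<lambda>z k. G m z) g" and x: "\<And>m. m < 3 \<Longrightarrow> Sb 0 (x m) M" and e: "Sb 0 e M"
  shows "Sb 0 (LL G x e (\<lambda>z k. 0)) (CB g M)"
proof -
  have 0: "Sb 0 (\<lambda>z k. 2 * (complex_of_real k * (complex_of_real k * (\<Sum>m<3. G m z * G m z))) + (2 * \<i>) * G 2 z)
     (2 * ((cmod 2)\<^sup>2 * (ku\<^sup>2 * (ku\<^sup>2 * (10 * (g * (\<kappa>0 * g)))))) + 2 * ((cmod (2 * \<i>))\<^sup>2 * (\<kappa>0 * g)))"
  proof (intro Sb_add Sb_cmult Sb_kmult Sb_sum3)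
    show "Sb 0 (\<lambda>z k. G m z * G m z) (g * (\<kappa>0 * g))" if "m < 3" for m
      using Bd_mult_Sb[OF G[OF that] Bd_imp_Sb[OF G[OF that]]] by simp
    show "Sb 0 (\<lambda>z k. G 2 z) (\<kappa>0 * g)" using Bd_imp_Sb[OF G[of 2]] by simp
  qed
  have R: "Sb 0 (Rest G (\<lambda>m z k. 0) x e) (CR g 0 * M)"
    by (rule Rest_Sb[OF G Sb_zero x e])
  have Q: "Sb 0 (Quad x) (4 * (ku\<^sup>2 * (10 * ((\<kappa>0 * M) * (cC * M)))))"
    by (rule Quad_Sb[OF x x])
  have "Sb 0 (\<lambda>z k. (2 * (complex_of_real k * (complex_of_real k * (\<Sum>m<3. G m z * G m z))) + (2 * \<i>) * G 2 z)
      + Rest G (\<lambda>m z k. 0) x e z k + Quad x z k) (CB g M)"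
    using Sb_add[OF Sb_add[OF 0 R] Q] by (simp add: CB_def norm_mult)
  then show ?thesis
  proof (rule Sb_cong)
    fix z k assume zk: "z \<in> A" "k \<in> K"
    have "LL G x e (\<lambda>z k. 0) z k = LL G (\<lambda>m z k. 0) (\<lambda>z k. 0) (\<lambda>z k. 0) z k + (0 + Rest G (\<lambda>m z k. 0) x e z k) + Quad x z k"
      using LL_add[where x = "\<lambda>m z k. 0" and y = x and G = G and e = "\<lambda>z k. 0" and e' = e
        and w = "\<lambda>z k. 0" and w' = "\<lambda>z k. 0", OF Sb_zero x zk] by simp
    moreover have "LL G (\<lambda>m z k. 0) (\<lambda>z k. 0) (\<lambda>z k. 0) z k
      = 2 * (complex_of_real k * (complex_of_real k * (\<Sum>m<3. G m z * G m z))) + (2 * \<i>) * G 2 z"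
      by (simp add: LL_def Iop_zero sum_distrib_left mult_ac)
    ultimately show "(2 * (complex_of_real k * (complex_of_real k * (\<Sum>m<3. G m z * G m z))) + (2 * \<i>) * G 2 z)
      + Rest G (\<lambda>m z k. 0) x e z k + Quad x z k = LL G x e (\<lambda>z k. 0) z k" by simp
  qed
qed

text \<open>All that the estimates use of the tail: the operator contains the gradient of V but not
  its second z derivative.\<close>

definition tail_bound :: "sfun \<Rightarrow> real \<Rightarrow> bool" where
  "tail_bound V g \<longleftrightarrow> (\<forall>j\<le>N. \<forall>s\<le>N. V j s \<in> borel_measurable Mz \<and> dzs N \<xi> d 2 V 1 j s \<in> borel_measurable Mz \<and>
     (\<forall>z\<in>A. (cmod (V j s z))\<^sup>2 \<le> g \<and> (cmod (dzs N \<xi> d 2 V 1 j s z))\<^sup>2 \<le> g))"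

lemma gvec_Bd:
  assumes V: "tail_bound V g" and js: "1 \<le> j" "j < N" "1 \<le> s" "s < N" and m: "m < 3"
  shows "Bd 0 (\<lambda>z k. gvec V j s m z) (cJ * g)"
proof -
  have B: "Bd 0 (\<lambda>z k. V j s z) g" "Bd 0 (\<lambda>z k. dzs N \<xi> d 2 V 1 j s z) g" if "j \<le> N" "s \<le> N" for j s
    using V that measurable_compose[OF measurable_fst, of "V j s" Mz borel Mk]
      measurable_compose[OF measurable_fst, of "dzs N \<xi> d 2 V 1 j s" Mz borel Mk]
    by (auto simp: tail_bound_def Bd_def case_prod_unfold)
  have g: "0 \<le> g" using Bd_nonneg[OF B(1)[of 0 0]] by simp
  have mono: "Bd 0 u t \<Longrightarrow> t \<le> t' \<Longrightarrow> Bd 0 u t'" for u t t' unfolding Bd_def by (meson order_trans)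
  have df: "Bd 0 (\<lambda>z k. (1 / complex_of_real (2 * h)) * (u z k - v z k)) (cJ * g)" if "Bd 0 u g" "Bd 0 v g" for u v
  proof (rule mono[OF _ mult_right_mono[OF cJ_ge(1) g]])
    have b: "Bd 0 (\<lambda>z k. u z k - v z k) (4 * g)" using Bd_diff[OF that] by simp
    then have "(\<lambda>x. (1 / complex_of_real (2 * h)) * (case x of (z, k) \<Rightarrow> u z k - v z k)) \<in> borel_measurable \<nu>"
      by (intro borel_measurable_times borel_measurable_const) (simp add: Bd_def)
    moreover have "(cmod ((1 / complex_of_real (2 * h)) * (u z k - v z k)))\<^sup>2 \<le> 1 / h\<^sup>2 * g" if "z \<in> A" "k \<in> K" for z k
    proof -
      have "(cmod ((1 / complex_of_real (2 * h)) * (u z k - v z k)))\<^sup>2 = (cmod (u z k - v z k))\<^sup>2 / (4 * h\<^sup>2)"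
        using h_pos by (simp add: norm_divide norm_mult power_divide power_mult_distrib)
      also have "\<dots> \<le> (4 * g) / (4 * h\<^sup>2)"
        using b that by (intro divide_right_mono) (auto simp: Bd_def)
      finally show ?thesis by simp
    qed
    ultimately show "Bd 0 (\<lambda>z k. (1 / complex_of_real (2 * h)) * (u z k - v z k)) (1 / h\<^sup>2 * g)"
      by (simp add: Bd_def case_prod_unfold)
  qed
  have "m = 0 \<or> m = 1 \<or> m = 2" using m by auto
  then show ?thesis
  proof (elim disjE)
    assume "m = 0"
    moreover have "Bd 0 (\<lambda>z k. (1 / complex_of_real (2 * h)) * (V (j+1) s z - V (j-1) s z)) (cJ * g)"
      by (rule df) (use B js in auto)
    ultimately show ?thesis by (simp only: gvec_simps)
  next
    assume "m = 1"
    moreover have "Bd 0 (\<lambda>z k. (1 / complex_of_real (2 * h)) * (V j (s+1) z - V j (s-1) z)) (cJ * g)"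
      by (rule df) (use B js in auto)
    ultimately show ?thesis by (simp only: gvec_simps)
  next
    assume "m = 2"
    moreover have "Bd 0 (\<lambda>z k. dzs N \<xi> d 2 V 1 j s z) (cJ * g)"
      using mult_right_mono[OF cJ_ge(2) g] B(2)[of j s] js by (auto intro: mono)
    ultimately show ?thesis by (simp only: gvec_simps)
  qed
qed

lemma Lh_eq_LL:
  assumes D: "\<And>m. m < 3 \<Longrightarrow> Sb 0 (jet (dd q) j s m) a" and zk: "z \<in> A" "k \<in> K"
  shows "Lh N h \<xi> d kl ku V q j s z k
    = LL (gvec V j s) (jet (dd q) j s) (lp (dd q) j s) (dd q 2 j s) z k"
proof -
  let ?g = "\<lambda>\<kappa>. gradh h (\<lambda>j s. dd q 0 j s z \<kappa>) (\<lambda>j s. dd q 1 j s z \<kappa>) j s"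
  have c: "comp3 m (?g \<kappa>) = jet (dd q) j s m z \<kappa>" for m \<kappa> by (simp add: jet_def)
  have int: "integrable (intv k ku) ?g"
    by (rule comp3_integrable) (simp only: c, rule Sb_slice_integrable[OF D zk])
  have I: "comp3 m (LINT \<kappa>:{k..ku}|lborel. ?g \<kappa>) = Iop (jet (dd q) j s m) z k" for m
    unfolding set_integral_intv Iop_def c[symmetric]
    by (rule integral_bounded_linear[OF bounded_linear_comp3 int, symmetric])
  have Iz: "(LINT \<kappa>:{k..ku}|lborel. dd q 1 j s z \<kappa>) = Iop (jet (dd q) j s 2) z k"
    by (simp add: Iop_def jet_simps)
  have j2: "jet (dd q) j s 2 z k = dd q 1 j s z k" by (simp add: jet_simps)
  have g2: "gvec V j s 2 z = dzs N \<xi> d 2 V 1 j s z" by (simp add: gvec_simps)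
  have gm: "comp3 m (gradh h (\<lambda>j s. V j s z) (\<lambda>j s. dzs N \<xi> d 2 V 1 j s z) j s) = gvec V j s m z" for m
    by (simp add: gvec_def)
  have lpl: "laph h (\<lambda>j s. dd q 0 j s z k) (\<lambda>j s. dd q 2 j s z k) j s = dd q 2 j s z k + lp (dd q) j s z k"
    by (simp add: laph_def lp_def)
  show ?thesis
    unfolding Lh_def Let_def dot3_comp3 comp3_diff comp3_scaleR comp3_add I gm c lpl LL_def Iz
    unfolding j2 g2 scaleR_conv_of_real
    by (simp only: mult.assoc)
qed

section \<open>From the Sobolev norm to mixed bounds on jets\<close>

definition cS :: real where "cS = 2 / (d + \<xi>) + 2 * (d + \<xi>)"
definition cQ :: real where "cQ = cJ * (cS / h\<^sup>2)"

lemma cS_nonneg: "0 \<le> cS" using len_pos by (simp add: cS_def)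
lemma cQ_nonneg: "0 \<le> cQ" using cS_nonneg cJ_ge(4) by (simp add: cQ_def)

lemma HK_nodes_Sb:
  assumes D: "deriv2 q D" and js: "j \<le> N" "s \<le> N"
  shows "Sb 0 (D 0 j s) (cS / h\<^sup>2 * (nrm q)\<^sup>2)" "Sb 0 (D 1 j s) (cS / h\<^sup>2 * (nrm q)\<^sup>2)"
proof -
  note e = deriv2D[OF D js]
  have n: "nsq 0 (D r j s) \<le> (nrm q)\<^sup>2 / h\<^sup>2" if "r \<le> 2" for r
    using nsq_le_nrm[OF D js that] h_pos by (simp add: field_simps)
  have m: "2 / (d + \<xi>) * a + 2 * (d + \<xi>) * b \<le> cS / h\<^sup>2 * (nrm q)\<^sup>2"
    if "a \<le> (nrm q)\<^sup>2 / h\<^sup>2" "b \<le> (nrm q)\<^sup>2 / h\<^sup>2" for a b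
  proof -
    have "2 / (d + \<xi>) * a + 2 * (d + \<xi>) * b \<le> 2 / (d + \<xi>) * ((nrm q)\<^sup>2 / h\<^sup>2) + 2 * (d + \<xi>) * ((nrm q)\<^sup>2 / h\<^sup>2)"
      using that len_pos by (intro add_mono mult_left_mono) auto
    then show ?thesis by (simp add: cS_def algebra_simps add_divide_distrib)
  qed
  have sq1: "sqi Mz (\<lambda>z. D 1 j s z k)" if "k \<in> K" for k by (rule ac_on_sqi[OF e(3)[OF that]])
  show "Sb 0 (D 0 j s) (cS / h\<^sup>2 * (nrm q)\<^sup>2)"
    by (rule Sb_mono[OF Sb_sobolev[OF e(5,6,2) sq1] m]) (auto intro!: n simp del: One_nat_def)
  show "Sb 0 (D 1 j s) (cS / h\<^sup>2 * (nrm q)\<^sup>2)"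
    by (rule Sb_mono[OF Sb_sobolev[OF e(6,7,3,4)] m]) (auto intro!: n simp del: One_nat_def)
qed

lemma HK_jets_Sb:
  assumes D: "deriv2 q D" and js: "1 \<le> j" "j < N" "1 \<le> s" "s < N"
  shows "m < 3 \<Longrightarrow> Sb 0 (jet D j s m) (cQ * (nrm q)\<^sup>2)" "Sb 0 (lp D j s) (cQ * (nrm q)\<^sup>2)"
  using jet_Sb[where D = D and lam = 0 and a = "cS / h\<^sup>2 * (nrm q)\<^sup>2", OF _ js] HK_nodes_Sb[OF D]
  unfolding cQ_def mult.assoc by (metis zero_less_numeral)+

section \<open>The operator, its derivative and its quadratic part along derivative families\<close>

definition LD :: "sfun \<Rightarrow> (nat \<Rightarrow> kfun) \<Rightarrow> nat \<Rightarrow> nat \<Rightarrow> real \<Rightarrow> real \<Rightarrow> complex" where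
  "LD V D j s = LL (gvec V j s) (jet D j s) (lp D j s) (D 2 j s)"

definition BD :: "sfun \<Rightarrow> (nat \<Rightarrow> kfun) \<Rightarrow> (nat \<Rightarrow> kfun) \<Rightarrow> nat \<Rightarrow> nat \<Rightarrow> real \<Rightarrow> real \<Rightarrow> complex" where
  "BD V D E j s z k = E 2 j s z k + Rest (gvec V j s) (jet D j s) (jet E j s) (lp E j s) z k"

definition QD :: "(nat \<Rightarrow> kfun) \<Rightarrow> nat \<Rightarrow> nat \<Rightarrow> real \<Rightarrow> real \<Rightarrow> complex" where
  "QD E j s = Quad (jet E j s)"

lemma L2_add: "L2 u \<Longrightarrow> L2 v \<Longrightarrow> L2 (\<lambda>z k. u z k + v z k)"
  using sqi_add[of \<nu> "case_prod u" "case_prod v"] by (simp add: case_prod_unfold)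

lemma LD_L2:
  assumes V: "tail_bound V g" and D: "deriv2 q D" and js: "1 \<le> j" "j < N" "1 \<le> s" "s < N"
  shows "L2 (LD V D j s)"
    "(nrm q)\<^sup>2 \<le> M \<Longrightarrow> nsq 0 (LD V D j s) \<le> 2 * (M / h\<^sup>2) + 2 * ((d + \<xi>) * CB (cJ * g) (cQ * M))"
proof -
  have js': "j \<le> N" "s \<le> N" using js by auto
  have S: "Sb 0 (LL (gvec V j s) (jet D j s) (lp D j s) (\<lambda>z k. 0)) (CB (cJ * g) (cQ * M))" if "(nrm q)\<^sup>2 \<le> M" for M
    using Sb_mono[OF HK_jets_Sb(1)[OF D js]] Sb_mono[OF HK_jets_Sb(2)[OF D js]] mult_left_mono[OF that cQ_nonneg]
    by (intro LL_Sb gvec_Bd[OF V js]) auto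
  note S0 = S[OF order_refl]
  have eq: "LD V D j s = (\<lambda>z k. D 2 j s z k + LL (gvec V j s) (jet D j s) (lp D j s) (\<lambda>z k. 0) z k)"
    by (simp add: LD_def LL_def fun_eq_iff)
  have L: "L2 (D 2 j s)" by (rule deriv2D(7)[OF D js'])
  show "L2 (LD V D j s)" unfolding eq by (intro L2_add L Sb_L2(1)[OF S0])
  have "nsq 0 (LD V D j s) \<le> 2 * nsq 0 (D 2 j s) + 2 * nsq 0 (LL (gvec V j s) (jet D j s) (lp D j s) (\<lambda>z k. 0))"
    unfolding eq by (intro nsq_add L Sb_L2(1)[OF S0])
  moreover assume M: "(nrm q)\<^sup>2 \<le> M"
  moreover have "nsq 0 (D 2 j s) \<le> M / h\<^sup>2"
    using order_trans[OF nsq_le_nrm[OF D js', of 2] M] h_pos by (simp add: field_simps)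
  ultimately show "nsq 0 (LD V D j s) \<le> 2 * (M / h\<^sup>2) + 2 * ((d + \<xi>) * CB (cJ * g) (cQ * M))"
    using Sb_L2(2)[OF S[OF M]] by linarith
qed

lemma BD_L2:
  assumes V: "tail_bound V g" and D: "deriv2 q D" and E: "deriv2 r E" and js: "1 \<le> j" "j < N" "1 \<le> s" "s < N"
  shows "L2 (BD V D E j s)"
    "nsq 0 (BD V D E j s) \<le> (2 / h\<^sup>2 + 2 * ((d + \<xi>) * (CR (cJ * g) (cQ * (nrm q)\<^sup>2) * cQ))) * (nrm r)\<^sup>2"
proof -
  have js': "j \<le> N" "s \<le> N" using js by auto
  have S: "Sb 0 (Rest (gvec V j s) (jet D j s) (jet E j s) (lp E j s)) (CR (cJ * g) (cQ * (nrm q)\<^sup>2) * (cQ * (nrm r)\<^sup>2))"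
    by (rule Rest_Sb[OF gvec_Bd[OF V js] HK_jets_Sb(1)[OF D js] HK_jets_Sb[OF E js]])
  have eq: "BD V D E j s = (\<lambda>z k. E 2 j s z k + Rest (gvec V j s) (jet D j s) (jet E j s) (lp E j s) z k)"
    by (simp add: BD_def fun_eq_iff)
  have L: "L2 (E 2 j s)" by (rule deriv2D(7)[OF E js'])
  show "L2 (BD V D E j s)" unfolding eq by (intro L2_add L Sb_L2(1)[OF S])
  have "nsq 0 (BD V D E j s) \<le> 2 * nsq 0 (E 2 j s) + 2 * nsq 0 (Rest (gvec V j s) (jet D j s) (jet E j s) (lp E j s))"
    unfolding eq by (intro nsq_add L Sb_L2(1)[OF S])
  moreover have "nsq 0 (E 2 j s) \<le> (nrm r)\<^sup>2 / h\<^sup>2"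
    using nsq_le_nrm[OF E js', of 2] h_pos by (simp add: field_simps)
  ultimately have "nsq 0 (BD V D E j s) \<le> 2 * ((nrm r)\<^sup>2 / h\<^sup>2) + 2 * ((d + \<xi>) * (CR (cJ * g) (cQ * (nrm q)\<^sup>2) * (cQ * (nrm r)\<^sup>2)))"
    using Sb_L2(2)[OF S] by linarith
  then show "nsq 0 (BD V D E j s) \<le> (2 / h\<^sup>2 + 2 * ((d + \<xi>) * (CR (cJ * g) (cQ * (nrm q)\<^sup>2) * cQ))) * (nrm r)\<^sup>2"
    by (simp add: algebra_simps)
qed

definition cD :: real where "cD = (d + \<xi>) * (4 * (ku\<^sup>2 * (10 * (\<kappa>0 * cC * cQ))))"

lemma cD_nonneg: "0 \<le> cD"
  using len_pos ku_ge cC_nonneg cQ_nonneg by (auto simp: cD_def intro!: mult_nonneg_nonneg)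

text \<open>One factor is measured by the norm of r, the other by a bound t still to be chosen. A
  weighted t that decays like \<open>1 / lam\<close> serves convexity; t proportional to
  \<open>(nrm r)\<^sup>2\<close> with lam = 0 gives the fourth-order bound for
  differentiability.\<close>

lemma QD_L2:
  assumes E: "deriv2 r E" and js: "1 \<le> j" "j < N" "1 \<le> s" "s < N"
    and y: "\<And>m. m < 3 \<Longrightarrow> Sb lam (jet E j s m) t"
  shows "L2 (QD E j s)" "nsq lam (QD E j s) \<le> cD * (nrm r)\<^sup>2 * t"
proof -
  have S: "Sb lam (QD E j s) (4 * (ku\<^sup>2 * (10 * ((\<kappa>0 * t) * (cC * (cQ * (nrm r)\<^sup>2))))))"
    unfolding QD_def by (rule Quad_Sb[OF y HK_jets_Sb(1)[OF E js]])
  show "L2 (QD E j s)" by (rule Sb_L2(1)[OF S])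
  show "nsq lam (QD E j s) \<le> cD * (nrm r)\<^sup>2 * t"
    using Sb_L2(2)[OF S] by (simp add: cD_def mult_ac)
qed

lemma jet_add: "jet (\<lambda>i j s z k. D i j s z k + E i j s z k) j s = (\<lambda>m z k. jet D j s m z k + jet E j s m z k)"
  by (auto simp: jet_def comp3_def gradh_def fun_eq_iff algebra_simps add_divide_distrib diff_divide_distrib)

lemma lp_add: "lp (\<lambda>i j s z k. D i j s z k + E i j s z k) j s = (\<lambda>z k. lp D j s z k + lp E j s z k)"
  by (auto simp: lp_def laph_def fun_eq_iff algebra_simps add_divide_distrib diff_divide_distrib)

lemma jet_scale: "jet (\<lambda>i j s z k. c * D i j s z k) j s = (\<lambda>m z k. c * jet D j s m z k)"
  by (auto simp: jet_def comp3_def gradh_def fun_eq_iff algebra_simps diff_divide_distrib)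

lemma lp_scale: "lp (\<lambda>i j s z k. c * D i j s z k) j s = (\<lambda>z k. c * lp D j s z k)"
  by (auto simp: lp_def laph_def fun_eq_iff algebra_simps add_divide_distrib diff_divide_distrib)

lemma LD_add:
  assumes D: "deriv2 q D" and E: "deriv2 r E" and js: "1 \<le> j" "j < N" "1 \<le> s" "s < N" and zk: "z \<in> A" "k \<in> K"
  shows "LD V (\<lambda>i j s z k. D i j s z k + E i j s z k) j s z k = LD V D j s z k + BD V D E j s z k + QD E j s z k"
  unfolding LD_def BD_def QD_def jet_add lp_add
  by (rule LL_add[OF HK_jets_Sb(1)[OF D js] HK_jets_Sb(1)[OF E js] zk])

lemma BD_add:
  assumes E: "deriv2 r E" and E': "deriv2 r' E'" and js: "1 \<le> j" "j < N" "1 \<le> s" "s < N" and zk: "z \<in> A" "k \<in> K"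
  shows "BD V D (\<lambda>i j s z k. E i j s z k + E' i j s z k) j s z k = BD V D E j s z k + BD V D E' j s z k"
proof -
  have I: "Iop (\<lambda>z k. jet E j s m z k + jet E' j s m z k) z k = Iop (jet E j s m) z k + Iop (jet E' j s m) z k" if "m < 3" for m
    by (rule Iop_add[OF HK_jets_Sb(1)[OF E js that] HK_jets_Sb(1)[OF E' js that] zk])
  show ?thesis
    unfolding BD_def jet_add lp_add Rest_def sum_lessThan_3 using I[of 0] I[of 1] I[of 2]
    by (simp add: algebra_simps)
qed

lemma BD_scale: "BD V D (\<lambda>i j s z k. c * E i j s z k) j s z k = c * BD V D E j s z k"
  unfolding BD_def jet_scale lp_scale Rest_def sum_lessThan_3 Iop_cmult
  by (simp add: algebra_simps)

lemma jets_cong: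
  assumes D: "deriv2 f D" and E: "deriv2 f E" and js: "1 \<le> j" "j < N" "1 \<le> s" "s < N" and zk: "z \<in> A" "k \<in> K"
  shows "jet D j s m z k = jet E j s m z k" "lp D j s z k = lp E j s z k" "Iop (jet D j s m) z k = Iop (jet E j s m) z k"
proof -
  note u = deriv2_unique(1,2)[OF D E _ _ refl]
  have j: "jet D j s m z k = jet E j s m z k" if "k \<in> K" for k
    unfolding jet_def comp3_def gradh_def using u zk(1) that js by (simp del: One_nat_def)
  show "lp D j s z k = lp E j s z k"
    unfolding lp_def laph_def using u zk js by (simp del: One_nat_def)
  show "jet D j s m z k = jet E j s m z k" by (rule j[OF zk(2)])
  show "Iop (jet D j s m) z k = Iop (jet E j s m) z k" by (rule Iop_cong) (use j zk(2) in auto)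
qed

text \<open>All lower order terms agree at every point of the box; the second derivative alone
  restricts the equality to almost every point.\<close>

lemma LD_cong_AE:
  assumes D: "deriv2 f D" and E: "deriv2 f E" and js: "1 \<le> j" "j < N" "1 \<le> s" "s < N"
  shows "AE x in \<nu>. LD V D j s (fst x) (snd x) = LD V E j s (fst x) (snd x)"
proof -
  have "AE x in \<nu>. D 2 j s (fst x) (snd x) = E 2 j s (fst x) (snd x)"
    by (rule deriv2_AE_unique[OF D E]) (use js in auto)
  then show ?thesis
    using AE_space
  proof eventually_elim
    case (elim x)
    then have "fst x \<in> A" "snd x \<in> K" by auto
    note c = jets_cong[OF D E js this]
    show ?case unfolding LD_def LL_def c using elim by simp
  qed
qed

lemma BD_cong_AE:
  assumes D: "deriv2 f D" and E: "deriv2 f E" and js: "1 \<le> j" "j < N" "1 \<le> s" "s < N"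
  shows "AE x in \<nu>. BD V C D j s (fst x) (snd x) = BD V C E j s (fst x) (snd x)"
proof -
  have "AE x in \<nu>. D 2 j s (fst x) (snd x) = E 2 j s (fst x) (snd x)"
    by (rule deriv2_AE_unique[OF D E]) (use js in auto)
  then show ?thesis
    using AE_space
  proof eventually_elim
    case (elim x)
    then have "fst x \<in> A" "snd x \<in> K" by auto
    note c = jets_cong[OF D E js this]
    show ?case unfolding BD_def Rest_def c using elim by simp
  qed
qed

section \<open>Weighted scalar product and the functional in terms of derivative families\<close>

definition wip :: "real \<Rightarrow> (real \<Rightarrow> real \<Rightarrow> complex) \<Rightarrow> (real \<Rightarrow> real \<Rightarrow> complex) \<Rightarrow> real" where
  "wip lam u v = (\<integral>(z,k). Re (u z k * cnj (v z k)) * wgt lam z \<partial>\<nu>)"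

lemma wip_integrable:
  assumes "L2 u" "L2 v"
  shows "integrable \<nu> (\<lambda>(z,k). Re (u z k * cnj (v z k)) * wgt lam z)"
  using integrable_wgt[OF rip_integrable[OF assms]] by (simp add: case_prod_unfold)

lemma wip_cong_AE:
  assumes "L2 u" "L2 v" "L2 v'" "AE x in \<nu>. v (fst x) (snd x) = v' (fst x) (snd x)"
  shows "wip lam u v = wip lam u v'"
  unfolding wip_def
proof (rule integral_cong_AE)
  show "AE x in \<nu>. (case x of (z, k) \<Rightarrow> Re (u z k * cnj (v z k)) * wgt lam z) = (case x of (z, k) \<Rightarrow> Re (u z k * cnj (v' z k)) * wgt lam z)"
    using assms(4) by eventually_elim (simp add: case_prod_unfold)
qed (use wip_integrable[OF assms(1,2)] wip_integrable[OF assms(1,3)] in auto)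

lemma nsq_cong_AE:
  assumes "L2 u" "L2 v" "AE x in \<nu>. u (fst x) (snd x) = v (fst x) (snd x)"
  shows "nsq lam u = nsq lam v"
  unfolding nsq_def
proof (rule integral_cong_AE)
  show "AE x in \<nu>. (case x of (z, k) \<Rightarrow> (cmod (u z k))\<^sup>2 * wgt lam z) = (case x of (z, k) \<Rightarrow> (cmod (v z k))\<^sup>2 * wgt lam z)"
    using assms(3) by eventually_elim (simp add: case_prod_unfold)
qed (use nsq_integrable[OF assms(1)] nsq_integrable[OF assms(2)] in auto)

lemma wip_add_right:
  assumes "L2 u" "L2 v" "L2 w"
  shows "wip lam u (\<lambda>z k. v z k + w z k) = wip lam u v + wip lam u w"
proof -
  have "wip lam u (\<lambda>z k. v z k + w z k) = (\<integral>x. (case x of (z,k) \<Rightarrow> Re (u z k * cnj (v z k)) * wgt lam z)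
      + (case x of (z,k) \<Rightarrow> Re (u z k * cnj (w z k)) * wgt lam z) \<partial>\<nu>)"
    unfolding wip_def by (intro Bochner_Integration.integral_cong) (auto simp: algebra_simps)
  then show ?thesis using wip_integrable[OF assms(1,2)] wip_integrable[OF assms(1,3)] by (simp add: wip_def)
qed

lemma wip_scale_right: "wip lam u (\<lambda>z k. complex_of_real c * v z k) = c * wip lam u v"
proof -
  have "wip lam u (\<lambda>z k. complex_of_real c * v z k) = (\<integral>x. c * (case x of (z,k) \<Rightarrow> Re (u z k * cnj (v z k)) * wgt lam z) \<partial>\<nu>)"
    unfolding wip_def by (intro Bochner_Integration.integral_cong) (auto simp: algebra_simps)
  then show ?thesis by (simp add: wip_def)
qed

lemma nsq_expand:
  assumes a: "L2 a" and b: "L2 b"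
  shows "nsq lam (\<lambda>z k. a z k + b z k) = nsq lam a + 2 * wip lam a b + nsq lam b"
proof -
  have "(cmod (x + y))\<^sup>2 = (cmod x)\<^sup>2 + 2 * Re (x * cnj y) + (cmod y)\<^sup>2" for x y
    by (simp add: cmod_power2) (simp add: power2_eq_square algebra_simps)
  then have "nsq lam (\<lambda>z k. a z k + b z k) = (\<integral>x. (case x of (z,k) \<Rightarrow> (cmod (a z k))\<^sup>2 * wgt lam z)
      + 2 * (case x of (z,k) \<Rightarrow> Re (a z k * cnj (b z k)) * wgt lam z) + (case x of (z,k) \<Rightarrow> (cmod (b z k))\<^sup>2 * wgt lam z) \<partial>\<nu>)"
    unfolding nsq_def by (intro Bochner_Integration.integral_cong) (auto simp: algebra_simps)
  then show ?thesis
    using nsq_integrable[OF a] nsq_integrable[OF b] wip_integrable[OF a b] by (simp add: nsq_def wip_def)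
qed

lemma wip_le:
  assumes u: "L2 u" and v: "L2 v"
  shows "\<bar>wip lam u v\<bar> \<le> sqrt (nsq lam u) * sqrt (nsq lam v)"
proof -
  have "(\<bar>wip lam u v\<bar>)\<^sup>2 \<le> nsq lam u * nsq lam v"
  proof (rule amgm_sq_bound)
    fix t :: real assume t: "0 < t"
    have e: "nsq lam (\<lambda>z k. complex_of_real c * u z k + v z k) = c\<^sup>2 * nsq lam u + 2 * c * wip lam u v + nsq lam v" for c
    proof -
      have "L2 (\<lambda>z k. complex_of_real c * u z k)" using sqi_cmult[OF u] by (simp add: case_prod_unfold)
      moreover have "wip lam (\<lambda>z k. complex_of_real c * u z k) v = c * wip lam u v"
      proof -
        have "wip lam (\<lambda>z k. complex_of_real c * u z k) v = (\<integral>x. c * (case x of (z,k) \<Rightarrow> Re (u z k * cnj (v z k)) * wgt lam z) \<partial>\<nu>)"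
          unfolding wip_def by (intro Bochner_Integration.integral_cong) (auto simp: algebra_simps)
        then show ?thesis by (simp add: wip_def)
      qed
      ultimately show ?thesis using v by (simp add: nsq_expand nsq_cmult)
    qed
    have 1: "0 \<le> t\<^sup>2 * nsq lam u + 2 * t * wip lam u v + nsq lam v" unfolding e[symmetric] by (rule nsq_nonneg)
    have 2: "0 \<le> t\<^sup>2 * nsq lam u - 2 * t * wip lam u v + nsq lam v" using e[of "-t"] nsq_nonneg[of lam "\<lambda>z k. complex_of_real (-t) * u z k + v z k"] by simp
    have "t * \<bar>wip lam u v\<bar> * 2 \<le> t\<^sup>2 * nsq lam u + nsq lam v" using 1 2 by (cases "0 \<le> wip lam u v") (auto simp: mult_ac)
    then show "\<bar>wip lam u v\<bar> \<le> (t * nsq lam u + nsq lam v / t) / 2"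
      using t by (simp add: field_simps power2_eq_square)
  qed (auto simp: nsq_nonneg)
  then have "\<bar>wip lam u v\<bar> \<le> sqrt (nsq lam u * nsq lam v)" by (rule real_le_rsqrt)
  then show ?thesis by (simp add: real_sqrt_mult)
qed

text \<open>Independence of the chosen derivatives allows the sum of the families of
  \<open>p + F\<close> and r to be used for the shifted argument.\<close>

lemma Jfun_eq:
  assumes V: "tail_bound V g" and pF: "kadd p F \<in> HK" and D: "deriv2 (kadd p F) D"
  shows "Jfun N h \<xi> d kl ku V F lam p = exp (2 * lam * d) *
    (\<Sum>j\<in>{1..<N}. \<Sum>s\<in>{1..<N}. h\<^sup>2 * nsq lam (LD V D j s))"
  unfolding Jfun_def
proof (intro arg_cong2[where f = "(*)"] refl sum.cong)
  fix j s assume "j \<in> {1..<N}" "s \<in> {1..<N}"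
  then have js: "1 \<le> j" "j < N" "1 \<le> s" "s < N" by auto
  let ?q = "kadd p F"
  note Dq = deriv2_dd[OF pF]
  note L = LD_L2(1)[OF V Dq js]
  have eq: "Lh N h \<xi> d kl ku V ?q j s z k = LD V (dd ?q) j s z k" if "z \<in> A" "k \<in> K" for z k
    unfolding LD_def by (rule Lh_eq_LL[OF HK_jets_Sb(1)[OF Dq js] that])
  have i: "integrable \<nu> (\<lambda>(z,k). (cmod (LD V (dd ?q) j s z k))\<^sup>2 * wgt lam z)" by (rule nsq_integrable[OF L])
  have "(LINT \<kappa>:{kl..ku}|lborel. LINT z:{-\<xi>..d}|lborel. (cmod (Lh N h \<xi> d kl ku V ?q j s z \<kappa>))\<^sup>2 * wgt lam z)
    = (LINT \<kappa>:{kl..ku}|lborel. LINT z:{-\<xi>..d}|lborel. (cmod (LD V (dd ?q) j s z \<kappa>))\<^sup>2 * wgt lam z)"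
    unfolding set_integral_intv using eq by (intro Bochner_Integration.integral_cong refl) auto
  also have "\<dots> = nsq lam (LD V (dd ?q) j s)"
    unfolding nsq_def by (rule box_iterated_integral[OF i])
  also have "\<dots> = nsq lam (LD V D j s)"
    by (rule nsq_cong_AE[OF L LD_L2(1)[OF V D js] LD_cong_AE[OF Dq D js]])
  finally show "(LINT \<kappa>:{kl..ku}|lborel. LINT z:{-\<xi>..d}|lborel. (cmod (Lh N h \<xi> d kl ku V ?q j s z \<kappa>))\<^sup>2 * wgt lam z) = nsq lam (LD V D j s)" .
qed

section \<open>Differentiability of the functional\<close>

definition lin :: "sfun \<Rightarrow> real \<Rightarrow> kfun \<Rightarrow> kfun \<Rightarrow> real" where
  "lin V lam q r = exp (2 * lam * d) *
     (\<Sum>j\<in>{1..<N}. \<Sum>s\<in>{1..<N}. h\<^sup>2 * (2 * wip lam (LD V (dd q) j s) (BD V (dd q) (dd r) j s)))"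

definition remainder :: "sfun \<Rightarrow> real \<Rightarrow> kfun \<Rightarrow> kfun \<Rightarrow> nat \<Rightarrow> nat \<Rightarrow> real" where
  "remainder V lam q r j s = nsq lam (\<lambda>z k. BD V (dd q) (dd r) j s z k + QD (dd r) j s z k)
     + 2 * wip lam (LD V (dd q) j s) (QD (dd r) j s)"

lemma QD_L2_plain:
  assumes E: "deriv2 r E" and js: "1 \<le> j" "j < N" "1 \<le> s" "s < N"
  shows "L2 (QD E j s)" "nsq 0 (QD E j s) \<le> cD * (nrm r)\<^sup>2 * (cQ * (nrm r)\<^sup>2)"
  using QD_L2[OF E js HK_jets_Sb(1)[OF E js]] by auto

text \<open>\<open>BD + QD\<close> stays inside one square in the remainder. Convexity compares this
  square with the second derivative of r, while differentiability only needs it to be of second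
  order.\<close>

lemma Jfun_expand:
  assumes V: "tail_bound V g" and F: "F \<in> HK" and p: "p \<in> HK" and r: "r \<in> HK"
  shows "Jfun N h \<xi> d kl ku V F lam (kadd p r) - Jfun N h \<xi> d kl ku V F lam p - lin V lam (kadd p F) r
    = exp (2 * lam * d) * (\<Sum>j\<in>{1..<N}. \<Sum>s\<in>{1..<N}. h\<^sup>2 * remainder V lam (kadd p F) r j s)"
proof -
  let ?q = "kadd p F"
  have q: "?q \<in> HK" by (rule kadd_HK[OF p F])
  have eq: "kadd (kadd p r) F = kadd ?q r" by (auto simp: kadd_def fun_eq_iff)
  note D = deriv2_dd[OF q] and E = deriv2_dd[OF r]
  let ?D = "dd ?q" and ?E = "dd r"
  let ?S = "\<lambda>i j s z k. ?D i j s z k + ?E i j s z k"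
  have S: "deriv2 (kadd (kadd p r) F) ?S" unfolding eq by (rule deriv2_add[OF D E])
  have "Jfun N h \<xi> d kl ku V F lam (kadd p r) = exp (2 * lam * d) *
    (\<Sum>j\<in>{1..<N}. \<Sum>s\<in>{1..<N}. h\<^sup>2 * nsq lam (LD V ?S j s))"
    by (rule Jfun_eq[OF V deriv2_HK[OF S] S])
  also have "\<dots> = exp (2 * lam * d) * (\<Sum>j\<in>{1..<N}. \<Sum>s\<in>{1..<N}.
      h\<^sup>2 * nsq lam (LD V ?D j s) + h\<^sup>2 * (2 * wip lam (LD V ?D j s) (BD V ?D ?E j s)) + h\<^sup>2 * remainder V lam ?q r j s)"
  proof (intro arg_cong2[where f = "(*)"] refl sum.cong)
    fix j s assume "j \<in> {1..<N}" "s \<in> {1..<N}"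
    then have js: "1 \<le> j" "j < N" "1 \<le> s" "s < N" by auto
    note L = LD_L2(1)[OF V D js] and B = BD_L2(1)[OF V D E js] and Q = QD_L2_plain(1)[OF E js]
    have "nsq lam (LD V ?S j s) = nsq lam (\<lambda>z k. LD V ?D j s z k + (BD V ?D ?E j s z k + QD ?E j s z k))"
      unfolding nsq_def
      by (intro Bochner_Integration.integral_cong refl) (auto simp: LD_add[OF D E js] add.assoc)
    also have "\<dots> = nsq lam (LD V ?D j s) + 2 * wip lam (LD V ?D j s) (BD V ?D ?E j s) + remainder V lam ?q r j s"
      by (simp add: nsq_expand[OF L L2_add[OF B Q]] wip_add_right[OF L B Q] remainder_def)
    finally show "h\<^sup>2 * nsq lam (LD V ?S j s) = h\<^sup>2 * nsq lam (LD V ?D j s)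
      + h\<^sup>2 * (2 * wip lam (LD V ?D j s) (BD V ?D ?E j s)) + h\<^sup>2 * remainder V lam ?q r j s"
      by (simp add: algebra_simps)
  qed
  also have "\<dots> = Jfun N h \<xi> d kl ku V F lam p + lin V lam ?q r
     + exp (2 * lam * d) * (\<Sum>j\<in>{1..<N}. \<Sum>s\<in>{1..<N}. h\<^sup>2 * remainder V lam ?q r j s)"
    unfolding Jfun_eq[OF V q D] lin_def by (simp add: sum.distrib distrib_left)
  finally show ?thesis by simp
qed

lemma lin_add:
  assumes V: "tail_bound V g" and q: "q \<in> HK" and r: "r \<in> HK" and r': "r' \<in> HK"
  shows "lin V lam q (kadd r r') = lin V lam q r + lin V lam q r'"
proof -
  note D = deriv2_dd[OF q] and E = deriv2_dd[OF r] and E' = deriv2_dd[OF r']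
  let ?S = "\<lambda>i j s z k. dd r i j s z k + dd r' i j s z k"
  note S = deriv2_add[OF E E'] and U = deriv2_dd[OF kadd_HK[OF r r']]
  have "wip lam (LD V (dd q) j s) (BD V (dd q) (dd (kadd r r')) j s)
    = wip lam (LD V (dd q) j s) (BD V (dd q) (dd r) j s) + wip lam (LD V (dd q) j s) (BD V (dd q) (dd r') j s)"
    if js: "1 \<le> j" "j < N" "1 \<le> s" "s < N" for j s
  proof -
    note L = LD_L2(1)[OF V D js] and B = BD_L2(1)[OF V D _ js]
    have "wip lam (LD V (dd q) j s) (BD V (dd q) (dd (kadd r r')) j s) = wip lam (LD V (dd q) j s) (BD V (dd q) ?S j s)"
      by (rule wip_cong_AE[OF L B[OF U] B[OF S] BD_cong_AE[OF U S js]])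
    also have "\<dots> = wip lam (LD V (dd q) j s) (\<lambda>z k. BD V (dd q) (dd r) j s z k + BD V (dd q) (dd r') j s z k)"
      unfolding wip_def
    proof (intro Bochner_Integration.integral_cong refl)
      fix x assume "x \<in> space \<nu>"
      then obtain z k where x: "x = (z, k)" "z \<in> A" "k \<in> K" by auto
      show "(case x of (z, k) \<Rightarrow> Re (LD V (dd q) j s z k * cnj (BD V (dd q) ?S j s z k)) * wgt lam z)
        = (case x of (z, k) \<Rightarrow> Re (LD V (dd q) j s z k * cnj (BD V (dd q) (dd r) j s z k + BD V (dd q) (dd r') j s z k)) * wgt lam z)"
        unfolding x(1) prod.case BD_add[OF E E' js x(2,3)] ..
    qed
    finally show ?thesis by (simp add: wip_add_right[OF L B[OF E] B[OF E']])
  qed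
  then have "h\<^sup>2 * (2 * wip lam (LD V (dd q) j s) (BD V (dd q) (dd (kadd r r')) j s))
     = h\<^sup>2 * (2 * wip lam (LD V (dd q) j s) (BD V (dd q) (dd r) j s)) + h\<^sup>2 * (2 * wip lam (LD V (dd q) j s) (BD V (dd q) (dd r') j s))"
    if "j \<in> {1..<N}" "s \<in> {1..<N}" for j s
    using that by (simp add: distrib_left)
  then have "(\<Sum>j\<in>{1..<N}. \<Sum>s\<in>{1..<N}. h\<^sup>2 * (2 * wip lam (LD V (dd q) j s) (BD V (dd q) (dd (kadd r r')) j s)))
    = (\<Sum>j\<in>{1..<N}. \<Sum>s\<in>{1..<N}. h\<^sup>2 * (2 * wip lam (LD V (dd q) j s) (BD V (dd q) (dd r) j s)))
    + (\<Sum>j\<in>{1..<N}. \<Sum>s\<in>{1..<N}. h\<^sup>2 * (2 * wip lam (LD V (dd q) j s) (BD V (dd q) (dd r') j s)))"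
    unfolding sum.distrib[symmetric] by (intro sum.cong refl)
  then show ?thesis
    unfolding lin_def by (simp only: distrib_left)
qed

lemma lin_scale:
  assumes V: "tail_bound V g" and q: "q \<in> HK" and r: "r \<in> HK"
  shows "lin V lam q (kscale c r) = c * lin V lam q r"
proof -
  note D = deriv2_dd[OF q] and E = deriv2_dd[OF r]
  note S = deriv2_scale[OF E, of c] and U = deriv2_dd[OF kscale_HK[OF r, of c]]
  have "h\<^sup>2 * (2 * wip lam (LD V (dd q) j s) (BD V (dd q) (dd (kscale c r)) j s))
    = c * (h\<^sup>2 * (2 * wip lam (LD V (dd q) j s) (BD V (dd q) (dd r) j s)))"
    if "j \<in> {1..<N}" "s \<in> {1..<N}" for j s
  proof -
    have js: "1 \<le> j" "j < N" "1 \<le> s" "s < N" using that by auto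
    note L = LD_L2(1)[OF V D js] and B = BD_L2(1)[OF V D _ js]
    have "wip lam (LD V (dd q) j s) (BD V (dd q) (dd (kscale c r)) j s)
        = wip lam (LD V (dd q) j s) (BD V (dd q) (\<lambda>i j s z k. complex_of_real c * dd r i j s z k) j s)"
      by (rule wip_cong_AE[OF L B[OF U] B[OF S] BD_cong_AE[OF U S js]])
    also have "\<dots> = wip lam (LD V (dd q) j s) (\<lambda>z k. complex_of_real c * BD V (dd q) (dd r) j s z k)"
      unfolding wip_def by (simp only: BD_scale)
    finally show ?thesis by (simp add: wip_scale_right)
  qed
  then have "(\<Sum>j\<in>{1..<N}. \<Sum>s\<in>{1..<N}. h\<^sup>2 * (2 * wip lam (LD V (dd q) j s) (BD V (dd q) (dd (kscale c r)) j s)))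
    = c * (\<Sum>j\<in>{1..<N}. \<Sum>s\<in>{1..<N}. h\<^sup>2 * (2 * wip lam (LD V (dd q) j s) (BD V (dd q) (dd r) j s)))"
    unfolding sum_distrib_left by (intro sum.cong refl)
  then show ?thesis
    unfolding lin_def by (simp only: mult.left_commute)
qed

text \<open>For differentiability lam is fixed, so the weight may be bounded crudely by a constant
  exponential in \<open>\<bar>lam\<bar>\<close>; no such loss is admissible for convexity.\<close>

definition wmax :: "real \<Rightarrow> real" where
  "wmax lam = exp (2 * \<bar>lam\<bar> * (\<bar>-\<xi>\<bar> + \<bar>d\<bar>))"

lemma nsq_le_wmax: "L2 u \<Longrightarrow> nsq lam u \<le> wmax lam * nsq 0 u"
  by (rule nsq_mono) (simp_all only: wgt_0 mult_1_right wmax_def wgt_bounds)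

lemma wmax_pos: "0 < wmax lam" by (simp add: wmax_def)

text \<open>A constant uniform in r is found at each node separately; the grid is finite, so the
  constants can be added.\<close>

lemma sum_abs_uniform_bound:
  fixes f :: "'a \<Rightarrow> nat \<Rightarrow> nat \<Rightarrow> real"
  assumes "\<And>j s. j \<in> {1..<N} \<Longrightarrow> s \<in> {1..<N} \<Longrightarrow> \<exists>C\<ge>0. \<forall>r\<in>R. \<bar>f r j s\<bar> \<le> C * b r"
    and c: "0 \<le> (c::real)"
  shows "\<exists>C\<ge>0. \<forall>r\<in>R. \<bar>c * (\<Sum>j\<in>{1..<N}. \<Sum>s\<in>{1..<N}. f r j s)\<bar> \<le> C * b r"
proof -
  have "\<forall>x. \<exists>C. x \<in> {1..<N} \<times> {1..<N} \<longrightarrow> 0 \<le> C \<and> (\<forall>r\<in>R. \<bar>f r (fst x) (snd x)\<bar> \<le> C * b r)"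
    using assms(1) by force
  then obtain C where C: "\<And>x. x \<in> {1..<N} \<times> {1..<N} \<Longrightarrow> 0 \<le> C x \<and> (\<forall>r\<in>R. \<bar>f r (fst x) (snd x)\<bar> \<le> C x * b r)"
    by metis
  show ?thesis
  proof (intro exI[of _ "c * (\<Sum>x\<in>{1..<N} \<times> {1..<N}. C x)"] conjI ballI)
    show "0 \<le> c * (\<Sum>x\<in>{1..<N} \<times> {1..<N}. C x)" using c C by (intro mult_nonneg_nonneg sum_nonneg) auto
    fix r assume r: "r \<in> R"
    have "\<bar>\<Sum>x\<in>{1..<N} \<times> {1..<N}. f r (fst x) (snd x)\<bar> \<le> (\<Sum>x\<in>{1..<N} \<times> {1..<N}. C x * b r)"
      using C r by (intro order_trans[OF sum_abs] sum_mono) blast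
    then show "\<bar>c * (\<Sum>j\<in>{1..<N}. \<Sum>s\<in>{1..<N}. f r j s)\<bar> \<le> c * (\<Sum>x\<in>{1..<N} \<times> {1..<N}. C x) * b r"
      using c by (simp add: sum.cartesian_product abs_mult case_prod_unfold sum_distrib_right mult.assoc mult_left_mono)
  qed
qed

lemma lin_bounded:
  assumes V: "tail_bound V g" and q: "q \<in> HK"
  shows "\<exists>C\<ge>0. \<forall>r\<in>HK. \<bar>lin V lam q r\<bar> \<le> C * nrm r"
  unfolding lin_def
proof (rule sum_abs_uniform_bound)
  fix j s assume "j \<in> {1..<N}" "s \<in> {1..<N}"
  then have js: "1 \<le> j" "j < N" "1 \<le> s" "s < N" by auto
  note D = deriv2_dd[OF q]
  note L = LD_L2(1)[OF V D js]
  let ?b = "2 / h\<^sup>2 + 2 * ((d + \<xi>) * (CR (cJ * g) (cQ * (nrm q)\<^sup>2) * cQ))"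
  let ?C = "2 * h\<^sup>2 * (sqrt (nsq lam (LD V (dd q) j s)) * sqrt (wmax lam * \<bar>?b\<bar>))"
  show "\<exists>C\<ge>0. \<forall>r\<in>HK. \<bar>h\<^sup>2 * (2 * wip lam (LD V (dd q) j s) (BD V (dd q) (dd r) j s))\<bar> \<le> C * nrm r"
  proof (intro exI[of _ ?C] conjI ballI)
    show "0 \<le> ?C" by (intro mult_nonneg_nonneg real_sqrt_ge_zero) (auto simp: nsq_nonneg wmax_pos less_imp_le)
    fix r assume r: "r \<in> HK"
    note E = deriv2_dd[OF r]
    note B = BD_L2[OF V D E js]
    have n: "0 \<le> nrm r" using ip_nonneg[OF r] by (simp add: nrm_eq)
    have b0: "nsq 0 (BD V (dd q) (dd r) j s) \<le> \<bar>?b\<bar> * (nrm r)\<^sup>2"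
      by (rule order_trans[OF B(2) mult_right_mono[OF abs_ge_self]]) simp
    have "nsq lam (BD V (dd q) (dd r) j s) \<le> wmax lam * (\<bar>?b\<bar> * (nrm r)\<^sup>2)"
      by (rule order_trans[OF nsq_le_wmax[OF B(1)] mult_left_mono[OF b0 less_imp_le[OF wmax_pos]]])
    then have "sqrt (nsq lam (BD V (dd q) (dd r) j s)) \<le> sqrt (wmax lam * (\<bar>?b\<bar> * (nrm r)\<^sup>2))" by (rule real_sqrt_le_mono)
    also have "\<dots> = sqrt (wmax lam * \<bar>?b\<bar>) * nrm r" using n by (simp add: real_sqrt_mult)
    finally have "\<bar>wip lam (LD V (dd q) j s) (BD V (dd q) (dd r) j s)\<bar> \<le> sqrt (nsq lam (LD V (dd q) j s)) * (sqrt (wmax lam * \<bar>?b\<bar>) * nrm r)"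
      by (intro order_trans[OF wip_le[OF L B(1)]] mult_left_mono) (simp_all add: nsq_nonneg)
    then have "h\<^sup>2 * 2 * \<bar>wip lam (LD V (dd q) j s) (BD V (dd q) (dd r) j s)\<bar> \<le> h\<^sup>2 * 2 * (sqrt (nsq lam (LD V (dd q) j s)) * (sqrt (wmax lam * \<bar>?b\<bar>) * nrm r))"
      by (rule mult_left_mono) simp
    then show "\<bar>h\<^sup>2 * (2 * wip lam (LD V (dd q) j s) (BD V (dd q) (dd r) j s))\<bar> \<le> ?C * nrm r"
      by (simp add: abs_mult mult_ac)
  qed
qed simp

text \<open>The quadratic part of the operator enters the cross term to the first power and the
  square to the second, hence the powers two and four of the norm.\<close>

lemma remainder_bounded:
  assumes V: "tail_bound V g" and q: "q \<in> HK"
  shows "\<exists>C\<ge>0. \<forall>r\<in>HK. \<bar>exp (2 * lam * d) * (\<Sum>j\<in>{1..<N}. \<Sum>s\<in>{1..<N}. h\<^sup>2 * remainder V lam q r j s)\<bar> \<le> C * ((nrm r)\<^sup>2 + (nrm r)^4)"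
proof (rule sum_abs_uniform_bound)
  fix j s assume "j \<in> {1..<N}" "s \<in> {1..<N}"
  then have js: "1 \<le> j" "j < N" "1 \<le> s" "s < N" by auto
  note D = deriv2_dd[OF q]
  note L = LD_L2(1)[OF V D js]
  let ?b = "\<bar>2 / h\<^sup>2 + 2 * ((d + \<xi>) * (CR (cJ * g) (cQ * (nrm q)\<^sup>2) * cQ))\<bar>"
  let ?c = "cD * cQ"
  let ?l = "sqrt (nsq lam (LD V (dd q) j s))"
  let ?C = "h\<^sup>2 * (2 * wmax lam * ?b + 2 * wmax lam * ?c + 2 * (?l * sqrt (wmax lam * ?c)))"
  have c: "0 \<le> ?c" using cD_nonneg cQ_nonneg by simp
  have w: "0 \<le> wmax lam" using wmax_pos less_imp_le by blast
  show "\<exists>C\<ge>0. \<forall>r\<in>HK. \<bar>h\<^sup>2 * remainder V lam q r j s\<bar> \<le> C * ((nrm r)\<^sup>2 + (nrm r)^4)"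
  proof (intro exI[of _ ?C] conjI ballI)
    show "0 \<le> ?C" using c w by (auto intro!: mult_nonneg_nonneg add_nonneg_nonneg simp: nsq_nonneg)
    fix r assume r: "r \<in> HK"
    note E = deriv2_dd[OF r]
    note B = BD_L2[OF V D E js] and Q = QD_L2_plain[OF E js]
    let ?n2 = "(nrm r)\<^sup>2" and ?n4 = "(nrm r)^4"
    have n4: "?n2 * ?n2 = ?n4" by (simp add: power4_eq_xxxx power2_eq_square)
    have b0: "nsq 0 (BD V (dd q) (dd r) j s) \<le> ?b * ?n2"
      by (rule order_trans[OF B(2) mult_right_mono[OF abs_ge_self]]) simp
    have b: "nsq lam (BD V (dd q) (dd r) j s) \<le> wmax lam * (?b * ?n2)"
      by (rule order_trans[OF nsq_le_wmax[OF B(1)] mult_left_mono[OF b0 w]])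
    have "cD * ?n2 * (cQ * ?n2) = ?c * ?n4" unfolding n4[symmetric] by (simp only: mult_ac)
    then have "nsq 0 (QD (dd r) j s) \<le> ?c * ?n4" using Q(2) by metis
    then have c4: "nsq lam (QD (dd r) j s) \<le> wmax lam * (?c * ?n4)"
      by (rule order_trans[OF nsq_le_wmax[OF Q(1)] mult_left_mono[OF _ w]])
    have "sqrt (nsq lam (QD (dd r) j s)) \<le> sqrt (wmax lam * (?c * ?n4))" using c4 by (rule real_sqrt_le_mono)
    also have "\<dots> = sqrt (wmax lam * ?c) * ?n2"
    proof -
      have "sqrt ?n4 = ?n2" by (rule real_sqrt_unique) simp_all
      then show ?thesis by (simp add: real_sqrt_mult)
    qed
    finally have wi: "\<bar>wip lam (LD V (dd q) j s) (QD (dd r) j s)\<bar> \<le> ?l * (sqrt (wmax lam * ?c) * ?n2)"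
      by (intro order_trans[OF wip_le[OF L Q(1)]] mult_left_mono) (simp_all add: nsq_nonneg)
    have "nsq lam (\<lambda>z k. BD V (dd q) (dd r) j s z k + QD (dd r) j s z k) \<le> 2 * (wmax lam * (?b * ?n2)) + 2 * (wmax lam * (?c * ?n4))"
      using nsq_add[OF B(1) Q(1), of lam] b c4 by linarith
    then have "\<bar>remainder V lam q r j s\<bar> \<le> 2 * (wmax lam * (?b * ?n2)) + 2 * (wmax lam * (?c * ?n4)) + 2 * (?l * (sqrt (wmax lam * ?c) * ?n2))"
      unfolding remainder_def using wi nsq_nonneg[of lam "\<lambda>z k. BD V (dd q) (dd r) j s z k + QD (dd r) j s z k"] by linarith
    also have "\<dots> \<le> (2 * wmax lam * ?b + 2 * wmax lam * ?c + 2 * (?l * sqrt (wmax lam * ?c))) * (?n2 + ?n4)"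
    proof -
      have "x * n + y * m + v * n \<le> (x + y + v) * (n + m)" if "0 \<le> x" "0 \<le> y" "0 \<le> v" "0 \<le> n" "0 \<le> m" for x y v n m :: real
      proof -
        have "0 \<le> x * m + y * n + v * m" using that by simp
        then show ?thesis by (simp add: algebra_simps)
      qed
      from this[of "2 * wmax lam * ?b" "2 * wmax lam * ?c" "2 * (?l * sqrt (wmax lam * ?c))" ?n2 ?n4]
      show ?thesis using c w by (simp add: mult.assoc nsq_nonneg)
    qed
    finally have "h\<^sup>2 * \<bar>remainder V lam q r j s\<bar> \<le> h\<^sup>2 * ((2 * wmax lam * ?b + 2 * wmax lam * ?c + 2 * (?l * sqrt (wmax lam * ?c))) * (?n2 + ?n4))"
      by (rule mult_left_mono) simp
    then show "\<bar>h\<^sup>2 * remainder V lam q r j s\<bar> \<le> ?C * (?n2 + ?n4)"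
      by (simp add: abs_mult mult.assoc)
  qed
qed simp

lemma nrm_nonneg: "r \<in> HK \<Longrightarrow> 0 \<le> nrm r"
  using ip_nonneg by (simp add: nrm_eq)

lemma frechet_of_representer:
  assumes V: "tail_bound V g" and F: "F \<in> HK" and p: "p \<in> H0" and G: "G \<in> H0"
    and rep: "\<And>r. r \<in> H0 \<Longrightarrow> ip G r = lin V lam (kadd p F) r"
  shows "frechet_H02 N h \<xi> d kl ku (Jfun N h \<xi> d kl ku V F lam) p G"
  unfolding frechet_H02_def
proof (intro conjI G allI impI)
  fix e :: real assume e: "0 < e"
  have q: "kadd p F \<in> HK" by (rule kadd_HK[OF H0_HK[OF p] F])
  from remainder_bounded[OF V q, of lam] obtain C where C: "0 \<le> C" and
    bd: "\<And>r. r \<in> HK \<Longrightarrow> \<bar>exp (2 * lam * d) * (\<Sum>j\<in>{1..<N}. \<Sum>s\<in>{1..<N}. h\<^sup>2 * remainder V lam (kadd p F) r j s)\<bar> \<le> C * ((nrm r)\<^sup>2 + (nrm r)^4)"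
    by blast
  \<comment> \<open>Below norm 1 the quartic term is absorbed by the quadratic one, leaving at most
    \<open>2 * C\<close> times the squared norm; the extra 1 allows C = 0.\<close>
  let ?\<eta> = "min 1 (e / (2 * C + 1))"
  show "\<exists>\<eta>>0. \<forall>r\<in>H0. nrm r < \<eta> \<longrightarrow> \<bar>Jfun N h \<xi> d kl ku V F lam (kadd p r) - Jfun N h \<xi> d kl ku V F lam p - ip G r\<bar> \<le> e * nrm r"
  proof (intro exI[of _ ?\<eta>] conjI ballI impI)
    show "0 < ?\<eta>" using e C by simp
    fix r assume r: "r \<in> H0" and n: "nrm r < ?\<eta>"
    have rk: "r \<in> HK" by (rule H0_HK[OF r])
    let ?n = "nrm r"
    have n0: "0 \<le> ?n" by (rule nrm_nonneg[OF rk])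
    have "\<bar>Jfun N h \<xi> d kl ku V F lam (kadd p r) - Jfun N h \<xi> d kl ku V F lam p - ip G r\<bar> \<le> C * (?n\<^sup>2 + ?n^4)"
      unfolding rep[OF r] Jfun_expand[OF V F H0_HK[OF p] rk] by (rule bd[OF rk])
    also have "\<dots> \<le> C * (?n + ?n) * ?n"
    proof -
      have "?n^4 \<le> ?n\<^sup>2" using n n0 by (intro power_decreasing) auto
      then have "?n\<^sup>2 + ?n^4 \<le> (?n + ?n) * ?n" by (simp add: power2_eq_square algebra_simps)
      then show ?thesis using C by (simp add: mult.assoc mult_left_mono)
    qed
    also have "\<dots> \<le> e * ?n"
    proof (rule mult_right_mono[OF _ n0])
      have "(2 * C + 1) * ?n \<le> e" using n C by (simp add: field_simps)
      then show "C * (?n + ?n) \<le> e" using n0 by (simp add: algebra_simps)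
    qed
    finally show "\<bar>Jfun N h \<xi> d kl ku V F lam (kadd p r) - Jfun N h \<xi> d kl ku V F lam p - ip G r\<bar> \<le> e * nrm r" .
  qed
qed

lemma representer_exists:
  assumes V: "tail_bound V g" and F: "F \<in> HK" and p: "p \<in> H0"
  shows "\<exists>G\<in>H0. \<forall>r\<in>H0. ip G r = lin V lam (kadd p F) r"
proof -
  have q: "kadd p F \<in> HK" by (rule kadd_HK[OF H0_HK[OF p] F])
  from lin_bounded[OF V q, of lam] obtain C where "\<And>r. r \<in> HK \<Longrightarrow> \<bar>lin V lam (kadd p F) r\<bar> \<le> C * nrm r" by blast
  then show ?thesis
    by (intro H0_riesz[where C = C] lin_add[OF V q] lin_scale[OF V q] H0_HK) (auto intro: H0_HK)
qed

lemma nrm_kscale: "r \<in> HK \<Longrightarrow> nrm (kscale c r) = \<bar>c\<bar> * nrm r"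
proof -
  assume r: "r \<in> HK"
  have "ip (kscale c r) (kscale c r) = c * (c * ip r r)"
    using ip_scale_left[OF r kscale_HK[OF r], of c c] ip_scale_left[OF r r, of c] ip_sym[of r "kscale c r"] by simp
  then show ?thesis by (simp add: nrm_eq real_sqrt_mult mult.assoc[symmetric] flip: power2_eq_square)
qed

text \<open>The convexity statement concerns any element satisfying the Frechet condition, so each
  must act like the representer constructed here. Testing on small multiples of r suffices, since
  both sides are homogeneous.\<close>

lemma frechet_unique:
  assumes G: "frechet_H02 N h \<xi> d kl ku J p G" and G': "frechet_H02 N h \<xi> d kl ku J p G'" and r: "r \<in> H0"
  shows "ip G r = ip G' r"
proof -
  have mem: "G \<in> H0" "G' \<in> H0" using G G' by (auto simp: frechet_H02_def)
  have rk: "r \<in> HK" by (rule H0_HK[OF r])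
  let ?n = "nrm r"
  have n0: "0 \<le> ?n" by (rule nrm_nonneg[OF rk])
  have le: "\<bar>ip G r - ip G' r\<bar> \<le> 2 * e * ?n" if e: "0 < e" for e
  proof -
    obtain \<eta> where \<eta>: "0 < \<eta>" and 1: "\<And>r. r \<in> H0 \<Longrightarrow> nrm r < \<eta> \<Longrightarrow> \<bar>J (kadd p r) - J p - ip G r\<bar> \<le> e * nrm r"
      using G e unfolding frechet_H02_def by blast
    obtain \<eta>' where \<eta>': "0 < \<eta>'" and 2: "\<And>r. r \<in> H0 \<Longrightarrow> nrm r < \<eta>' \<Longrightarrow> \<bar>J (kadd p r) - J p - ip G' r\<bar> \<le> e * nrm r"
      using G' e unfolding frechet_H02_def by blast
    \<comment> \<open>The added 1 covers r of norm zero and makes the norm of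
      \<open>kscale t r\<close> strictly smaller than both thresholds.\<close>
    define t where "t = min \<eta> \<eta>' / (?n + 1)"
    have t: "0 < t" using \<eta> \<eta>' n0 by (simp add: t_def)
    have "t * ?n < t * (?n + 1)" using t by simp
    also have "\<dots> = min \<eta> \<eta>'" using n0 by (simp add: t_def)
    finally have tn: "nrm (kscale t r) < min \<eta> \<eta>'" using t by (simp add: nrm_kscale[OF rk])
    have k: "kscale t r \<in> H0" by (rule kscale_H0[OF r])
    have "\<bar>ip G (kscale t r) - ip G' (kscale t r)\<bar> \<le> 2 * e * nrm (kscale t r)"
      using 1[OF k] 2[OF k] tn by linarith
    moreover have "ip X (kscale t r) = t * ip X r" if "X \<in> H0" for X
      using ip_scale_left[OF rk H0_HK[OF that], of t] by (simp add: ip_sym[of X])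
    ultimately have "t * \<bar>ip G r - ip G' r\<bar> \<le> t * (2 * e * ?n)"
      using mem t by (simp add: nrm_kscale[OF rk] right_diff_distrib[symmetric] abs_mult mult_ac)
    then show ?thesis using t by simp
  qed
  have "\<bar>ip G r - ip G' r\<bar> \<le> 0"
  proof (rule field_le_epsilon)
    fix e :: real assume e: "0 < e"
    have "2 * (e / (2 * (?n + 1))) * ?n \<le> e" using e n0 by (simp add: field_simps)
    then show "\<bar>ip G r - ip G' r\<bar> \<le> 0 + e" using le[of "e / (2 * (?n + 1))"] e n0 by simp
  qed
  then show ?thesis by simp
qed

section \<open>Strong convexity\<close>

text \<open>Young's inequality with the products grouped so that the weight meets the integrated
  factor I, whose weighted square is at most t, and the factor y. The factor a is left without
  weight.\<close>

lemma pointwise_cross_bound: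
  fixes a c :: complex and w k t :: real
  assumes "0 \<le> w" "0 \<le> k" "k \<le> ku" and I: "\<And>m. m < 3 \<Longrightarrow> w * (cmod (I m))\<^sup>2 \<le> t"
  shows "- 2 * (Re (a * cnj ((- 2) * (complex_of_real k * (\<Sum>m<3. I m * y m)))) * w)
     \<le> 2 * ku * (\<Sum>m<(3::nat). (cmod a)\<^sup>2 * t + (cmod (y m))\<^sup>2 * w)"
proof -
  have "- 2 * (Re (a * cnj ((- 2) * (complex_of_real k * (\<Sum>m<3. I m * y m)))) * w)
      \<le> 2 * (cmod (a * cnj ((- 2) * (complex_of_real k * (\<Sum>m<3. I m * y m)))) * w)"
  proof -
    have "- 2 * (Re u * w) \<le> 2 * (cmod u * w)" for u
    proof -
      have "- Re u \<le> cmod u" using abs_Re_le_cmod[of u] by linarith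
      from mult_right_mono[OF this assms(1)] show ?thesis by (simp add: mult.commute)
    qed
    then show ?thesis .
  qed
  also have "\<dots> = 4 * k * (cmod a * cmod (\<Sum>m<3. I m * y m) * w)"
    using assms(2) unfolding norm_mult complex_mod_cnj by (simp add: norm_mult)
  also have "\<dots> \<le> 4 * ku * (cmod a * (\<Sum>m<3. cmod (I m) * cmod (y m)) * w)"
  proof (intro mult_mono)
    show "cmod (\<Sum>m<3. I m * y m) \<le> (\<Sum>m<3. cmod (I m) * cmod (y m))"
      by (rule order_trans[OF norm_sum]) (simp add: norm_mult)
  qed (use assms in \<open>auto intro!: mult_nonneg_nonneg sum_nonneg\<close>)
  also have "\<dots> = 2 * ku * (\<Sum>m<3. 2 * (cmod a * cmod (I m)) * cmod (y m) * w)"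
    by (simp add: sum_lessThan_3 algebra_simps)
  also have "\<dots> \<le> 2 * ku * (\<Sum>m<3. (cmod a)\<^sup>2 * t + (cmod (y m))\<^sup>2 * w)"
  proof (intro mult_left_mono sum_mono)
    fix m :: nat assume "m \<in> {..<3}"
    then have m: "m < 3" by simp
    have "2 * (cmod a * cmod (I m)) * cmod (y m) * w \<le> ((cmod a * cmod (I m))\<^sup>2 + (cmod (y m))\<^sup>2) * w"
      using assms(1) by (intro mult_right_mono sum_squares_bound)
    also have "\<dots> = (cmod a)\<^sup>2 * (w * (cmod (I m))\<^sup>2) + (cmod (y m))\<^sup>2 * w"
      by (simp add: algebra_simps power_mult_distrib)
    also have "\<dots> \<le> (cmod a)\<^sup>2 * t + (cmod (y m))\<^sup>2 * w"
      using I[OF m] by (intro add_mono mult_left_mono) auto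
    finally show "2 * (cmod a * cmod (I m)) * cmod (y m) * w \<le> (cmod a)\<^sup>2 * t + (cmod (y m))\<^sup>2 * w" .
  qed (use assms in auto)
  finally show ?thesis .
qed

text \<open>Cauchy-Schwarz for the weighted scalar product would involve a weighted norm of a and
  yield only the square root of t; the pointwise grouping gives t itself and needs just the
  unweighted norm of a. The factor 6 counts three components twice.\<close>

lemma cross_term_bound:
  assumes L: "L2 a" and Q: "L2 (Quad y)" and y: "\<And>m. m < 3 \<Longrightarrow> Sb lam (y m) t"
  shows "- 2 * wip lam a (Quad y) \<le> 6 * ku * (\<kappa>0 * nsq 0 a + (d + \<xi>) * cC) * t"
proof -
  let ?c = "\<lambda>m z k. complex_of_real k * y m z k - Iop (y m) z k"
  have S: "Sb lam (?c m) (cC * t)" if "m < 3" for m by (rule shifted_Sb[OF y[OF that]])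
  note c = Sb_L2(1)[OF S] and cn = Sb_L2(2)[OF S]
  have I: "Bd lam (Iop (y m)) (\<kappa>0 * t)" if "m < 3" for m by (rule Bd_Iop[OF y[OF that]])
  have i1: "integrable \<nu> (\<lambda>(z,k). (cmod (a z k))\<^sup>2)"
    using sqi_integrable_sq[OF L] by (simp add: case_prod_unfold)
  have int: "integrable \<nu> (\<lambda>x. (cmod (a (fst x) (snd x)))\<^sup>2 * (\<kappa>0 * t) + (cmod (?c m (fst x) (snd x)))\<^sup>2 * wgt lam (fst x))"
    if "m < 3" for m
    using i1 nsq_integrable[OF c[OF that], of lam] by (intro Bochner_Integration.integrable_add) (simp_all add: case_prod_unfold)
  have "- 2 * wip lam a (Quad y) = (\<integral>x. - 2 * (case x of (z,k) \<Rightarrow> Re (a z k * cnj (Quad y z k)) * wgt lam z) \<partial>\<nu>)"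
    by (simp add: wip_def)
  also have "\<dots> \<le> (\<integral>x. 2 * ku * (\<Sum>m<3. (cmod (a (fst x) (snd x)))\<^sup>2 * (\<kappa>0 * t) + (cmod (?c m (fst x) (snd x)))\<^sup>2 * wgt lam (fst x)) \<partial>\<nu>)"
  proof (rule integral_mono)
    show "integrable \<nu> (\<lambda>x. - 2 * (case x of (z,k) \<Rightarrow> Re (a z k * cnj (Quad y z k)) * wgt lam z))"
      using wip_integrable[OF L Q, of lam] by simp
    show "integrable \<nu> (\<lambda>x. 2 * ku * (\<Sum>m<3. (cmod (a (fst x) (snd x)))\<^sup>2 * (\<kappa>0 * t) + (cmod (?c m (fst x) (snd x)))\<^sup>2 * wgt lam (fst x)))"
      by (rule integrable_mult_right[OF Bochner_Integration.integrable_sum[OF int]]) simp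
    fix x assume "x \<in> space \<nu>"
    then obtain z k where x: "x = (z, k)" "z \<in> A" "k \<in> K" by auto
    have "- 2 * (Re (a z k * cnj (Quad y z k)) * wgt lam z) \<le> 2 * ku * (\<Sum>m<3. (cmod (a z k))\<^sup>2 * (\<kappa>0 * t) + (cmod (?c m z k))\<^sup>2 * wgt lam z)"
      unfolding Quad_def
      by (rule pointwise_cross_bound) (use x(2,3) kl_pos I in \<open>auto simp: Bd_def\<close>)
    then show "- 2 * (case x of (z,k) \<Rightarrow> Re (a z k * cnj (Quad y z k)) * wgt lam z)
      \<le> 2 * ku * (\<Sum>m<3. (cmod (a (fst x) (snd x)))\<^sup>2 * (\<kappa>0 * t) + (cmod (?c m (fst x) (snd x)))\<^sup>2 * wgt lam (fst x))"
      unfolding x(1) prod.case fst_conv snd_conv .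
  qed
  also have "\<dots> = 2 * ku * (\<Sum>m<3. nsq 0 a * (\<kappa>0 * t) + nsq lam (?c m))"
  proof -
    have "(\<integral>x. (cmod (a (fst x) (snd x)))\<^sup>2 * (\<kappa>0 * t) + (cmod (?c m (fst x) (snd x)))\<^sup>2 * wgt lam (fst x) \<partial>\<nu>)
       = nsq 0 a * (\<kappa>0 * t) + nsq lam (?c m)" if "m < 3" for m
      using i1 nsq_integrable[OF c[OF that], of lam]
      by (subst Bochner_Integration.integral_add) (simp_all add: case_prod_unfold nsq_def)
    then show ?thesis
      using int by (subst integral_mult_right_zero) (simp add: Bochner_Integration.integral_sum)
  qed
  also have "\<dots> \<le> 2 * ku * (\<Sum>m<(3::nat). nsq 0 a * (\<kappa>0 * t) + (d + \<xi>) * (cC * t))"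
    using cn ku_pos by (intro mult_left_mono sum_mono add_left_mono) auto
  also have "\<dots> = 6 * ku * (\<kappa>0 * nsq 0 a + (d + \<xi>) * cC) * t"
    by (simp add: algebra_simps)
  finally show ?thesis .
qed

text \<open>The three summands come from the lower order linear part, the quadratic part and the
  cross term, each bounded by a multiple of the common jet bound; the last factor expresses that jet
  bound through \<open>X / lam\<close>.\<close>

definition C3 :: "real \<Rightarrow> real \<Rightarrow> real \<Rightarrow> real" where
  "C3 g Mq Mr = (2 * ((d + \<xi>) * CR (cJ * g) (cQ * Mq)) + 2 * (cD * Mr)
     + 6 * ku * (\<kappa>0 * (2 * (Mq / h\<^sup>2) + 2 * ((d + \<xi>) * CB (cJ * g) (cQ * Mq))) + (d + \<xi>) * cC)) * (cJ * (1 + (d + \<xi>)))"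

text \<open>The second derivative of r is \<open>(BD + QD) - (Rest + QD)\<close>, so the square in
  the remainder is at least half of its square minus the square of the lower order part. X sums over
  all nodes because differences at one node reach its neighbours.\<close>

lemma remainder_lower:
  assumes V: "tail_bound V g" and q: "q \<in> HK" "(nrm q)\<^sup>2 \<le> Mq" and r: "r \<in> H0" "(nrm r)\<^sup>2 \<le> Mr"
    and lam: "1 \<le> lam" and js: "1 \<le> j" "j < N" "1 \<le> s" "s < N"
    and X: "X = (\<Sum>j\<le>N. \<Sum>s\<le>N. nsq lam (dd r 2 j s))"
  shows "nsq lam (dd r 2 j s) / 2 - C3 g Mq Mr * (X / lam) \<le> remainder V lam q r j s"
proof -
  note D = deriv2_dd[OF q(1)] and E = deriv2_dd[OF H0_HK[OF r(1)]]
  let ?D = "dd q" and ?E = "dd r"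
  have js': "j \<le> N" "s \<le> N" using js by auto
  \<comment> \<open>A common bound for r and its z derivative: the latter is bounded by
    \<open>X / lam\<close>, the former by \<open>(d + \<xi>) * (X / lam)\<close>.\<close>
  define s0 where "s0 = (1 + (d + \<xi>)) * (X / lam)"
  have l0: "0 < lam" using lam by simp
  have XX: "nsq lam (?E 2 i l) \<le> X" if "i \<le> N" "l \<le> N" for i l
  proof -
    have "nsq lam (?E 2 i l) \<le> (\<Sum>s\<le>N. nsq lam (?E 2 i s))"
      using that nsq_nonneg by (intro member_le_sum) auto
    also have "\<dots> \<le> X" unfolding X
      using that nsq_nonneg by (intro member_le_sum[where f = "\<lambda>j. \<Sum>s\<le>N. nsq lam (?E 2 j s)"]) (auto intro!: sum_nonneg)
    finally show ?thesis .
  qed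
  have X0: "0 \<le> X" using XX[of 0 0] nsq_nonneg[of lam "?E 2 0 0"] by simp
  have nodes: "Sb lam (?E 0 i l) s0 \<and> Sb lam (?E 1 i l) s0" if il: "i \<le> N" "l \<le> N" for i l
  proof -
    let ?n = "nsq lam (?E 2 i l)" and ?m = "1 / (2 * lam)"
    note J = H0_jets[OF r(1) E il disjI1, of lam ?m]
    have m: "0 \<le> ?m" "?m \<le> 1 / lam" "?m \<le> 1" using lam by (auto simp: field_simps)
    have x: "?m * ?n \<le> X / lam"
      using mult_mono[OF m(2) XX[OF il]] nsq_nonneg l0 by simp
    have X0l: "0 \<le> X / lam" using X0 l0 by simp
    have "?m * ((d + \<xi>) * (?m * ?n)) \<le> 1 * ((d + \<xi>) * (X / lam))"
      using m x len_pos X0l by (intro mult_mono[of ?m] mult_left_mono) (auto simp: nsq_nonneg)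
    then have "?m * ((d + \<xi>) * (?m * ?n)) \<le> s0" using X0l by (simp add: s0_def algebra_simps)
    moreover have "?m * ?n \<le> s0"
      using x mult_nonneg_nonneg[OF less_imp_le[OF len_pos] X0l] unfolding s0_def by (simp add: algebra_simps)
    ultimately show ?thesis using Sb_mono[OF J(1)] Sb_mono[OF J(2)] l0 by simp
  qed
  define t where "t = cJ * s0"
  have jE: "Sb lam (jet ?E j s m) t" if "m < 3" for m
    unfolding t_def by (rule jet_Sb(1)[OF nodes js that])
  have lE: "Sb lam (lp ?E j s) t"
    unfolding t_def by (rule jet_Sb(2)[where m = 0, OF nodes js]) auto
  have t0: "0 \<le> t" by (rule Sb_nonneg[OF lE])
  have jD: "Sb 0 (jet ?D j s m) (cQ * Mq)" if "m < 3" for m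
    by (rule Sb_mono[OF HK_jets_Sb(1)[OF D js that] mult_left_mono[OF q(2) cQ_nonneg]])
  let ?R = "Rest (gvec V j s) (jet ?D j s) (jet ?E j s) (lp ?E j s)"
  have R: "Sb lam ?R (CR (cJ * g) (cQ * Mq) * t)"
    by (rule Rest_Sb[OF gvec_Bd[OF V js] jD jE lE])
  note RL = Sb_L2[OF R]
  have Q: "L2 (QD ?E j s)" and Qn: "nsq lam (QD ?E j s) \<le> cD * Mr * t"
  proof -
    show "L2 (QD ?E j s)" by (rule QD_L2(1)[OF E js jE])
    have "nsq lam (QD ?E j s) \<le> cD * (nrm r)\<^sup>2 * t" by (rule QD_L2(2)[OF E js jE])
    also have "\<dots> \<le> cD * Mr * t" using r(2) cD_nonneg t0 by (intro mult_right_mono mult_left_mono) auto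
    finally show "nsq lam (QD ?E j s) \<le> cD * Mr * t" .
  qed
  note B = BD_L2(1)[OF V D E js] and L = LD_L2(1)[OF V D js]
  have L0: "nsq 0 (LD V ?D j s) \<le> 2 * (Mq / h\<^sup>2) + 2 * ((d + \<xi>) * CB (cJ * g) (cQ * Mq))"
    by (rule LD_L2(2)[OF V D js q(2)])
  let ?BQ = "\<lambda>z k. BD V ?D ?E j s z k + QD ?E j s z k" and ?RQ = "\<lambda>z k. ?R z k + QD ?E j s z k"
  have "?E 2 j s = (\<lambda>z k. ?BQ z k + (-1) * ?RQ z k)" by (simp add: BD_def fun_eq_iff)
  moreover have "L2 (\<lambda>z k. (-1) * ?RQ z k)"
    using sqi_cmult[OF L2_add[OF RL(1) Q], of "-1"] by (simp add: case_prod_unfold)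
  ultimately have "nsq lam (?E 2 j s) \<le> 2 * nsq lam ?BQ + 2 * nsq lam (\<lambda>z k. (-1) * ?RQ z k)"
    using nsq_add[OF L2_add[OF B Q], of "\<lambda>z k. (-1) * ?RQ z k" lam] by simp
  also have "nsq lam (\<lambda>z k. (-1) * ?RQ z k) = nsq lam ?RQ"
    by (subst nsq_cmult) simp
  finally have 1: "nsq lam (?E 2 j s) \<le> 2 * nsq lam ?BQ + 2 * nsq lam ?RQ" .
  have 2: "nsq lam ?RQ \<le> 2 * ((d + \<xi>) * (CR (cJ * g) (cQ * Mq) * t)) + 2 * (cD * Mr * t)"
    using nsq_add[OF RL(1) Q, of lam] RL(2) Qn by linarith
  have "- 2 * wip lam (LD V ?D j s) (QD ?E j s) \<le> 6 * ku * (\<kappa>0 * nsq 0 (LD V ?D j s) + (d + \<xi>) * cC) * t"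
    unfolding QD_def by (rule cross_term_bound[OF L Q[unfolded QD_def] jE])
  also have "\<dots> \<le> 6 * ku * (\<kappa>0 * (2 * (Mq / h\<^sup>2) + 2 * ((d + \<xi>) * CB (cJ * g) (cQ * Mq))) + (d + \<xi>) * cC) * t"
    using L0 ku_pos ku_ge t0 by (intro mult_right_mono mult_left_mono add_right_mono) auto
  finally have 3: "- 2 * wip lam (LD V ?D j s) (QD ?E j s)
    \<le> 6 * ku * (\<kappa>0 * (2 * (Mq / h\<^sup>2) + 2 * ((d + \<xi>) * CB (cJ * g) (cQ * Mq))) + (d + \<xi>) * cC) * t" .
  have "C3 g Mq Mr * (X / lam) = 2 * ((d + \<xi>) * (CR (cJ * g) (cQ * Mq) * t)) + 2 * (cD * Mr * t)
     + 6 * ku * (\<kappa>0 * (2 * (Mq / h\<^sup>2) + 2 * ((d + \<xi>) * CB (cJ * g) (cQ * Mq))) + (d + \<xi>) * cC) * t"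
  proof -
    have "(2 * (x * y) + 2 * v + w) * t = 2 * (x * (y * t)) + 2 * (v * t) + w * t" for x y v w :: real
      by (simp add: algebra_simps)
    moreover have "C3 g Mq Mr * (X / lam) = (2 * ((d + \<xi>) * CR (cJ * g) (cQ * Mq)) + 2 * (cD * Mr)
     + 6 * ku * (\<kappa>0 * (2 * (Mq / h\<^sup>2) + 2 * ((d + \<xi>) * CB (cJ * g) (cQ * Mq))) + (d + \<xi>) * cC)) * t"
      unfolding C3_def t_def s0_def by (simp only: mult.assoc)
    ultimately show ?thesis by simp
  qed
  then show ?thesis unfolding remainder_def using 1 2 3 by linarith
qed

text \<open>Matches the sum over all nodes in the norm with the sum over interior nodes in the
  functional.\<close>

lemma sum_interior:
  fixes f :: "nat \<Rightarrow> nat \<Rightarrow> real"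
  assumes "\<And>j s. j \<le> N \<Longrightarrow> s \<le> N \<Longrightarrow> lateral j s \<Longrightarrow> f j s = 0"
  shows "(\<Sum>j\<le>N. \<Sum>s\<le>N. f j s) = (\<Sum>j\<in>{1..<N}. \<Sum>s\<in>{1..<N}. f j s)"
proof -
  have "(\<Sum>j\<le>N. \<Sum>s\<le>N. f j s) = (\<Sum>j\<in>{1..<N}. \<Sum>s\<le>N. f j s)"
  proof (rule sum.mono_neutral_right)
    show "\<forall>j\<in>{..N} - {1..<N}. (\<Sum>s\<le>N. f j s) = 0"
    proof (intro ballI sum.neutral)
      fix j s assume j: "j \<in> {..N} - {1..<N}" and "s \<in> {..N}"
      have "j = 0 \<or> j = N" using j by auto
      then show "f j s = 0" using \<open>s \<in> {..N}\<close> j by (intro assms) (auto simp: lateral_def)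
    qed
  qed auto
  also have "\<dots> = (\<Sum>j\<in>{1..<N}. \<Sum>s\<in>{1..<N}. f j s)"
  proof (rule sum.cong[OF refl], rule sum.mono_neutral_right)
    fix j assume j: "j \<in> {1..<N}"
    show "\<forall>s\<in>{..N} - {1..<N}. f j s = 0"
    proof
      fix s assume s: "s \<in> {..N} - {1..<N}"
      have "s = 0 \<or> s = N" using s by auto
      then show "f j s = 0" using j s by (intro assms) (auto simp: lateral_def)
    qed
  qed auto
  finally show ?thesis .
qed

text \<open>The prefactor \<open>exp (2 * lam * d)\<close> normalises the weight to be at least 1 on
  the interval. This keeps the convexity constant free of exponentials in lam.\<close>

lemma nsq_unweighted_le:
  assumes "L2 u" "0 \<le> lam"
  shows "nsq 0 u \<le> exp (2 * lam * d) * nsq lam u"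
proof (rule nsq_mono[OF assms(1)])
  fix z k assume "z \<in> A" "k \<in> K"
  then have "0 \<le> 2 * lam * (d - z)" using assms(2) by simp
  then have "1 \<le> exp (2 * lam * (d - z))" by simp
  then show "wgt 0 z \<le> exp (2 * lam * d) * wgt lam z" by (simp add: wgt_def mult_exp_exp algebra_simps)
qed

definition Cn :: real where "Cn = 1 + (d + \<xi>)\<^sup>2 + (d + \<xi>)^4"

lemma Cn_pos: "0 < Cn"
proof -
  have "0 \<le> (d + \<xi>)^4" by (rule zero_le_even_power) simp
  then show ?thesis unfolding Cn_def by (simp add: add_pos_nonneg)
qed

text \<open>The principal terms add up to \<open>X / 2\<close>; for lam above the stated threshold
  the errors of all \<open>(N - 1)\<^sup>2\<close> interior nodes take at most \<open>X / 4\<close>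
  of it. The bounds \<open>2 * R\<^sup>2 + 2 * MF\<close> and \<open>4 * R\<^sup>2\<close> are the
  squared norms of \<open>p + F\<close> and of r, the difference of two elements of the
  ball.\<close>

lemma strong_convexity:
  assumes V: "tail_bound V g" and F: "F \<in> HK" "(nrm F)\<^sup>2 \<le> MF"
    and p: "p \<in> H0" "nrm p \<le> R" and pr: "kadd p r \<in> H0" "nrm (kadd p r) \<le> R"
    and lam: "1 \<le> lam" "4 * (real (N - 1))\<^sup>2 * C3 g (2 * R\<^sup>2 + 2 * MF) (4 * R\<^sup>2) \<le> lam"
  shows "Jfun N h \<xi> d kl ku V F lam (kadd p r) - Jfun N h \<xi> d kl ku V F lam p - lin V lam (kadd p F) r
    \<ge> 1 / (4 * Cn) * (nrm r)\<^sup>2"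
    and "r \<in> H0"
proof -
  have req: "r = kadd (kadd p r) (kscale (-1) p)" by (auto simp: kadd_def kscale_def fun_eq_iff)
  show r: "r \<in> H0" by (subst req) (intro kadd_H0 pr(1) kscale_H0 p(1))
  note pk = H0_HK[OF p(1)] and rk = H0_HK[OF r] and prk = H0_HK[OF pr(1)]
  have p2: "(nrm p)\<^sup>2 \<le> R\<^sup>2" and pr2: "(nrm (kadd p r))\<^sup>2 \<le> R\<^sup>2"
    using p(2) pr(2) nrm_nonneg[OF pk] nrm_nonneg[OF prk] by (auto intro: power_mono)
  have q: "kadd p F \<in> HK" by (rule kadd_HK[OF pk F(1)])
  have q2: "(nrm (kadd p F))\<^sup>2 \<le> 2 * R\<^sup>2 + 2 * MF"
    using nrm_add_sq_le[OF pk F(1)] p2 F(2) by linarith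
  have "(nrm (kadd (kadd p r) (kscale (-1) p)))\<^sup>2 \<le> 2 * (nrm (kadd p r))\<^sup>2 + 2 * (nrm (kscale (-1) p))\<^sup>2"
    by (rule nrm_add_sq_le[OF prk kscale_HK[OF pk]])
  then have r2: "(nrm r)\<^sup>2 \<le> 4 * R\<^sup>2"
    unfolding req[symmetric] using p2 pr2 by (simp add: nrm_kscale[OF pk])
  let ?C = "C3 g (2 * R\<^sup>2 + 2 * MF) (4 * R\<^sup>2)"
  note E = deriv2_dd[OF rk]
  define X where "X = (\<Sum>j\<le>N. \<Sum>s\<le>N. nsq lam (dd r 2 j s))"
  have X0: "0 \<le> X" unfolding X_def by (intro sum_nonneg nsq_nonneg)
  have Xint: "X = (\<Sum>j\<in>{1..<N}. \<Sum>s\<in>{1..<N}. nsq lam (dd r 2 j s))"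
    unfolding X_def by (rule sum_interior) (rule H0_lateral[OF r E])
  have "X / 2 - (real (N - 1))\<^sup>2 * (?C * (X / lam)) = (\<Sum>j\<in>{1..<N}. \<Sum>s\<in>{1..<N}. nsq lam (dd r 2 j s) / 2 - ?C * (X / lam))"
    by (cases "N = 0") (simp_all add: sum_subtractf Xint sum_divide_distrib power2_eq_square mult.assoc of_nat_diff)
  also have "\<dots> \<le> (\<Sum>j\<in>{1..<N}. \<Sum>s\<in>{1..<N}. remainder V lam (kadd p F) r j s)"
    by (intro sum_mono remainder_lower[OF V q q2 r r2 lam(1) _ _ _ _ X_def]) auto
  finally have 1: "X / 2 - (real (N - 1))\<^sup>2 * (?C * (X / lam)) \<le> (\<Sum>j\<in>{1..<N}. \<Sum>s\<in>{1..<N}. remainder V lam (kadd p F) r j s)" .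
  have "((real (N - 1))\<^sup>2 * ?C) * (X / lam) \<le> (lam / 4) * (X / lam)"
    using lam X0 by (intro mult_right_mono) auto
  then have 2: "X / 4 \<le> (\<Sum>j\<in>{1..<N}. \<Sum>s\<in>{1..<N}. remainder V lam (kadd p F) r j s)"
    using 1 lam(1) by (simp add: mult.assoc)
  have "(nrm r)\<^sup>2 \<le> Cn * (\<Sum>j\<le>N. \<Sum>s\<le>N. h\<^sup>2 * nsq 0 (dd r 2 j s))"
    unfolding Cn_def by (rule H0_norm_le[OF r E])
  also have "\<dots> \<le> Cn * (\<Sum>j\<le>N. \<Sum>s\<le>N. h\<^sup>2 * (exp (2 * lam * d) * nsq lam (dd r 2 j s)))"
    using Cn_pos lam(1) by (intro mult_left_mono sum_mono nsq_unweighted_le deriv2D(7)[OF E]) auto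
  also have "\<dots> = 4 * Cn * (exp (2 * lam * d) * (h\<^sup>2 * (X / 4)))"
    by (simp add: X_def sum_distrib_left mult_ac)
  also have "\<dots> \<le> 4 * Cn * (exp (2 * lam * d) * (h\<^sup>2 * (\<Sum>j\<in>{1..<N}. \<Sum>s\<in>{1..<N}. remainder V lam (kadd p F) r j s)))"
    using Cn_pos 2 by (intro mult_left_mono) auto
  also have "\<dots> = 4 * Cn * (Jfun N h \<xi> d kl ku V F lam (kadd p r) - Jfun N h \<xi> d kl ku V F lam p - lin V lam (kadd p F) r)"
    unfolding Jfun_expand[OF V F(1) pk rk] by (simp add: sum_distrib_left)
  finally show "Jfun N h \<xi> d kl ku V F lam (kadd p r) - Jfun N h \<xi> d kl ku V F lam p - lin V lam (kadd p F) r
    \<ge> 1 / (4 * Cn) * (nrm r)\<^sup>2"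
    using Cn_pos by (simp add: field_simps)
qed

section \<open>The tail function\<close>

text \<open>Functions of \<open>z\<close> alone are regarded as constant in \<open>k\<close>, which multiplies every
  squared norm by \<open>ku - kl\<close>.\<close>

definition lift :: "sfun \<Rightarrow> kfun" where
  "lift f = (\<lambda>j s z k. f j s z)"

abbreviation "ds \<equiv> dzs N \<xi> d 2"
abbreviation "lds f \<equiv> (\<lambda>i. lift (ds f i))"

lemma nsq_const:
  assumes u: "u \<in> borel_measurable Mz" and i: "integrable Mz (\<lambda>z. (cmod (u z))\<^sup>2)"
  shows "L2 (\<lambda>z k. u z)" "nsq lam (\<lambda>z k. u z) = \<kappa>0 * (\<integral>z. (cmod (u z))\<^sup>2 * wgt lam z \<partial>Mz)"
proof -
  have m: "(\<lambda>x. u (fst x)) \<in> borel_measurable \<nu>" by (rule measurable_compose[OF measurable_fst u])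
  have "integrable \<nu> (\<lambda>x. (cmod (u (fst x)))\<^sup>2)"
  proof (rule zk.Fubini_integrable)
    show "integrable Mz (\<lambda>x. \<integral>y. norm ((cmod (u (fst (x, y))))\<^sup>2) \<partial>Mk)" using i by simp
  qed (use m in \<open>auto intro!: AE_I2\<close>)
  with m show L: "L2 (\<lambda>z k. u z)" by (simp add: sqi_def case_prod_unfold)
  have "nsq lam (\<lambda>z k. u z) = (\<integral>z. (\<integral>k. (cmod (u z))\<^sup>2 * wgt lam z \<partial>Mk) \<partial>Mz)"
    unfolding nsq_def using zk.integral_fst[of "\<lambda>z k. (cmod (u z))\<^sup>2 * wgt lam z"] nsq_integrable[OF L, of lam]
    by (simp add: case_prod_unfold)
  then show "nsq lam (\<lambda>z k. u z) = \<kappa>0 * (\<integral>z. (cmod (u z))\<^sup>2 * wgt lam z \<partial>Mz)" by (simp add: mult.assoc)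
qed

lemma Hs_derivs_lift:
  assumes "Hs_derivs N \<xi> d 2 f D"
  shows "deriv2 (lift f) (\<lambda>i. lift (D i))"
    "j \<le> N \<Longrightarrow> s \<le> N \<Longrightarrow> i \<le> 2 \<Longrightarrow> sqi Mz (D i j s)"
proof -
  have a: "(\<forall>z\<in>A. D 0 j s z = f j s z) \<and> ac_on (-\<xi>) d (D 0 j s) (D 1 j s) \<and> ac_on (-\<xi>) d (D 1 j s) (D 2 j s) \<and> sqi Mz (D 2 j s)"
    if "j \<le> N" "s \<le> N" for j s
    using assms that unfolding Hs_derivs_def zchain_ac_on all_less_2 by (simp add: numeral_2_eq_2)
  have sq: "sqi Mz (D i j s)" if "j \<le> N" "s \<le> N" "i \<le> 2" for i j s
  proof -
    have "i = 0 \<or> i = 1 \<or> i = 2" using that(3) by auto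
    then show ?thesis using a[OF that(1,2)] ac_on_sqi by blast
  qed
  then show "j \<le> N \<Longrightarrow> s \<le> N \<Longrightarrow> i \<le> 2 \<Longrightarrow> sqi Mz (D i j s)" .
  have L: "L2 (\<lambda>z k. D i j s z)" if "j \<le> N" "s \<le> N" "i \<le> 2" for i j s
    using sq[OF that] by (intro nsq_const(1)) (auto simp: sqi_def)
  show "deriv2 (lift f) (\<lambda>i. lift (D i))"
    unfolding deriv2_iff lift_def using a L by (simp del: One_nat_def)
qed

lemma Hs_ds: "f \<in> Hs N \<xi> d 2 \<Longrightarrow> Hs_derivs N \<xi> d 2 f (ds f)"
proof -
  assume "f \<in> Hs N \<xi> d 2"
  then have "\<exists>D. Hs_derivs N \<xi> d 2 f D" by (simp add: Hs_def)
  then show ?thesis unfolding dzs_def by (rule someI_ex)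
qed

lemmas Hs_lift = Hs_derivs_lift(1)[OF Hs_ds]
lemmas Hs_sqi = Hs_derivs_lift(2)[OF Hs_ds]

lemma nsq_lds:
  assumes "f \<in> Hs N \<xi> d 2" "j \<le> N" "s \<le> N" "i \<le> 2"
  shows "nsq lam (lds f i j s) = \<kappa>0 * (\<integral>z. (cmod (ds f i j s z))\<^sup>2 * wgt lam z \<partial>Mz)"
  unfolding lift_def by (rule nsq_const(2)) (use Hs_sqi[OF assms] in \<open>auto simp: sqi_def\<close>)

lemma kappa0_pos: "0 < \<kappa>0" using kl_less by simp

lemma normHs_lift:
  assumes f: "f \<in> Hs N \<xi> d 2"
  shows "(nrm (lift f))\<^sup>2 = \<kappa>0 * (normHs N h \<xi> d 2 f)\<^sup>2"
proof -
  have "(normHs N h \<xi> d 2 f)\<^sup>2 = (\<Sum>j\<le>N. \<Sum>s\<le>N. \<Sum>r\<le>2. h\<^sup>2 * (\<integral>z. (cmod (ds f r j s z))\<^sup>2 \<partial>Mz))"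
    unfolding normHs_def set_integral_intv
    by (rule real_sqrt_pow2) (intro sum_nonneg mult_nonneg_nonneg integral_nonneg_AE; simp)
  then have "\<kappa>0 * (normHs N h \<xi> d 2 f)\<^sup>2 = (\<Sum>j\<le>N. \<Sum>s\<le>N. \<Sum>r\<le>2. h\<^sup>2 * (\<kappa>0 * (\<integral>z. (cmod (ds f r j s z))\<^sup>2 \<partial>Mz)))"
    by (simp add: sum_distrib_left mult.left_commute)
  also have "\<dots> = (\<Sum>j\<le>N. \<Sum>s\<le>N. \<Sum>r\<le>2. h\<^sup>2 * nsq 0 (lds f r j s))"
    by (intro sum.cong refl) (simp add: nsq_lds[OF f])
  also have "\<dots> = (nrm (lift f))\<^sup>2"
    using Hs_lift[OF f] by (simp add: nrm_sq[OF deriv2_HK] ip_self)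
  finally show ?thesis by simp
qed

lemma Hs_comb:
  assumes f: "f \<in> Hs N \<xi> d 2" and g: "g \<in> Hs N \<xi> d 2"
  shows "(\<lambda>j s z. f j s z + c * g j s z) \<in> Hs N \<xi> d 2"
proof -
  have "Hs_derivs N \<xi> d 2 (\<lambda>j s z. f j s z + c * g j s z) (\<lambda>i j s z. ds f i j s z + c * ds g i j s z)"
    using Hs_ds[OF f] Hs_ds[OF g] unfolding Hs_derivs_def zchain_ac_on all_less_2
    by (auto intro!: ac_on_add ac_on_cmult sqi_add sqi_cmult)
  then show ?thesis unfolding Hs_def by blast
qed

lemma Hs_sdiff: "f \<in> Hs N \<xi> d 2 \<Longrightarrow> g \<in> Hs N \<xi> d 2 \<Longrightarrow> sdiff f g \<in> Hs N \<xi> d 2"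
  using Hs_comb[of f g "-1"] by (simp add: sdiff_def)

lemma lift_sdiff: "lift (sdiff f g) = kadd (lift f) (kscale (-1) (lift g))"
  by (simp add: lift_def sdiff_def kadd_def kscale_def fun_eq_iff)

text \<open>Through this equivalence the tail problem inherits the jet bounds and closure properties
  of the k-dependent subspace.\<close>

lemma Hs0_iff_H0:
  assumes f: "f \<in> Hs N \<xi> d 2"
  shows "f \<in> Hs0 N \<xi> d \<longleftrightarrow> lift f \<in> H0"
proof -
  have K: "kl \<in> K" using kl_less by simp
  show ?thesis
  proof
    assume a: "f \<in> Hs0 N \<xi> d"
    show "lift f \<in> H0"
      unfolding H0_iff[OF Hs_lift[OF f]]
    proof (intro allI impI ballI conjI)
      fix j s k z assume js: "j \<le> N" "s \<le> N"
      show "lift f j s (-\<xi>) k = 0" "lift f j s d k = 0" "lds f 1 j s (-\<xi>) k = 0"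
        using a js by (auto simp: Hs0_def lift_def)
      assume "lateral j s" "z \<in> A"
      then show "lift f j s z k = 0" using a js unfolding Hs0_def lift_def lateral_def by blast
    qed
  next
    assume a: "lift f \<in> H0"
    have b: "(lateral j s \<longrightarrow> (\<forall>z\<in>A. f j s z = 0)) \<and> f j s (-\<xi>) = 0 \<and> f j s d = 0 \<and> ds f 1 j s (-\<xi>) = 0"
      if "j \<le> N" "s \<le> N" for j s
    proof -
      have "(lateral j s \<longrightarrow> (\<forall>z\<in>A. lift f j s z kl = 0)) \<and> lift f j s (-\<xi>) kl = 0 \<and> lift f j s d kl = 0 \<and> lds f 1 j s (-\<xi>) kl = 0"
        using a that K unfolding H0_iff[OF Hs_lift[OF f]] by blast
      then show ?thesis unfolding lift_def .
    qed
    then show "f \<in> Hs0 N \<xi> d"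
      unfolding Hs0_def mem_Collect_eq lateral_def using f by blast
  qed
qed

section \<open>The discrete Laplacian on lifted functions\<close>

definition lap :: "(nat \<Rightarrow> kfun) \<Rightarrow> nat \<Rightarrow> nat \<Rightarrow> real \<Rightarrow> real \<Rightarrow> complex" where
  "lap D j s z k = D 2 j s z k + lp D j s z k"

lemma lap_L2:
  assumes D: "deriv2 q D" and js: "1 \<le> j" "j < N" "1 \<le> s" "s < N"
  shows "L2 (lap D j s)" "nsq 0 (lap D j s) \<le> (2 / h\<^sup>2 + 2 * ((d + \<xi>) * cQ)) * (nrm q)\<^sup>2"
proof -
  have js': "j \<le> N" "s \<le> N" using js by auto
  note S = Sb_L2[OF HK_jets_Sb(2)[OF D js]]
  have eq: "lap D j s = (\<lambda>z k. D 2 j s z k + lp D j s z k)" by (simp add: lap_def fun_eq_iff)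
  have L: "L2 (D 2 j s)" by (rule deriv2D(7)[OF D js'])
  show "L2 (lap D j s)" unfolding eq by (intro L2_add L S(1))
  have "nsq 0 (lap D j s) \<le> 2 * nsq 0 (D 2 j s) + 2 * nsq 0 (lp D j s)"
    unfolding eq by (intro nsq_add L S(1))
  moreover have "nsq 0 (D 2 j s) \<le> (nrm q)\<^sup>2 / h\<^sup>2"
    using nsq_le_nrm[OF D js', of 2] h_pos by (simp add: field_simps)
  ultimately show "nsq 0 (lap D j s) \<le> (2 / h\<^sup>2 + 2 * ((d + \<xi>) * cQ)) * (nrm q)\<^sup>2"
    using S(2) by (simp add: algebra_simps)
qed

lemma lap_combine_AE:
  assumes D: "deriv2 f D" and E: "deriv2 g E" and U: "deriv2 (kadd f (kscale (-1) g)) U"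
    and js: "1 \<le> j" "j < N" "1 \<le> s" "s < N"
  shows "AE x in \<nu>. lap U j s (fst x) (snd x) = lap D j s (fst x) (snd x) - lap E j s (fst x) (snd x)"
proof -
  note C = deriv2_combine[OF D E]
  have "AE x in \<nu>. U 2 j s (fst x) (snd x) = D 2 j s (fst x) (snd x) - E 2 j s (fst x) (snd x)"
    using deriv2_AE_unique[OF U C, of j s 2] js by simp
  then show ?thesis
    using AE_space
  proof eventually_elim
    case (elim x)
    then have x: "fst x \<in> A" "snd x \<in> K" by auto
    have "lp (\<lambda>i j s z k. D i j s z k + (-1) * E i j s z k) j s z k = lp D j s z k + (-1) * lp E j s z k" for z k
      unfolding lp_add lp_scale by simp
    then show ?case unfolding lap_def jets_cong(2)[OF U C js x] using elim by simp
  qed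
qed

lemma lapS_eq:
  assumes f: "f \<in> Hs N \<xi> d 2" and js: "1 \<le> j" "j < N" "1 \<le> s" "s < N" and z: "z \<in> A"
  shows "lapS N h \<xi> d f j s z = lap (lds f) j s z k"
proof -
  have "ds f 0 i l z = f i l z" if "i \<le> N" "l \<le> N" for i l
    using Hs_ds[OF f] that z unfolding Hs_derivs_def by blast
  then show ?thesis using js by (simp add: lapS_def laph_def lap_def lp_def lift_def)
qed

lemma lapS_sqi:
  assumes f: "f \<in> Hs N \<xi> d 2" and js: "1 \<le> j" "j < N" "1 \<le> s" "s < N"
  shows "sqi Mz (lapS N h \<xi> d f j s)"
proof -
  have "sqi Mz (\<lambda>z. ds f 2 j s z + (1 / complex_of_real (h\<^sup>2)) *
    ((ds f 0 (j-1) s z + ds f 0 (j+1) s z) + (ds f 0 j (s-1) z + ds f 0 j (s+1) z) - 4 * ds f 0 j s z))"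
    by (intro sqi_add sqi_cmult sqi_diff Hs_sqi[OF f]) (use js in auto)
  also have "?this \<longleftrightarrow> ?thesis"
    by (rule sqi_cong) (simp only: space_intv lapS_eq[OF f js, where k = 0] lap_def lp_eq, simp only: lift_def)
  finally show ?thesis .
qed

lemma nsq_lapS:
  assumes f: "f \<in> Hs N \<xi> d 2" and g: "g \<in> Hs N \<xi> d 2" and js: "1 \<le> j" "j < N" "1 \<le> s" "s < N"
  shows "nsq lam (\<lambda>z k. lap (lds f) j s z k + lap (lds g) j s z k)
      = \<kappa>0 * (\<integral>z. (cmod (lapS N h \<xi> d f j s z + lapS N h \<xi> d g j s z))\<^sup>2 * wgt lam z \<partial>Mz)"
    "nsq lam (lap (lds f) j s) = \<kappa>0 * (\<integral>z. (cmod (lapS N h \<xi> d f j s z))\<^sup>2 * wgt lam z \<partial>Mz)"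
proof -
  note F = lapS_sqi[OF f js] and G = lapS_sqi[OF g js]
  have "nsq lam (\<lambda>z k. lap (lds f) j s z k + lap (lds g) j s z k) = nsq lam (\<lambda>z k. lapS N h \<xi> d f j s z + lapS N h \<xi> d g j s z)"
    unfolding nsq_def by (intro Bochner_Integration.integral_cong refl) (auto simp: lapS_eq[OF f js, symmetric] lapS_eq[OF g js, symmetric])
  then show "nsq lam (\<lambda>z k. lap (lds f) j s z k + lap (lds g) j s z k)
      = \<kappa>0 * (\<integral>z. (cmod (lapS N h \<xi> d f j s z + lapS N h \<xi> d g j s z))\<^sup>2 * wgt lam z \<partial>Mz)"
    using nsq_const(2)[of "\<lambda>z. lapS N h \<xi> d f j s z + lapS N h \<xi> d g j s z" lam] sqi_add[OF F G] by (simp add: sqi_def)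
  have "nsq lam (lap (lds f) j s) = nsq lam (\<lambda>z k. lapS N h \<xi> d f j s z)"
    unfolding nsq_def by (intro Bochner_Integration.integral_cong refl) (auto simp: lapS_eq[OF f js, symmetric])
  then show "nsq lam (lap (lds f) j s) = \<kappa>0 * (\<integral>z. (cmod (lapS N h \<xi> d f j s z))\<^sup>2 * wgt lam z \<partial>Mz)"
    using nsq_const(2)[of "lapS N h \<xi> d f j s" lam] F by (simp add: sqi_def)
qed

lemma Ifun_eq:
  assumes Q: "Q \<in> Hs N \<xi> d 2" and W: "W \<in> Hs N \<xi> d 2"
  shows "\<kappa>0 * Ifun N h \<xi> d Q mu W = exp (2 * mu * d) *
    (\<Sum>j\<in>{1..<N}. \<Sum>s\<in>{1..<N}. h\<^sup>2 * nsq mu (\<lambda>z k. lap (lds W) j s z k + lap (lds Q) j s z k))"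
proof -
  have "(\<Sum>j\<in>{1..<N}. \<Sum>s\<in>{1..<N}. h\<^sup>2 * nsq mu (\<lambda>z k. lap (lds W) j s z k + lap (lds Q) j s z k))
    = (\<Sum>j\<in>{1..<N}. \<Sum>s\<in>{1..<N}. h\<^sup>2 * (\<kappa>0 * (\<integral>z. (cmod (lapS N h \<xi> d W j s z + lapS N h \<xi> d Q j s z))\<^sup>2 * wgt mu z \<partial>Mz)))"
    by (intro sum.cong refl) (simp add: nsq_lapS(1)[OF W Q])
  then show ?thesis
    unfolding Ifun_def set_integral_intv by (simp add: sum_distrib_left mult_ac)
qed

text \<open>Of the right-hand side only the second derivative at a single node is kept: on the zero
  boundary subspace it already controls the function and its first derivative.\<close>

lemma carleman_lift:
  assumes C: "0 < C" and lam: "0 \<le> lam" and u: "u \<in> Hs N \<xi> d 2" and js: "j \<le> N" "s \<le> N"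
    and carl: "(\<Sum>j\<in>{1..<N}. \<Sum>s\<in>{1..<N}. h\<^sup>2 *
           (LINT z:{-\<xi>..d}|lborel. (cmod (lapS N h \<xi> d u j s z))\<^sup>2 * wgt lam z))
        \<ge> C * (\<Sum>j\<le>N. \<Sum>s\<le>N. h\<^sup>2 *
           (LINT z:{-\<xi>..d}|lborel.
              ((cmod (dzs N \<xi> d 2 u 2 j s z))\<^sup>2 + lam * (cmod (dzs N \<xi> d 2 u 1 j s z))\<^sup>2
               + lam ^ 3 * (cmod (u j s z))\<^sup>2) * wgt lam z))"
  shows "C * (h\<^sup>2 * nsq lam (lds u 2 j s)) \<le> (\<Sum>j\<in>{1..<N}. \<Sum>s\<in>{1..<N}. h\<^sup>2 * nsq lam (lap (lds u) j s))"
proof -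
  let ?r = "\<lambda>j s z. ((cmod (ds u 2 j s z))\<^sup>2 + lam * (cmod (ds u 1 j s z))\<^sup>2 + lam ^ 3 * (cmod (u j s z))\<^sup>2) * wgt lam z"
  have nn: "0 \<le> ?r j s z" for j s z using lam by (intro mult_nonneg_nonneg add_nonneg_nonneg) auto
  have iw: "integrable Mz (\<lambda>z. (cmod (v z))\<^sup>2 * wgt lam z)" if v: "sqi Mz v" for v
  proof (rule Bochner_Integration.integrable_bound)
    show "integrable Mz (\<lambda>z. (cmod (v z))\<^sup>2 * wmax lam)" using v by (simp add: sqi_def)
    have "wgt lam \<in> borel_measurable Mz" by (simp add: measurable_restrict_space1)
    then show "(\<lambda>z. (cmod (v z))\<^sup>2 * wgt lam z) \<in> borel_measurable Mz"
      using sqi_measurable[OF v] by measurable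
    show "AE z in Mz. norm ((cmod (v z))\<^sup>2 * wgt lam z) \<le> norm ((cmod (v z))\<^sup>2 * wmax lam)"
    proof (rule AE_I2)
      fix z assume "z \<in> space Mz"
      then have "wgt lam z \<le> wmax lam" unfolding wmax_def by (intro wgt_bounds) simp
      then show "norm ((cmod (v z))\<^sup>2 * wgt lam z) \<le> norm ((cmod (v z))\<^sup>2 * wmax lam)"
        using wmax_pos[of lam] by (simp add: abs_mult mult_left_mono)
    qed
  qed
  have su: "sqi Mz (u j s)"
  proof -
    have "sqi Mz (ds u 0 j s) \<longleftrightarrow> sqi Mz (u j s)"
      using Hs_ds[OF u] js unfolding Hs_derivs_def by (intro sqi_cong) auto
    then show ?thesis using Hs_sqi[OF u js, of 0] by simp
  qed
  have int: "integrable Mz (?r j s)"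
  proof -
    have "integrable Mz (\<lambda>z. (cmod (ds u 2 j s z))\<^sup>2 * wgt lam z + lam * ((cmod (ds u 1 j s z))\<^sup>2 * wgt lam z) + lam ^ 3 * ((cmod (u j s z))\<^sup>2 * wgt lam z))"
      using iw[OF Hs_sqi[OF u js, of 2]] iw[OF Hs_sqi[OF u js, of 1]] iw[OF su]
      by (intro Bochner_Integration.integrable_add integrable_mult_right) auto
    then show ?thesis by (simp add: algebra_simps)
  qed
  have "(\<integral>z. (cmod (ds u 2 j s z))\<^sup>2 * wgt lam z \<partial>Mz) \<le> integral\<^sup>L Mz (?r j s)"
    using iw[OF Hs_sqi[OF u js, of 2]] int lam
    by (intro integral_mono mult_right_mono) auto
  then have "h\<^sup>2 * (\<integral>z. (cmod (ds u 2 j s z))\<^sup>2 * wgt lam z \<partial>Mz) \<le> h\<^sup>2 * integral\<^sup>L Mz (?r j s)"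
    by (rule mult_left_mono) simp
  also have "\<dots> \<le> (\<Sum>s\<le>N. h\<^sup>2 * integral\<^sup>L Mz (?r j s))"
    using js nn by (intro member_le_sum) (auto intro!: mult_nonneg_nonneg integral_nonneg_AE)
  also have "\<dots> \<le> (\<Sum>j\<le>N. \<Sum>s\<le>N. h\<^sup>2 * integral\<^sup>L Mz (?r j s))"
    using js nn by (intro member_le_sum[where f = "\<lambda>j. \<Sum>s\<le>N. h\<^sup>2 * integral\<^sup>L Mz (?r j s)"]) (auto intro!: sum_nonneg mult_nonneg_nonneg integral_nonneg_AE)
  finally have "C * (h\<^sup>2 * (\<integral>z. (cmod (ds u 2 j s z))\<^sup>2 * wgt lam z \<partial>Mz)) \<le> C * (\<Sum>j\<le>N. \<Sum>s\<le>N. h\<^sup>2 * integral\<^sup>L Mz (?r j s))"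
    using C by (intro mult_left_mono) auto
  also have "\<dots> \<le> (\<Sum>j\<in>{1..<N}. \<Sum>s\<in>{1..<N}. h\<^sup>2 * (\<integral>z. (cmod (lapS N h \<xi> d u j s z))\<^sup>2 * wgt lam z \<partial>Mz))"
    using carl unfolding set_integral_intv by simp
  finally have "\<kappa>0 * (C * (h\<^sup>2 * (\<integral>z. (cmod (ds u 2 j s z))\<^sup>2 * wgt lam z \<partial>Mz)))
     \<le> \<kappa>0 * (\<Sum>j\<in>{1..<N}. \<Sum>s\<in>{1..<N}. h\<^sup>2 * (\<integral>z. (cmod (lapS N h \<xi> d u j s z))\<^sup>2 * wgt lam z \<partial>Mz))"
    using ku_ge by (rule mult_left_mono)
  moreover have "(\<Sum>j\<in>{1..<N}. \<Sum>s\<in>{1..<N}. h\<^sup>2 * nsq lam (lap (lds u) j s))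
     = (\<Sum>j\<in>{1..<N}. \<Sum>s\<in>{1..<N}. h\<^sup>2 * (\<kappa>0 * (\<integral>z. (cmod (lapS N h \<xi> d u j s z))\<^sup>2 * wgt lam z \<partial>Mz)))"
    by (intro sum.cong refl) (simp add: nsq_lapS(2)[OF u u])
  ultimately show ?thesis
    by (simp add: nsq_lds[OF u js] sum_distrib_left mult.left_commute)
qed

section \<open>The choice of mu and the deviation of the minimiser\<close>

lemma ln_mu:
  assumes "0 < \<delta>" "\<delta> < exp (-2 * (d + \<xi>) * lam0)"
  shows "lam0 < ln (\<delta> powr (-1 / (2 * (d + \<xi>))))"
    "exp (2 * ln (\<delta> powr (-1 / (2 * (d + \<xi>)))) * (d + \<xi>)) = 1 / \<delta>"
proof -
  have mu: "ln (\<delta> powr (-1 / (2 * (d + \<xi>)))) = - ln \<delta> / (2 * (d + \<xi>))"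
    using assms by (simp add: ln_powr)
  have "ln \<delta> < -2 * (d + \<xi>) * lam0"
    using assms by (metis ln_exp ln_less_cancel_iff exp_gt_zero)
  then show "lam0 < ln (\<delta> powr (-1 / (2 * (d + \<xi>))))"
    unfolding mu using len_pos by (simp add: field_simps)
  \<comment> \<open>This mu lets the total variation of the weight across the interval cancel
    exactly one of the two powers of \<delta> in the squared noise.\<close>
  have "2 * (- ln \<delta> / (2 * (d + \<xi>))) * (d + \<xi>) = - ln \<delta>" using len_pos by (simp add: field_simps)
  then show "exp (2 * ln (\<delta> powr (-1 / (2 * (d + \<xi>)))) * (d + \<xi>)) = 1 / \<delta>"
    unfolding mu using assms by (simp add: exp_minus inverse_eq_divide)
qed

text \<open>At lateral nodes the boundary data do not prescribe the z derivative at z = -xi; there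
  it vanishes because the function is identically zero in z.\<close>

lemma tail_bc_diff_Hs0:
  assumes f: "f \<in> Hs N \<xi> d 2" "tail_bc N \<xi> d f (ds f 1) psi0 psi1"
    and g: "g \<in> Hs N \<xi> d 2" "tail_bc N \<xi> d g (ds g 1) psi0 psi1"
  shows "sdiff f g \<in> Hs0 N \<xi> d"
  unfolding Hs0_iff_H0[OF Hs_sdiff[OF f(1) g(1)]] lift_sdiff
    H0_iff[OF deriv2_combine[OF Hs_lift[OF f(1)] Hs_lift[OF g(1)]]]
proof (intro allI impI ballI conjI)
  fix j s k assume js: "j \<le> N" "s \<le> N" and k: "k \<in> K"
  have eq: "kadd (lift f) (kscale (-1) (lift g)) j s z k = f j s z - g j s z" for z
    by (simp add: kadd_def kscale_def lift_def)
  have int: "j \<in> {1..<N} \<and> s \<in> {1..<N}" if "\<not> lateral j s"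
    using js that by (auto simp: lateral_def)
  have lat: "h' j s z = 0" if "lateral j s" "z \<in> A" "tail_bc N \<xi> d h' hz p0 p1" for h' hz p0 p1 z
    using that js unfolding tail_bc_def lateral_def by blast
  have ends: "-\<xi> \<in> A" "d \<in> A" using xi_pos d_pos by auto
  show "kadd (lift f) (kscale (-1) (lift g)) j s z k = 0" if "lateral j s" "z \<in> A" for z
    unfolding eq using lat[OF that f(2)] lat[OF that g(2)] by simp
  show "kadd (lift f) (kscale (-1) (lift g)) j s (-\<xi>) k = 0"
  proof (cases "lateral j s")
    case True then show ?thesis unfolding eq using lat[OF True ends(1) f(2)] lat[OF True ends(1) g(2)] by simp
  next
    case False then show ?thesis unfolding eq using int f(2) g(2) unfolding tail_bc_def by force
  qed
  show "kadd (lift f) (kscale (-1) (lift g)) j s d k = 0"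
    unfolding eq using js f(2) g(2) unfolding tail_bc_def by force
  show "lds f 1 j s (-\<xi>) k - lds g 1 j s (-\<xi>) k = 0"
  proof (cases "lateral j s")
    case True
    have "lds f 1 j s (-\<xi>) k = 0"
      using deriv2_unique(2)[OF Hs_lift[OF f(1)] deriv2_zero js _ ends(1) k] lat[OF True _ f(2)] by (simp add: lift_def)
    moreover have "lds g 1 j s (-\<xi>) k = 0"
      using deriv2_unique(2)[OF Hs_lift[OF g(1)] deriv2_zero js _ ends(1) k] lat[OF True _ g(2)] by (simp add: lift_def)
    ultimately show ?thesis by simp
  next
    case False then show ?thesis using int f(2) g(2) unfolding tail_bc_def lift_def by force
  qed
qed

lemma lap_zero_AE:
  assumes f: "f \<in> Hs N \<xi> d 2" and js: "1 \<le> j" "j < N" "1 \<le> s" "s < N"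
    and 0: "AE z in lborel. z \<in> A \<longrightarrow> lapS N h \<xi> d f j s z = 0"
  shows "AE x in \<nu>. lap (lds f) j s (fst x) (snd x) = 0"
proof -
  have "AE z in Mz. lapS N h \<xi> d f j s z = 0"
    using 0 by (subst AE_restrict_space_iff) auto
  then have "AE z in Mz. lap (lds f) j s z k = 0" for k
    using AE_space by eventually_elim (simp add: lapS_eq[OF f js, symmetric])
  then have a: "AE z in Mz. AE k in Mk. lap (lds f) j s (fst (z, k)) (snd (z, k)) = 0"
  proof -
    have "lap (lds f) j s z k = lap (lds f) j s z 0" for z k
      by (simp add: lap_def lp_eq lift_def)
    note indep = this
    show ?thesis
    proof (rule eventually_mono[OF \<open>\<And>k. AE z in Mz. lap (lds f) j s z k = 0\<close>[of 0]])
      fix z assume "lap (lds f) j s z 0 = 0"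
      then have "lap (lds f) j s z k = 0" for k using indep by metis
      then show "AE k in Mk. lap (lds f) j s (fst (z, k)) (snd (z, k)) = 0" by simp
    qed
  qed
  show ?thesis
  proof (rule zk.AE_pair_measure[OF _ a])
    have "case_prod (lap (lds f) j s) \<in> borel_measurable \<nu>"
      using lap_L2(1)[OF Hs_lift[OF f] js] by (rule sqi_measurable)
    then have [measurable]: "(\<lambda>x. lap (lds f) j s (fst x) (snd x)) \<in> borel_measurable \<nu>"
      by (simp add: case_prod_unfold)
    show "{x \<in> space \<nu>. lap (lds f) j s (fst x) (snd x) = 0} \<in> sets \<nu>" by measurable
  qed
qed

definition CP :: real where "CP = 2 / h\<^sup>2 + 2 * ((d + \<xi>) * cQ)"

lemma CP_nonneg: "0 \<le> CP"
  using len_pos cQ_nonneg by (simp add: CP_def)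

text \<open>The competitor \<open>Vs - Qs\<close> is admissible because both functions carry the
  same exact data, and harmonicity of \<open>Vs\<close> makes the Laplacian of competitor plus Q
  that of the noise \<open>Q - Qs\<close>. The Laplacian of the deviation is the residual of W minus
  that of the competitor, and minimality bounds the former by the latter.\<close>

lemma minimizer_deviation:
  assumes C: "0 < C" and lam0: "0 \<le> lam0"
    and carl: "\<forall>lam\<ge>lam0. \<forall>u\<in>Hs0 N \<xi> d.
        (\<Sum>j\<in>{1..<N}. \<Sum>s\<in>{1..<N}. h\<^sup>2 *
           (LINT z:{-\<xi>..d}|lborel. (cmod (lapS N h \<xi> d u j s z))\<^sup>2 * wgt lam z))
        \<ge> C * (\<Sum>j\<le>N. \<Sum>s\<le>N. h\<^sup>2 *
           (LINT z:{-\<xi>..d}|lborel.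
              ((cmod (dzs N \<xi> d 2 u 2 j s z))\<^sup>2 + lam * (cmod (dzs N \<xi> d 2 u 1 j s z))\<^sup>2
               + lam ^ 3 * (cmod (u j s z))\<^sup>2) * wgt lam z))"
    and Q: "Q \<in> Hs N \<xi> d 2"
    and Qs: "Qs \<in> Hs N \<xi> d 2" "tail_bc N \<xi> d Qs (ds Qs 1) psi0s psi1s"
    and Vs: "Vs \<in> Hs N \<xi> d 2" "tail_bc N \<xi> d Vs (ds Vs 1) psi0s psi1s"
    and harm: "\<forall>j\<in>{1..<N}. \<forall>s\<in>{1..<N}. AE z in lborel. z \<in> {-\<xi>..d} \<longrightarrow> lapS N h \<xi> d Vs j s z = 0"
    and \<delta>: "0 < \<delta>" "\<delta> < exp (-2 * (d + \<xi>) * lam0)"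
    and noise: "normHs N h \<xi> d 2 (sdiff Q Qs) < \<delta>"
    and W: "W \<in> Hs0 N \<xi> d"
    and min: "\<forall>W'\<in>Hs0 N \<xi> d. Ifun N h \<xi> d Q (ln (\<delta> powr (-1 / (2 * (d + \<xi>))))) W
                            \<le> Ifun N h \<xi> d Q (ln (\<delta> powr (-1 / (2 * (d + \<xi>))))) W'"
    and js: "j \<le> N" "s \<le> N"
  shows "nsq 0 (lds (sdiff W (sdiff Vs Qs)) 2 j s) \<le> 4 / C * ((real (N - 1))\<^sup>2 * (CP * \<kappa>0))"
proof -
  define mu where "mu = ln (\<delta> powr (-1 / (2 * (d + \<xi>))))"
  have mu: "lam0 < mu" "exp (2 * mu * (d + \<xi>)) = 1 / \<delta>" unfolding mu_def by (rule ln_mu[OF \<delta>])+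
  have mu0: "0 \<le> mu" using lam0 mu by linarith
  have "exp (-2 * (d + \<xi>) * lam0) \<le> 1"
    using mult_nonneg_nonneg[OF less_imp_le[OF len_pos] lam0] by (simp add: algebra_simps)
  then have d1: "\<delta> < 1" using \<delta>(2) by linarith
  define W' where "W' = sdiff Vs Qs"
  define P where "P = sdiff Q Qs"
  define U where "U = sdiff W W'"
  have W'0: "W' \<in> Hs0 N \<xi> d" unfolding W'_def by (rule tail_bc_diff_Hs0[OF Vs Qs])
  have WH: "W \<in> Hs N \<xi> d 2" and W'H: "W' \<in> Hs N \<xi> d 2" using W W'0 by (auto simp: Hs0_def)
  have PH: "P \<in> Hs N \<xi> d 2" unfolding P_def by (rule Hs_sdiff[OF Q Qs(1)])
  have UH: "U \<in> Hs N \<xi> d 2" unfolding U_def by (rule Hs_sdiff[OF WH W'H])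
  have U0: "U \<in> Hs0 N \<xi> d"
    unfolding Hs0_iff_H0[OF UH] unfolding U_def lift_sdiff
    using W W'0 by (intro kadd_H0 kscale_H0) (simp_all add: Hs0_iff_H0[OF WH] Hs0_iff_H0[OF W'H])
  let ?a = "\<lambda>j s z k. lap (lds W) j s z k + lap (lds Q) j s z k"
  let ?a' = "\<lambda>j s z k. lap (lds W') j s z k + lap (lds Q) j s z k"
  let ?b = "\<lambda>j s. lap (lds P) j s"
  note lW = Hs_lift[OF WH] and lQ = Hs_lift[OF Q] and lW' = Hs_lift[OF W'H] and lP = Hs_lift[OF PH]
    and lU = Hs_lift[OF UH] and lVs = Hs_lift[OF Vs(1)] and lQs = Hs_lift[OF Qs(1)]
  have ae: "AE x in \<nu>. ?a' j s (fst x) (snd x) = ?b j s (fst x) (snd x)"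
    "AE x in \<nu>. lap (lds U) j s (fst x) (snd x) = ?a j s (fst x) (snd x) + (-1) * ?b j s (fst x) (snd x)"
    if js: "1 \<le> j" "j < N" "1 \<le> s" "s < N" for j s
  proof -
    have z: "AE x in \<nu>. lap (lds Vs) j s (fst x) (snd x) = 0"
      by (rule lap_zero_AE[OF Vs(1) js]) (use harm js in auto)
    have p: "AE x in \<nu>. lap (lds P) j s (fst x) (snd x) = lap (lds Q) j s (fst x) (snd x) - lap (lds Qs) j s (fst x) (snd x)"
      by (rule lap_combine_AE[OF lQ lQs lP[unfolded P_def lift_sdiff, folded P_def] js])
    have w: "AE x in \<nu>. lap (lds W') j s (fst x) (snd x) = lap (lds Vs) j s (fst x) (snd x) - lap (lds Qs) j s (fst x) (snd x)"
      by (rule lap_combine_AE[OF lVs lQs lW'[unfolded W'_def lift_sdiff, folded W'_def] js])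
    have u: "AE x in \<nu>. lap (lds U) j s (fst x) (snd x) = lap (lds W) j s (fst x) (snd x) - lap (lds W') j s (fst x) (snd x)"
      by (rule lap_combine_AE[OF lW lW' lU[unfolded U_def lift_sdiff, folded U_def] js])
    show "AE x in \<nu>. ?a' j s (fst x) (snd x) = ?b j s (fst x) (snd x)"
      using z p w by eventually_elim simp
    show "AE x in \<nu>. lap (lds U) j s (fst x) (snd x) = ?a j s (fst x) (snd x) + (-1) * ?b j s (fst x) (snd x)"
      using z p w u by eventually_elim simp
  qed
  define SB where "SB = (\<Sum>j\<in>{1..<N}. \<Sum>s\<in>{1..<N}. h\<^sup>2 * nsq mu (?b j s))"
  have "Ifun N h \<xi> d Q mu W \<le> Ifun N h \<xi> d Q mu W'" using min W'0 by (simp add: mu_def)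
  then have "\<kappa>0 * Ifun N h \<xi> d Q mu W \<le> \<kappa>0 * Ifun N h \<xi> d Q mu W'" using ku_ge by (rule mult_left_mono)
  then have "(\<Sum>j\<in>{1..<N}. \<Sum>s\<in>{1..<N}. h\<^sup>2 * nsq mu (?a j s)) \<le> (\<Sum>j\<in>{1..<N}. \<Sum>s\<in>{1..<N}. h\<^sup>2 * nsq mu (?a' j s))"
    unfolding Ifun_eq[OF Q WH] Ifun_eq[OF Q W'H] by simp
  also have "\<dots> = SB"
    unfolding SB_def
  proof (intro sum.cong refl arg_cong2[where f = "(*)"])
    fix j s assume "j \<in> {1..<N}" "s \<in> {1..<N}"
    then have js: "1 \<le> j" "j < N" "1 \<le> s" "s < N" by auto
    show "nsq mu (?a' j s) = nsq mu (?b j s)"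
      by (rule nsq_cong_AE[OF L2_add[OF lap_L2(1)[OF lW' js] lap_L2(1)[OF lQ js]] lap_L2(1)[OF lP js] ae(1)[OF js]])
  qed
  finally have Sa: "(\<Sum>j\<in>{1..<N}. \<Sum>s\<in>{1..<N}. h\<^sup>2 * nsq mu (?a j s)) \<le> SB" .
  have "C * (h\<^sup>2 * nsq mu (lds U 2 j s)) \<le> (\<Sum>j\<in>{1..<N}. \<Sum>s\<in>{1..<N}. h\<^sup>2 * nsq mu (lap (lds U) j s))"
    using carl U0 mu(1) by (intro carleman_lift[OF C mu0 UH js]) auto
  also have "\<dots> \<le> (\<Sum>j\<in>{1..<N}. \<Sum>s\<in>{1..<N}. 2 * (h\<^sup>2 * nsq mu (?a j s)) + 2 * (h\<^sup>2 * nsq mu (?b j s)))"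
  proof (intro sum_mono)
    fix j s assume "j \<in> {1..<N}" "s \<in> {1..<N}"
    then have js: "1 \<le> j" "j < N" "1 \<le> s" "s < N" by auto
    note La = L2_add[OF lap_L2(1)[OF lW js] lap_L2(1)[OF lQ js]] and Lb = lap_L2(1)[OF lP js]
    have Lb': "L2 (\<lambda>z k. (-1) * ?b j s z k)"
      using sqi_cmult[OF Lb, of "-1"] by (simp add: case_prod_unfold)
    have "nsq mu (lap (lds U) j s) = nsq mu (\<lambda>z k. ?a j s z k + (-1) * ?b j s z k)"
      by (rule nsq_cong_AE[OF lap_L2(1)[OF lU js] L2_add[OF La Lb'] ae(2)[OF js]])
    also have "\<dots> \<le> 2 * nsq mu (?a j s) + 2 * nsq mu (\<lambda>z k. (-1) * ?b j s z k)"
      by (rule nsq_add[OF La Lb'])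
    also have "nsq mu (\<lambda>z k. (-1) * ?b j s z k) = nsq mu (?b j s)" by (subst nsq_cmult) simp
    finally have "h\<^sup>2 * nsq mu (lap (lds U) j s) \<le> h\<^sup>2 * (2 * nsq mu (?a j s) + 2 * nsq mu (?b j s))"
      by (rule mult_left_mono) simp
    then show "h\<^sup>2 * nsq mu (lap (lds U) j s) \<le> 2 * (h\<^sup>2 * nsq mu (?a j s)) + 2 * (h\<^sup>2 * nsq mu (?b j s))"
      by (simp add: algebra_simps)
  qed
  also have "\<dots> = 2 * (\<Sum>j\<in>{1..<N}. \<Sum>s\<in>{1..<N}. h\<^sup>2 * nsq mu (?a j s)) + 2 * SB"
    by (simp add: sum.distrib sum_distrib_left SB_def)
  also have "\<dots> \<le> 4 * SB" using Sa by linarith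
  \<comment> \<open>The weight is largest at z = -xi, with value
    \<open>exp (2 * mu * \<xi>)\<close>.\<close>
  also have "SB \<le> (\<Sum>j\<in>{1..<N}. \<Sum>s\<in>{1..<N}. h\<^sup>2 * (exp (2 * mu * \<xi>) * (CP * (\<kappa>0 * \<delta>\<^sup>2))))"
    unfolding SB_def
  proof (intro sum_mono mult_left_mono)
    fix j s assume "j \<in> {1..<N}" "s \<in> {1..<N}"
    then have js: "1 \<le> j" "j < N" "1 \<le> s" "s < N" by auto
    have "nsq mu (?b j s) \<le> exp (2 * mu * \<xi>) * nsq 0 (?b j s)"
    proof (rule nsq_mono[OF lap_L2(1)[OF lP js]])
      fix z k assume "z \<in> A" "k \<in> K"
      then have "0 \<le> 2 * mu * (\<xi> + z)" using mu0 by simp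
      then show "wgt mu z \<le> exp (2 * mu * \<xi>) * wgt 0 z" by (simp add: wgt_def algebra_simps)
    qed
    also have "\<dots> \<le> exp (2 * mu * \<xi>) * (CP * (\<kappa>0 * \<delta>\<^sup>2))"
    proof (intro mult_left_mono)
      have "0 \<le> normHs N h \<xi> d 2 P"
        unfolding normHs_def set_integral_intv
        by (rule real_sqrt_ge_zero) (intro sum_nonneg mult_nonneg_nonneg integral_nonneg_AE; simp)
      then have "(normHs N h \<xi> d 2 P)\<^sup>2 \<le> \<delta>\<^sup>2" using noise unfolding P_def by (intro power_mono) auto
      then have "CP * (nrm (lift P))\<^sup>2 \<le> CP * (\<kappa>0 * \<delta>\<^sup>2)"
        unfolding normHs_lift[OF PH] using CP_nonneg ku_ge by (intro mult_left_mono) auto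
      then show "nsq 0 (?b j s) \<le> CP * (\<kappa>0 * \<delta>\<^sup>2)"
        using lap_L2(2)[OF lP js] unfolding CP_def by linarith
    qed simp
    finally show "nsq mu (?b j s) \<le> exp (2 * mu * \<xi>) * (CP * (\<kappa>0 * \<delta>\<^sup>2))" .
  qed simp
  also have "\<dots> = h\<^sup>2 * (exp (2 * mu * \<xi>) * ((real (N - 1))\<^sup>2 * (CP * (\<kappa>0 * \<delta>\<^sup>2))))"
    by (cases "N = 0") (simp_all add: power2_eq_square of_nat_diff)
  finally have "h\<^sup>2 * (C * nsq mu (lds U 2 j s)) \<le> h\<^sup>2 * (4 * (exp (2 * mu * \<xi>) * ((real (N - 1))\<^sup>2 * (CP * (\<kappa>0 * \<delta>\<^sup>2)))))"
    by (simp add: mult.left_commute)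
  then have "C * nsq mu (lds U 2 j s) \<le> 4 * (exp (2 * mu * \<xi>) * ((real (N - 1))\<^sup>2 * (CP * (\<kappa>0 * \<delta>\<^sup>2))))"
    using h_pos by simp
  then have nU: "nsq mu (lds U 2 j s) \<le> 4 / C * (exp (2 * mu * \<xi>) * ((real (N - 1))\<^sup>2 * (CP * (\<kappa>0 * \<delta>\<^sup>2))))"
    using C by (simp add: field_simps)
  have "nsq 0 (lds U 2 j s) \<le> exp (2 * mu * d) * nsq mu (lds U 2 j s)"
    by (rule nsq_unweighted_le[OF deriv2D(7)[OF lU js] mu0])
  also have "\<dots> \<le> exp (2 * mu * d) * (4 / C * (exp (2 * mu * \<xi>) * ((real (N - 1))\<^sup>2 * (CP * (\<kappa>0 * \<delta>\<^sup>2)))))"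
    by (rule mult_left_mono[OF nU]) simp
  \<comment> \<open>The exponential from bounding the weight above and the one from removing it
    below combine to \<open>1 / \<delta>\<close>, so one power of \<delta> survives.\<close>
  also have "\<dots> = (exp (2 * mu * (d + \<xi>)) * \<delta>\<^sup>2) * (4 / C * ((real (N - 1))\<^sup>2 * (CP * \<kappa>0)))"
    by (simp add: distrib_left exp_add mult_ac)
  also have "exp (2 * mu * (d + \<xi>)) * \<delta>\<^sup>2 = \<delta>" using mu(2) \<delta>(1) by (simp add: power2_eq_square)
  also have "\<delta> * (4 / C * ((real (N - 1))\<^sup>2 * (CP * \<kappa>0))) \<le> 1 * (4 / C * ((real (N - 1))\<^sup>2 * (CP * \<kappa>0)))"
    using d1 C CP_nonneg ku_ge by (intro mult_right_mono mult_nonneg_nonneg) auto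
  finally show ?thesis by (simp add: U_def W'_def)
qed

text \<open>The tail is the deviation of the minimiser plus the exact tail plus the noise. The
  deviation has zero boundary data and is bounded through its second derivative; the other two are
  bounded by the Sobolev inequality. Division by \<open>\<kappa>0\<close> undoes the
  lifting.\<close>

lemma tail_bound_of_parts:
  assumes U: "U \<in> Hs0 N \<xi> d" and B: "\<And>j s. j \<le> N \<Longrightarrow> s \<le> N \<Longrightarrow> nsq 0 (lds U 2 j s) \<le> B"
    and V: "V \<in> Hs N \<xi> d 2" and P: "P \<in> Hs N \<xi> d 2" "(normHs N h \<xi> d 2 P)\<^sup>2 \<le> 1"
    and T: "T \<in> Hs N \<xi> d 2" "\<And>j s z. T j s z = U j s z + V j s z + P j s z"
  shows "tail_bound T ((2 * (2 * (((d + \<xi>) + (d + \<xi>)^3) * B) + 2 * (cS / h\<^sup>2 * (\<kappa>0 * (normHs N h \<xi> d 2 V)\<^sup>2))) + 2 * (cS / h\<^sup>2 * \<kappa>0)) / \<kappa>0)"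
    (is "tail_bound T (?S / \<kappa>0)")
proof -
  have UH: "U \<in> Hs N \<xi> d 2" using U by (simp add: Hs0_def)
  have U0: "lift U \<in> H0" using U Hs0_iff_H0[OF UH] by simp
  note lU = Hs_lift[OF UH] and lV = Hs_lift[OF V] and lP = Hs_lift[OF P(1)] and lT = Hs_lift[OF T(1)]
  have eq: "lift T = kadd (kadd (lift U) (lift V)) (lift P)" by (simp add: lift_def kadd_def T(2) fun_eq_iff)
  have S: "deriv2 (lift T) (\<lambda>i j s z k. lds U i j s z k + lds V i j s z k + lds P i j s z k)"
    unfolding eq by (rule deriv2_add[OF deriv2_add[OF lU lV] lP])
  have main: "Sb 0 (lds T i j s) ?S" if js: "j \<le> N" "s \<le> N" and i: "i = 0 \<or> i = 1" for i j s
  proof -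
    have B0: "0 \<le> B" using B[OF js] nsq_nonneg[of 0 "lds U 2 j s"] by linarith
    note J = H0_jets[OF U0 lU js disjI2, of 0 "d + \<xi>"]
    let ?n = "nsq 0 (lds U 2 j s)"
    have a: "(d + \<xi>) * ?n \<le> (d + \<xi>) * B" using B[OF js] len_pos by (intro mult_left_mono) auto
    have b: "(d + \<xi>) * ((d + \<xi>) * ((d + \<xi>) * ?n)) \<le> (d + \<xi>)^3 * B"
      using B[OF js] len_pos by (simp add: power3_eq_cube mult.assoc)
    have c: "0 \<le> (d + \<xi>) * B" "0 \<le> (d + \<xi>)^3 * B" using B0 len_pos by auto
    have "(d + \<xi>) * ?n \<le> ((d + \<xi>) + (d + \<xi>)^3) * B"
      "(d + \<xi>) * ((d + \<xi>) * ((d + \<xi>) * ?n)) \<le> ((d + \<xi>) + (d + \<xi>)^3) * B"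
      using a b c unfolding distrib_right by linarith+
    then have SU: "Sb 0 (lds U i j s) (((d + \<xi>) + (d + \<xi>)^3) * B)"
      using Sb_mono[OF J(1)] Sb_mono[OF J(2)] i by auto
    have SV: "Sb 0 (lds V i j s) (cS / h\<^sup>2 * (\<kappa>0 * (normHs N h \<xi> d 2 V)\<^sup>2))"
      using HK_nodes_Sb[OF lV js] i unfolding normHs_lift[OF V] by auto
    have "\<kappa>0 * (normHs N h \<xi> d 2 P)\<^sup>2 \<le> \<kappa>0" using P(2) ku_ge mult_left_mono[OF P(2), of \<kappa>0] by simp
    then have "cS / h\<^sup>2 * (nrm (lift P))\<^sup>2 \<le> cS / h\<^sup>2 * \<kappa>0"
      unfolding normHs_lift[OF P(1)] using cS_nonneg by (intro mult_left_mono) auto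
    then have SP: "Sb 0 (lds P i j s) (cS / h\<^sup>2 * \<kappa>0)"
      using Sb_mono[OF HK_nodes_Sb(1)[OF lP js]] Sb_mono[OF HK_nodes_Sb(2)[OF lP js]] i by auto
    show ?thesis
      by (rule Sb_cong[OF Sb_add[OF Sb_add[OF SU SV] SP]])
        (use deriv2_unique(1,2)[OF lT S js refl] i in auto)
  qed
  have pt: "(cmod (ds T i j s z))\<^sup>2 \<le> ?S / \<kappa>0" if "j \<le> N" "s \<le> N" "i = 0 \<or> i = 1" "z \<in> A" for i j s z
  proof -
    have "wgt 0 z * (\<integral>k. (cmod (lds T i j s z k))\<^sup>2 \<partial>Mk) \<le> ?S" using main[OF that(1-3)] that(4) unfolding Sb_def by blast
    then have "(cmod (ds T i j s z))\<^sup>2 * \<kappa>0 \<le> ?S" by (simp add: lift_def mult.commute)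
    then show ?thesis using kappa0_pos by (simp add: pos_le_divide_eq)
  qed
  have T0: "ds T 0 j s z = T j s z" if "j \<le> N" "s \<le> N" "z \<in> A" for j s z
    using Hs_ds[OF T(1)] that unfolding Hs_derivs_def by blast
  show ?thesis
    unfolding tail_bound_def
  proof (intro allI impI conjI ballI)
    fix j s assume js: "j \<le> N" "s \<le> N"
    have "T j s \<in> borel_measurable Mz \<longleftrightarrow> ds T 0 j s \<in> borel_measurable Mz"
      by (rule measurable_cong) (simp add: T0[OF js])
    then show "T j s \<in> borel_measurable Mz" using Hs_sqi[OF T(1) js, of 0] by (simp add: sqi_def)
    show "ds T 1 j s \<in> borel_measurable Mz" using Hs_sqi[OF T(1) js, of 1] by (simp add: sqi_def)
    fix z assume z: "z \<in> A"
    show "(cmod (T j s z))\<^sup>2 \<le> ?S / \<kappa>0" using pt[OF js _ z, of 0] T0[OF js z] by simp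
    show "(cmod (ds T 1 j s z))\<^sup>2 \<le> ?S / \<kappa>0" by (rule pt[OF js _ z]) simp
  qed
qed

section \<open>Noisy boundary data\<close>

lemma Hk3_kdiff:
  assumes "F \<in> Hk N \<xi> d kl ku 3" "G \<in> Hk N \<xi> d kl ku 3"
  shows "kdiff F G \<in> Hk N \<xi> d kl ku 3"
proof -
  obtain D E where D: "Hk_derivs N \<xi> d kl ku 3 F D" and E: "Hk_derivs N \<xi> d kl ku 3 G E"
    using assms unfolding Hk_def by blast
  have "Hk_derivs N \<xi> d kl ku 3 (kdiff F G) (\<lambda>i j s z k. D i j s z k - E i j s z k)"
    unfolding Hk_derivs_iff
  proof (intro allI impI conjI ballI)
    fix j s assume js: "j \<le> N" "s \<le> N"
    show "D 0 j s z k - E 0 j s z k = kdiff F G j s z k" if "k \<in> K" "z \<in> A" for z k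
      using D E js that by (simp add: Hk_derivs_iff kdiff_def)
    show "ac_on (-\<xi>) d (\<lambda>z. D i j s z k - E i j s z k) (\<lambda>z. D (Suc i) j s z k - E (Suc i) j s z k)"
      if "k \<in> K" "i < 3" for k i
      using D E js that unfolding Hk_derivs_iff by (intro ac_on_diff) blast+
    show "sqi Mz (\<lambda>z. D 3 j s z k - E 3 j s z k)" if "k \<in> K" for k
      using D E js that unfolding Hk_derivs_iff by (intro sqi_diff) blast+
    show "L2 (\<lambda>z k. D i j s z k - E i j s z k)" if "i \<le> 3" for i
    proof -
      have "L2 (D i j s)" "L2 (E i j s)" using D E js that unfolding Hk_derivs_iff by blast+
      from sqi_diff[OF this] show ?thesis by (simp add: case_prod_unfold)
    qed
  qed
  then show ?thesis unfolding Hk_def by blast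
qed

text \<open>Noise of norm at most 1 lets the norm of the exact data stand in for that of the noisy
  ones.\<close>

lemma boundary_data_bound:
  assumes F: "F \<in> Hk N \<xi> d kl ku 3" and G: "G \<in> Hk N \<xi> d kl ku 3"
    and d: "normHk N h \<xi> d kl ku 3 (kdiff F G) \<le> 1"
  shows "F \<in> HK" "(nrm F)\<^sup>2 \<le> 2 + 2 * (normHk N h \<xi> d kl ku 3 G)\<^sup>2"
proof -
  note D = Hk3_norm_le[OF Hk3_kdiff[OF F G]] and g = Hk3_norm_le[OF G]
  show "F \<in> HK" by (rule Hk3_norm_le(1)[OF F])
  have "F = kadd (kdiff F G) G" by (simp add: kadd_def kdiff_def fun_eq_iff)
  then have "(nrm F)\<^sup>2 \<le> 2 * (nrm (kdiff F G))\<^sup>2 + 2 * (nrm G)\<^sup>2"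
    using nrm_add_sq_le[OF D(1) g(1)] by simp
  moreover have "(nrm (kdiff F G))\<^sup>2 \<le> 1\<^sup>2" using D d nrm_nonneg[OF D(1)] by (intro power_mono) auto
  moreover have "(nrm G)\<^sup>2 \<le> (normHk N h \<xi> d kl ku 3 G)\<^sup>2" using g nrm_nonneg[OF g(1)] by (intro power_mono) auto
  ultimately show "(nrm F)\<^sup>2 \<le> 2 + 2 * (normHk N h \<xi> d kl ku 3 G)\<^sup>2" by simp
qed

end

theorem theorem7p3:
  fixes b \<xi> d h :: real and N :: nat
    and kl ku :: real
    and lam0 :: real
    and R MF MV :: real
  assumes b_pos: "b > 0" and xi_pos: "\<xi> > 0" and d_pos: "d > 0" and h_pos: "h > 0"
    and grid: "real N * h = 2 * b"
    and k_bounds: "0 < kl" "kl < ku"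
    and lam0_gt: "lam0 > 1"
    and carleman: "\<exists>C>0. \<forall>lam\<ge>lam0. \<forall>u\<in>Hs0 N \<xi> d.
        (\<Sum>j\<in>{1..<N}. \<Sum>s\<in>{1..<N}. h\<^sup>2 *
           (LINT z:{-\<xi>..d}|lborel. (cmod (lapS N h \<xi> d u j s z))\<^sup>2 * wgt lam z))
        \<ge> C * (\<Sum>j\<le>N. \<Sum>s\<le>N. h\<^sup>2 *
           (LINT z:{-\<xi>..d}|lborel.
              ((cmod (dzs N \<xi> d 2 u 2 j s z))\<^sup>2 + lam * (cmod (dzs N \<xi> d 2 u 1 j s z))\<^sup>2
               + lam ^ 3 * (cmod (u j s z))\<^sup>2) * wgt lam z))"
    and R_pos: "R > 0"
  shows "\<exists>lam1 C1. lam1 \<ge> lam0 \<and> C1 > 0 \<and>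
    (\<forall>\<delta> psi0 psi1 psi0s psi1s Q Qs Vs W phi0 phi1 phi0s phi1s F Fs.
       ( \<comment> \<open>tail data and tail functions\<close>
         Q \<in> Hs N \<xi> d 2 \<and> tail_bc N \<xi> d Q (dzs N \<xi> d 2 Q 1) psi0 psi1 \<and>
         Qs \<in> Hs N \<xi> d 2 \<and> tail_bc N \<xi> d Qs (dzs N \<xi> d 2 Qs 1) psi0s psi1s \<and>
         Vs \<in> Hs N \<xi> d 2 \<and> tail_bc N \<xi> d Vs (dzs N \<xi> d 2 Vs 1) psi0s psi1s \<and>
         (\<forall>j\<in>{1..<N}. \<forall>s\<in>{1..<N}.
            AE z in lborel. z \<in> {-\<xi>..d} \<longrightarrow> lapS N h \<xi> d Vs j s z = 0) \<and>
         0 < \<delta> \<and> \<delta> < exp (-2 * (d + \<xi>) * lam0) \<and>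
         normHs N h \<xi> d 2 (sdiff Q Qs) < \<delta> \<and>
         \<comment> \<open>W = W_{mu(delta)} minimises I_{mu(delta)} over H_0^{2,h}\<close>
         W \<in> Hs0 N \<xi> d \<and>
         (\<forall>W'\<in>Hs0 N \<xi> d. Ifun N h \<xi> d Q (ln (\<delta> powr (-1 / (2 * (d + \<xi>))))) W
                            \<le> Ifun N h \<xi> d Q (ln (\<delta> powr (-1 / (2 * (d + \<xi>))))) W') \<and>
         \<comment> \<open>boundary data F, F_*\<close>
         F \<in> Hk N \<xi> d kl ku 3 \<and> Fs \<in> Hk N \<xi> d kl ku 3 \<and>
         (\<forall>k\<in>{kl..ku}. tail_bc N \<xi> d (\<lambda>j s z. F j s z k)
              (\<lambda>j s z. dzk N \<xi> d kl ku 3 F 1 j s z k) (\<lambda>j s. phi0 j s k) (\<lambda>j s. phi1 j s k)) \<and>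
         (\<forall>k\<in>{kl..ku}. tail_bc N \<xi> d (\<lambda>j s z. Fs j s z k)
              (\<lambda>j s z. dzk N \<xi> d kl ku 3 Fs 1 j s z k) (\<lambda>j s. phi0s j s k) (\<lambda>j s. phi1s j s k)) \<and>
         normHk N h \<xi> d kl ku 3 (kdiff F Fs) < \<delta> \<and>
         \<delta> < exp (-2 * (d + \<xi>) * lam1) \<and>
         \<comment> \<open>the parameters on which lambda_1, C_1 depend\<close>
         normHk N h \<xi> d kl ku 3 Fs = MF \<and> normHs N h \<xi> d 2 Vs = MV)
       \<longrightarrow>
       \<comment> \<open>(i) Frechet differentiability of J_lambda on H^h_{0,2}, with V = W + Q\<close>
       (\<forall>lam. \<forall>p\<in>Hk02 N \<xi> d kl ku. \<exists>g.
          frechet_H02 N h \<xi> d kl ku (Jfun N h \<xi> d kl ku (sadd W Q) F lam) p g) \<and>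
       \<comment> \<open>(ii) strong convexity on the closed ball of radius R\<close>
       (\<forall>lam\<ge>lam1. \<forall>p r g.
          p \<in> Hk02 N \<xi> d kl ku \<and> normHk N h \<xi> d kl ku 2 p \<le> R \<and>
          kadd p r \<in> Hk02 N \<xi> d kl ku \<and> normHk N h \<xi> d kl ku 2 (kadd p r) \<le> R \<and>
          frechet_H02 N h \<xi> d kl ku (Jfun N h \<xi> d kl ku (sadd W Q) F lam) p g
          \<longrightarrow>
          Jfun N h \<xi> d kl ku (sadd W Q) F lam (kadd p r) - Jfun N h \<xi> d kl ku (sadd W Q) F lam p
            - ipHk N h \<xi> d kl ku 2 g r
          \<ge> C1 * (normHk N h \<xi> d kl ku 2 r)\<^sup>2))"
proof -
  interpret semidiscrete_grid N h \<xi> d kl ku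
    using h_pos xi_pos d_pos k_bounds by unfold_locales
  obtain C where C: "0 < C" and carl: "\<forall>lam\<ge>lam0. \<forall>u\<in>Hs0 N \<xi> d.
        (\<Sum>j\<in>{1..<N}. \<Sum>s\<in>{1..<N}. h\<^sup>2 *
           (LINT z:{-\<xi>..d}|lborel. (cmod (lapS N h \<xi> d u j s z))\<^sup>2 * wgt lam z))
        \<ge> C * (\<Sum>j\<le>N. \<Sum>s\<le>N. h\<^sup>2 *
           (LINT z:{-\<xi>..d}|lborel.
              ((cmod (dzs N \<xi> d 2 u 2 j s z))\<^sup>2 + lam * (cmod (dzs N \<xi> d 2 u 1 j s z))\<^sup>2
               + lam ^ 3 * (cmod (u j s z))\<^sup>2) * wgt lam z))"
    using carleman by (elim exE conjE) (rule that)
  \<comment> \<open>These constants are fixed before any data are introduced: F and the tail enter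
    only through \<open>MF\<close> and \<open>MV\<close>. The number B bounds the deviation of the
    minimiser for every admissible noise level.\<close>
  define B where "B = 4 / C * ((real (N - 1))\<^sup>2 * (CP * \<kappa>0))"
  define g where "g = (2 * (2 * (((d + \<xi>) + (d + \<xi>)^3) * B) + 2 * (cS / h\<^sup>2 * (\<kappa>0 * MV\<^sup>2))) + 2 * (cS / h\<^sup>2 * \<kappa>0)) / \<kappa>0"
  define M where "M = 2 + 2 * MF\<^sup>2"
  define lam1 where "lam1 = max lam0 (4 * (real (N - 1))\<^sup>2 * C3 g (2 * R\<^sup>2 + 2 * M) (4 * R\<^sup>2))"
  have bounds: "tail_bound (sadd W Q) g \<and> F \<in> HK \<and> (nrm F)\<^sup>2 \<le> M"
    if Q: "Q \<in> Hs N \<xi> d 2" and Qs: "Qs \<in> Hs N \<xi> d 2" "tail_bc N \<xi> d Qs (dzs N \<xi> d 2 Qs 1) psi0s psi1s"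
      and Vs: "Vs \<in> Hs N \<xi> d 2" "tail_bc N \<xi> d Vs (dzs N \<xi> d 2 Vs 1) psi0s psi1s"
      and harm: "\<forall>j\<in>{1..<N}. \<forall>s\<in>{1..<N}. AE z in lborel. z \<in> {-\<xi>..d} \<longrightarrow> lapS N h \<xi> d Vs j s z = 0"
      and \<delta>: "0 < \<delta>" "\<delta> < exp (-2 * (d + \<xi>) * lam0)"
      and noise: "normHs N h \<xi> d 2 (sdiff Q Qs) < \<delta>" and W: "W \<in> Hs0 N \<xi> d"
      and min: "\<forall>W'\<in>Hs0 N \<xi> d. Ifun N h \<xi> d Q (ln (\<delta> powr (-1 / (2 * (d + \<xi>))))) W
                            \<le> Ifun N h \<xi> d Q (ln (\<delta> powr (-1 / (2 * (d + \<xi>))))) W'"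
      and F: "F \<in> Hk N \<xi> d kl ku 3" and Fs: "Fs \<in> Hk N \<xi> d kl ku 3"
      and noiseF: "normHk N h \<xi> d kl ku 3 (kdiff F Fs) < \<delta>"
      and MF: "normHk N h \<xi> d kl ku 3 Fs = MF" and MV: "normHs N h \<xi> d 2 Vs = MV"
    for \<delta> psi0s psi1s Q Qs Vs W F Fs
  proof -
    have "exp (-2 * (d + \<xi>) * lam0) \<le> 1"
      using mult_nonneg_nonneg[OF less_imp_le[OF len_pos], of lam0] lam0_gt by (simp add: algebra_simps)
    then have d1: "\<delta> < 1" using \<delta>(2) by linarith
    have WH: "W \<in> Hs N \<xi> d 2" using W by (simp add: Hs0_def)
    let ?U = "sdiff W (sdiff Vs Qs)" and ?P = "sdiff Q Qs"
    have PH: "?P \<in> Hs N \<xi> d 2" by (rule Hs_sdiff[OF Q Qs(1)])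
    \<comment> \<open>The decomposition used is
      \<open>W + Q = (W - (Vs - Qs)) + Vs + (Q - Qs)\<close>.\<close>
    have W'0: "sdiff Vs Qs \<in> Hs0 N \<xi> d" by (rule tail_bc_diff_Hs0[OF Vs Qs])
    then have W'H: "sdiff Vs Qs \<in> Hs N \<xi> d 2" by (simp add: Hs0_def)
    have U0: "?U \<in> Hs0 N \<xi> d"
      unfolding Hs0_iff_H0[OF Hs_sdiff[OF WH W'H]] lift_sdiff[of W]
      using W W'0 by (intro kadd_H0 kscale_H0) (simp_all add: Hs0_iff_H0[OF WH] Hs0_iff_H0[OF W'H])
    have "0 \<le> normHs N h \<xi> d 2 ?P"
      unfolding normHs_def set_integral_intv
      by (rule real_sqrt_ge_zero) (intro sum_nonneg mult_nonneg_nonneg integral_nonneg_AE; simp)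
    then have P1: "(normHs N h \<xi> d 2 ?P)\<^sup>2 \<le> 1" using noise d1 by (intro power_le_one) auto
    have T: "sadd W Q \<in> Hs N \<xi> d 2" using Hs_comb[OF WH Q, of 1] by (simp add: sadd_def)
    have "tail_bound (sadd W Q) g"
      unfolding g_def MV[symmetric]
    proof (rule tail_bound_of_parts[OF U0 _ Vs(1) PH P1 T])
      show "nsq 0 (lds ?U 2 j s) \<le> B" if "j \<le> N" "s \<le> N" for j s
        unfolding B_def
        by (rule minimizer_deviation[OF C _ carl Q Qs Vs harm \<delta> noise W min that]) (use lam0_gt in simp)
    qed (simp add: sadd_def sdiff_def)
    moreover have "F \<in> HK" "(nrm F)\<^sup>2 \<le> M"
      using boundary_data_bound[OF F Fs] noiseF d1 by (auto simp: M_def MF[symmetric])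
    ultimately show ?thesis by blast
  qed
  show ?thesis
  proof (rule exI[of _ lam1], rule exI[of _ "1 / (4 * Cn)"], intro conjI allI impI ballI, goal_cases)
    case 1 then show ?case by (simp add: lam1_def)
  next
    case 2 then show ?case using Cn_pos by simp
  next
    case (3 \<delta> psi0 psi1 psi0s psi1s Q Qs Vs W phi0 phi1 phi0s phi1s F Fs lam p)
    have s: "tail_bound (sadd W Q) g \<and> F \<in> HK \<and> (nrm F)\<^sup>2 \<le> M"
      using 3(1) by (elim conjE) (rule bounds[where psi0s = psi0s and psi1s = psi1s and \<delta> = \<delta> and Qs = Qs and Vs = Vs and Fs = Fs]; assumption)
    from representer_exists[of "sadd W Q" g F p lam] s 3(2)
    obtain G where "G \<in> H0" "\<forall>r\<in>H0. ip G r = lin (sadd W Q) lam (kadd p F) r" by blast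
    with s 3(2) have "frechet_H02 N h \<xi> d kl ku (Jfun N h \<xi> d kl ku (sadd W Q) F lam) p G"
      by (intro frechet_of_representer[of _ g]) blast+
    then show ?case by blast
  next
    case (4 \<delta> psi0 psi1 psi0s psi1s Q Qs Vs W phi0 phi1 phi0s phi1s F Fs lam p r g')
    have "tail_bound (sadd W Q) g \<and> F \<in> HK \<and> (nrm F)\<^sup>2 \<le> M"
      using 4(1) by (elim conjE) (rule bounds[where psi0s = psi0s and psi1s = psi1s and \<delta> = \<delta> and Qs = Qs and Vs = Vs and Fs = Fs]; assumption)
    then have s: "tail_bound (sadd W Q) g" "F \<in> HK" "(nrm F)\<^sup>2 \<le> M" by blast+
    from 4(3) have p: "p \<in> H0" "nrm p \<le> R" and pr: "kadd p r \<in> H0" "nrm (kadd p r) \<le> R"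
      and g': "frechet_H02 N h \<xi> d kl ku (Jfun N h \<xi> d kl ku (sadd W Q) F lam) p g'" by blast+
    have lam: "1 \<le> lam" "4 * (real (N - 1))\<^sup>2 * C3 g (2 * R\<^sup>2 + 2 * M) (4 * R\<^sup>2) \<le> lam"
      using 4(2) lam0_gt by (auto simp: lam1_def)
    note conv = strong_convexity[OF s p pr lam]
    from representer_exists[OF s(1,2) p(1), of lam]
    obtain G where G: "G \<in> H0" "\<And>r. r \<in> H0 \<Longrightarrow> ip G r = lin (sadd W Q) lam (kadd p F) r" by blast
    have "ip g' r = ip G r"
      by (rule frechet_unique[OF g' frechet_of_representer[OF s(1,2) p(1) G] conv(2)])
    then show ?case using conv(1) G(2)[OF conv(2)] by simp
  qed
qed

end
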